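(* Let $p$ be a prime and let $G=C_{p^{i_1}}\times\cdots\times C_{p^{i_n}}$ be a finite abelian $p$-group, where $i_1,\dots,i_n\ge1$ and $C_m$ denotes the cyclic group of order $m$. Then the ring $R^*_{\mathbb C}(G)$ is generated by elements $x_1,\dots,x_n$ of degree $1$ such that any monomial in any relation between these in $R^*_{\mathbb C}(G)\otimes\mathbb F_p$ features some $x_k^{p^{i_k}}$; that is: if $f\in\mathbb F_p[X_1,\dots,X_n]$ satisfies $f(x_1,\dots,x_n)=0$ in $R^*_{\mathbb C}(G)\otimes_{\mathbb Z}\mathbb F_p$, then every monomial occurring in $f$ with nonzero coefficient is divisible by $X_k^{p^{i_k}}$ for some index $k$.
   Context: Let $G$ be a finite group. $R_{\mathbb C}(G)$ is the ring of virtual complex characters of $G$ (the free abelian group on the irreducible complex characters, with product induced by tensor product), with augmentation $\epsilon:R_{\mathbb C}(G)\to\mathbb Z$ the degree map and $I=\ker\epsilon$. Exterior powers of representations give maps $\lambda^n$ on characters, extended to $R_{\mathbb C}(G)$ by requiring $\lambda^0=1$ and $\lambda^n(x+y)=\sum_{i+j=n}\lambda^i(x)\lambda^j(y)$. Put $\gamma^n(x)=\lambda^n(x+n-1)$. Let $\Gamma^n\subseteq R_{\mathbb C}(G)$ be the additive subgroup generated by all products $\gamma^{i_1}(x_1)\cdots\gamma^{i_r}(x_r)$ with $x_j\in I$ and $\sum_j i_j\ge n$; then $\Gamma^0=R_{\mathbb C}(G)$, $\Gamma^1=I$, $\Gamma^m\Gamma^n\subseteq\Gamma^{m+n}$. The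 graded character ring is $R^*_{\mathbb C}(G)=\bigoplus_{n\ge0}\Gamma^n/\Gamma^{n+1}$. *)

theory Defs
  imports
    "HOL-Algebra.Algebra"
    "HOL-Number_Theory.Residues"
    "Jordan_Normal_Form.VS_Connect"
begin

section \<open>Complex representations and their characters\<close>

text \<open>A representation of dimension \<open>d\<close> (possibly \<open>0\<close>) is a homomorphism to \<open>GL\<^sub>d(\<complex>)\<close>, the group
  of units of the ring of \<open>d \<times> d\<close> matrices.\<close>

definition representation :: "('a, 'b) monoid_scheme \<Rightarrow> nat \<Rightarrow> ('a \<Rightarrow> complex mat) \<Rightarrow> bool" where
  "representation G d \<rho> \<longleftrightarrow> \<rho> \<in> hom G (units_of (ring_mat TYPE(complex) d ()))"

definition irreducible_rep :: "('a, 'b) monoid_scheme \<Rightarrow> nat \<Rightarrow> ('a \<Rightarrow> complex mat) \<Rightarrow> bool" where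
  "irreducible_rep G d \<rho> \<longleftrightarrow>
     representation G d \<rho> \<and> d > 0 \<and>
     (\<forall>W. subspace class_ring W (module_vec TYPE(complex) d) \<and>
          (\<forall>g\<in>carrier G. \<forall>w\<in>W. \<rho> g *\<^sub>v w \<in> W) \<longrightarrow>
          W = {0\<^sub>v d} \<or> W = carrier_vec d)"

definition mat_trace :: "'a::comm_monoid_add mat \<Rightarrow> 'a" where
  "mat_trace A = (\<Sum>i<dim_row A. A $$ (i, i))"

definition rep_character ::
  "('a, 'b) monoid_scheme \<Rightarrow> ('a \<Rightarrow> complex mat) \<Rightarrow> 'a \<Rightarrow> complex" where
  "rep_character G \<rho> = (\<lambda>g\<in>carrier G. mat_trace (\<rho> g))"

definition irreducible_characters :: "('a, 'b) monoid_scheme \<Rightarrow> ('a \<Rightarrow> complex) set" where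
  "irreducible_characters G = {rep_character G \<rho> | d \<rho>. irreducible_rep G d \<rho>}"

text \<open>The basis vectors \<open>e\<^bsub>I\<^esub> = e\<^bsub>I!0\<^esub> \<and> \<dots> \<and> e\<^bsub>I!(k-1)\<^esub>\<close> of \<open>\<Lambda>\<^sup>k(\<complex>\<^sup>d)\<close> are indexed by the strictly
  increasing lists \<open>I\<close> of length \<open>k\<close> with entries below \<open>d\<close>; the coefficient of \<open>e\<^bsub>I\<^esub>\<close> in
  \<open>A e\<^bsub>J!0\<^esub> \<and> \<dots> \<and> A e\<^bsub>J!(k-1)\<^esub>\<close> is the minor of \<open>A\<close> with rows \<open>I\<close> and columns \<open>J\<close>.\<close>

definition ext_basis :: "nat \<Rightarrow> nat \<Rightarrow> nat list list" where
  "ext_basis d k = filter (\<lambda>I. length I = k) (subseqs [0..<d])"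

definition ext_power :: "nat \<Rightarrow> 'a::comm_ring_1 mat \<Rightarrow> 'a mat" where
  "ext_power k A =
     (let B = ext_basis (dim_row A) k in
      mat (length B) (length B)
        (\<lambda>(r, s). det (mat k k (\<lambda>(a, b). A $$ (B ! r ! a, B ! s ! b)))))"


section \<open>The ring of virtual characters\<close>

definition function_ring :: "('a, 'b) monoid_scheme \<Rightarrow> ('a \<Rightarrow> complex) ring" where
  "function_ring G =
     \<lparr>carrier = carrier G \<rightarrow>\<^sub>E UNIV,
      monoid.mult = (\<lambda>x y. \<lambda>g\<in>carrier G. x g * y g),
      monoid.one = (\<lambda>g\<in>carrier G. 1),
      ring.zero = (\<lambda>g\<in>carrier G. 0),
      ring.add = (\<lambda>x y. \<lambda>g\<in>carrier G. x g + y g)\<rparr>"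

text \<open>For finite \<open>G\<close> the irreducible characters are linearly independent, so the subgroup they
  generate is free on them; the character of a tensor product is the pointwise product.\<close>

definition char_ring :: "('a, 'b) monoid_scheme \<Rightarrow> ('a \<Rightarrow> complex) ring" where
  "char_ring G =
     (function_ring G)
       \<lparr>carrier := generate (add_monoid (function_ring G)) (irreducible_characters G)\<rparr>"

text \<open>The degree of a virtual character is its value at the identity of the group.\<close>

definition augmentation_ideal :: "('a, 'b) monoid_scheme \<Rightarrow> ('a \<Rightarrow> complex) set" where
  "augmentation_ideal G = {x \<in> carrier (char_ring G). x \<one>\<^bsub>G\<^esub> = 0}"

definition is_lambda_structure ::
  "('a, 'b) monoid_scheme \<Rightarrow> (nat \<Rightarrow> ('a \<Rightarrow> complex) \<Rightarrow> 'a \<Rightarrow> complex) \<Rightarrow> bool" where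
  "is_lambda_structure G L \<longleftrightarrow>
     (let R = char_ring G in
      (\<forall>n. L n \<in> carrier R \<rightarrow>\<^sub>E carrier R) \<and>
      (\<forall>d \<rho> n. representation G d \<rho> \<longrightarrow>
         L n (rep_character G \<rho>) = rep_character G (\<lambda>g. ext_power n (\<rho> g))) \<and>
      (\<forall>x\<in>carrier R. L 0 x = \<one>\<^bsub>R\<^esub>) \<and>
      (\<forall>n. \<forall>x\<in>carrier R. \<forall>y\<in>carrier R.
         L n (x \<oplus>\<^bsub>R\<^esub> y) = (\<Oplus>\<^bsub>R\<^esub>i\<in>{..n}. L i x \<otimes>\<^bsub>R\<^esub> L (n - i) y)))"

text \<open>For finite \<open>G\<close> there is exactly one such family: every virtual character is a difference of
  two characters, and additivity then determines \<open>L\<close> recursively.\<close>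

definition lambda_op ::
  "('a, 'b) monoid_scheme \<Rightarrow> nat \<Rightarrow> ('a \<Rightarrow> complex) \<Rightarrow> 'a \<Rightarrow> complex" where
  "lambda_op G = (THE L. is_lambda_structure G L)"

definition gamma_op ::
  "('a, 'b) monoid_scheme \<Rightarrow> nat \<Rightarrow> ('a \<Rightarrow> complex) \<Rightarrow> 'a \<Rightarrow> complex" where
  "gamma_op G n x =
     (let R = char_ring G in lambda_op G n (x \<oplus>\<^bsub>R\<^esub> add_pow R (int n - 1) \<one>\<^bsub>R\<^esub>))"

text \<open>A product \<open>\<gamma>\<^bsup>i\<^sub>1\<^esup>(x\<^sub>1) \<cdots> \<gamma>\<^bsup>i\<^sub>r\<^esup>(x\<^sub>r)\<close> is given by the list of the pairs \<open>(i\<^sub>j, x\<^sub>j)\<close>.\<close>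

definition gamma_filtration :: "('a, 'b) monoid_scheme \<Rightarrow> nat \<Rightarrow> ('a \<Rightarrow> complex) set" where
  "gamma_filtration G n =
     (let R = char_ring G in
      generate (add_monoid R)
        {foldr (\<lambda>(i, x) y. gamma_op G i x \<otimes>\<^bsub>R\<^esub> y) ps \<one>\<^bsub>R\<^esub> | ps.
           snd ` set ps \<subseteq> augmentation_ideal G \<and> n \<le> sum_list (map fst ps)})"


section \<open>The graded character ring\<close>

definition graded_piece ::
  "('a, 'b) monoid_scheme \<Rightarrow> nat \<Rightarrow> ('a \<Rightarrow> complex) set monoid" where
  "graded_piece G n =
     (char_ring G)\<lparr>carrier := gamma_filtration G n\<rparr> A_Mod gamma_filtration G (Suc n)"

text \<open>Elements are families \<open>u\<close> of cosets \<open>u n \<in> \<Gamma>\<^sup>n / \<Gamma>\<^sup>n\<^sup>+\<^sup>1\<close> with finite support. The coset product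
  \<open>\<Gamma>\<^sup>i / \<Gamma>\<^sup>i\<^sup>+\<^sup>1 \<times> \<Gamma>\<^sup>j / \<Gamma>\<^sup>j\<^sup>+\<^sup>1 \<rightarrow> \<Gamma>\<^sup>i\<^sup>+\<^sup>j / \<Gamma>\<^sup>i\<^sup>+\<^sup>j\<^sup>+\<^sup>1\<close> is \<^const>\<open>rcoset_mult\<close> modulo \<open>\<Gamma>\<^sup>i\<^sup>+\<^sup>j\<^sup>+\<^sup>1\<close>, and the
  groups \<^const>\<open>graded_piece\<close> are written multiplicatively, so that \<^const>\<open>finprod\<close> is the sum
  over \<open>i + j = n\<close>.\<close>

definition graded_char_ring ::
  "('a, 'b) monoid_scheme \<Rightarrow> (nat \<Rightarrow> ('a \<Rightarrow> complex) set) ring" where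
  "graded_char_ring G =
     \<lparr>carrier = carrier (sum_group UNIV (graded_piece G)),
      monoid.mult = (\<lambda>u v n. finprod (graded_piece G n)
        (\<lambda>i. rcoset_mult (char_ring G) (gamma_filtration G (Suc n)) (u i) (v (n - i))) {..n}),
      monoid.one = (\<lambda>n. if n = 0 then gamma_filtration G 1 +>\<^bsub>char_ring G\<^esub> \<one>\<^bsub>char_ring G\<^esub>
                 else \<one>\<^bsub>graded_piece G n\<^esub>),
      ring.zero = \<one>\<^bsub>sum_group UNIV (graded_piece G)\<^esub>,
      ring.add = monoid.mult (sum_group UNIV (graded_piece G))\<rparr>"

definition homogeneous_elements ::
  "('a, 'b) monoid_scheme \<Rightarrow> nat \<Rightarrow> (nat \<Rightarrow> ('a \<Rightarrow> complex) set) set" where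
  "homogeneous_elements G d =
     {u \<in> carrier (graded_char_ring G). \<forall>m. m \<noteq> d \<longrightarrow> u m = \<one>\<^bsub>graded_piece G m\<^esub>}"


section \<open>Tensor products of rings over the integers\<close>

text \<open>The free abelian group on pairs, with the product determined by
  \<open>(a, b) (c, d) = (a c, b d)\<close>.\<close>

definition free_pair_ring ::
  "('a, 'm) ring_scheme \<Rightarrow> ('b, 'n) ring_scheme \<Rightarrow> ('a \<times> 'b \<Rightarrow>\<^sub>0 int) ring" where
  "free_pair_ring A B =
     \<lparr>carrier = carrier (free_Abelian_group (carrier A \<times> carrier B)),
      monoid.mult = (\<lambda>u v. frag_extend (\<lambda>(a, b).
         frag_extend (\<lambda>(c, d). frag_of (a \<otimes>\<^bsub>A\<^esub> c, b \<otimes>\<^bsub>B\<^esub> d)) v) u),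
      monoid.one = frag_of (\<one>\<^bsub>A\<^esub>, \<one>\<^bsub>B\<^esub>),
      ring.zero = 0,
      ring.add = (+)\<rparr>"

text \<open>The additive subgroup generated by the biadditivity relations; it is an ideal.\<close>

definition tensor_relations ::
  "('a, 'm) ring_scheme \<Rightarrow> ('b, 'n) ring_scheme \<Rightarrow> ('a \<times> 'b \<Rightarrow>\<^sub>0 int) set" where
  "tensor_relations A B =
     generate (add_monoid (free_pair_ring A B))
       ({frag_of (a \<oplus>\<^bsub>A\<^esub> a', b) - frag_of (a, b) - frag_of (a', b) | a a' b.
           a \<in> carrier A \<and> a' \<in> carrier A \<and> b \<in> carrier B} \<union>
        {frag_of (a, b \<oplus>\<^bsub>B\<^esub> b') - frag_of (a, b) - frag_of (a, b') | a b b'.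
           a \<in> carrier A \<and> b \<in> carrier B \<and> b' \<in> carrier B})"

definition tensor_ring ::
  "('a, 'm) ring_scheme \<Rightarrow> ('b, 'n) ring_scheme \<Rightarrow> ('a \<times> 'b \<Rightarrow>\<^sub>0 int) set ring" where
  "tensor_ring A B = free_pair_ring A B Quot tensor_relations A B"

definition tensor ::
  "('a, 'm) ring_scheme \<Rightarrow> ('b, 'n) ring_scheme \<Rightarrow> 'a \<Rightarrow> 'b \<Rightarrow> ('a \<times> 'b \<Rightarrow>\<^sub>0 int) set" where
  "tensor A B a b = tensor_relations A B +>\<^bsub>free_pair_ring A B\<^esub> frag_of (a, b)"


section \<open>Multivariate polynomials\<close>

text \<open>As in \<^theory>\<open>HOL-Algebra.Indexed_Polynomials\<close>, a polynomial is the function sending a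
  monomial (a multiset of indices) to its coefficient.\<close>

abbreviation mpolys :: "('a, 'm) ring_scheme \<Rightarrow> 'c set \<Rightarrow> ('c multiset \<Rightarrow> 'a) set" where
  "mpolys K I \<equiv> ring.indexed_pset K I (carrier K)"

text \<open>Evaluation at \<open>x\<close> in a \<open>K\<close>-algebra \<open>S\<close> with structure map \<open>\<phi>\<close>.\<close>

definition mpoly_eval ::
  "('a, 'm) ring_scheme \<Rightarrow> ('s, 'n) ring_scheme \<Rightarrow> ('a \<Rightarrow> 's) \<Rightarrow> ('c \<Rightarrow> 's) \<Rightarrow>
   ('c multiset \<Rightarrow> 'a) \<Rightarrow> 's" where
  "mpoly_eval K S \<phi> x f =
     (\<Oplus>\<^bsub>S\<^esub>m\<in>{m. f m \<noteq> \<zero>\<^bsub>K\<^esub>}.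
        \<phi> (f m) \<otimes>\<^bsub>S\<^esub> (\<Otimes>\<^bsub>S\<^esub>k\<in>set_mset m. x k [^]\<^bsub>S\<^esub> count m k))"

end

theory Submission
  imports
    Defs
    "Jordan_Normal_Form.Schur_Decomposition"
    "HOL-Computational_Algebra.Polynomial_FPS"
begin

text \<open>
  The characters of \<open>G\<close> are indexed by \<open>G\<close> itself, and a virtual character is an integer combination of
  linear characters. From \<open>\<lambda>\<^sub>t(\<chi>) = 1 + \<chi> t\<close> one gets \<open>\<gamma>\<^sub>t(\<chi> - 1) = 1 + (\<chi> - 1) t\<close>, so that \<open>\<Gamma>\<^sup>d\<close> is
  the \<open>d\<close>-th power of the augmentation ideal, spanned by the monomials of degree at least \<open>d\<close> in
  \<open>X\<^sub>k = \<chi>\<^sub>k - 1\<close>, where \<open>\<chi>\<^sub>k\<close> generates the characters of the \<open>k\<close>-th factor. The classes of the \<open>X\<^sub>k\<close>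
  therefore generate the graded ring. For the relations, write \<open>\<Sum>\<^sub>a c\<^sub>a \<chi>\<^sup>a = \<Sum>\<^sub>a c\<^sub>a \<Prod>\<^sub>k (1 + X\<^sub>k)\<^bsup>a\<^sub>k\<^esup>\<close> with
  \<open>0 \<le> a\<^sub>k < q\<^sub>k = p\<^bsup>i\<^sub>k\<^esup>\<close>; the coefficient \<open>\<Sum>\<^sub>a c\<^sub>a \<Prod>\<^sub>k binom(a\<^sub>k, m\<^sub>k)\<close> of \<open>X\<^sup>m\<close>, taken modulo \<open>p\<close>, vanishes
  on \<open>\<Gamma>\<^sup>d\<^sup>+\<^sup>1\<close> when \<open>d = \<bar>m\<bar>\<close> and all \<open>m\<^sub>k < q\<^sub>k\<close>, because \<open>(1 + X\<^sub>k)\<^bsup>q\<^sub>k\<^esup> = 1\<close> becomes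
  \<open>X\<^sub>k\<^bsup>q\<^sub>k\<^esup> = 0\<close> modulo \<open>p\<close>. It sends a monomial \<open>X\<^sup>M\<close> of degree \<open>d\<close> to \<open>1\<close> if \<open>M = m\<close> and to \<open>0\<close> otherwise.
\<close>


section \<open>Tensor products and relations between monomials\<close>

text \<open>The operations \<lambda>^n are specified by a definite description, so existence and
  uniqueness of the family must be proved before any \<gamma>^n can be evaluated, and existence
  involves the exterior powers of every representation, not only of linear characters. The traces of
  the exterior powers are the coefficients of det(1 + t \<rho>(g)), and the isotypic projections of
  \<rho> factor this determinant into powers of 1 + \<chi>(g) t. That formula extends to negative
  multiplicities as a power series. The passage to \<gamma> is the substitution t/(1 - t), under
  which 1 + \<chi> t becomes (1 + (\<chi> - 1) t)/(1 - t); on the augmentation ideal the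
  denominators cancel. The ring axioms of the graded ring are inherited from the Rees ring of
  polynomials with n-th coefficient in \<Gamma>^n, which maps onto it. The tensor product with F_p
  is only mapped out of: a function on the graded ring that is additive modulo p, multiplied by the
  second factor, kills the tensor relations modulo p. The functionals are therefore integer valued,
  and what is proved of them are congruences modulo p.\<close>

lemma frag_extend_fun_diff:
  "frag_extend (\<lambda>x. f x - g x) u = frag_extend f u - frag_extend g u"
  by (induction u rule: frag_induction[OF subset_UNIV]) (simp_all add: frag_extend_diff)

section \<open>The ring on pairs and its ideal of tensor relations\<close>

locale cring_pair = A: cring A + B: cring B
  for A :: "('a, 'm) ring_scheme" and B :: "('b, 'n) ring_scheme"
begin

abbreviation F where "F \<equiv> free_pair_ring A B"
abbreviation T where "T \<equiv> tensor_relations A B"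

lemma free_pair_ring_sel:
  "carrier F = {c. Poly_Mapping.keys c \<subseteq> carrier A \<times> carrier B}"
  "\<zero>\<^bsub>F\<^esub> = 0" "\<one>\<^bsub>F\<^esub> = frag_of (\<one>\<^bsub>A\<^esub>, \<one>\<^bsub>B\<^esub>)" "x \<oplus>\<^bsub>F\<^esub> y = x + y"
  by (auto simp: free_pair_ring_def)

lemma free_pair_mult_of:
  "frag_of (a, b) \<otimes>\<^bsub>F\<^esub> frag_of (c, d) = frag_of (a \<otimes>\<^bsub>A\<^esub> c, b \<otimes>\<^bsub>B\<^esub> d)"
  by (simp add: free_pair_ring_def)

text \<open>The second factor sits inside the extended function, so additivity there is linearity of
  \<open>frag_extend\<close> in its function argument. Differences are used because they are the
  induction step of \<open>free_pair_induct\<close>.\<close>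

lemma free_pair_mult_diff:
  "(u - v) \<otimes>\<^bsub>F\<^esub> w = u \<otimes>\<^bsub>F\<^esub> w - v \<otimes>\<^bsub>F\<^esub> w"
  "w \<otimes>\<^bsub>F\<^esub> (u - v) = w \<otimes>\<^bsub>F\<^esub> u - w \<otimes>\<^bsub>F\<^esub> v"
  by (simp_all add: free_pair_ring_def frag_extend_diff split_def frag_extend_fun_diff)

lemma free_pair_mult_add:
  "(u + v) \<otimes>\<^bsub>F\<^esub> w = u \<otimes>\<^bsub>F\<^esub> w + v \<otimes>\<^bsub>F\<^esub> w"
  by (simp add: free_pair_ring_def frag_extend_add)

lemma free_pair_mult_0: "0 \<otimes>\<^bsub>F\<^esub> w = 0" "w \<otimes>\<^bsub>F\<^esub> 0 = 0"
  using free_pair_mult_diff(1)[of 0 0 w] free_pair_mult_diff(2)[of w 0 0] by simp_all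

text \<open>Closure under differences, together with 0, yields sums and negatives; a biadditive
  identity is thereby reduced to basis pairs and one additive step.\<close>

lemma free_pair_induct [consumes 1, case_names zero one diff]:
  assumes "c \<in> carrier F" "P 0"
    and "\<And>a b. a \<in> carrier A \<Longrightarrow> b \<in> carrier B \<Longrightarrow> P (frag_of (a, b))"
    and "\<And>u v. P u \<Longrightarrow> P v \<Longrightarrow> P (u - v)"
  shows "P c"
  using assms(1) unfolding free_pair_ring_sel mem_Collect_eq
  by (induction c rule: frag_induction) (use assms(2-4) in auto)

lemma free_pair_diff_closed:
  "u \<in> carrier F \<Longrightarrow> v \<in> carrier F \<Longrightarrow> u - v \<in> carrier F"
  using keys_diff[of u v] by (auto simp: free_pair_ring_sel)

lemma free_pair_0_closed: "0 \<in> carrier F"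
  by (simp add: free_pair_ring_sel)

lemma frag_of_closed:
  "a \<in> carrier A \<Longrightarrow> b \<in> carrier B \<Longrightarrow> frag_of (a, b) \<in> carrier F"
  by (auto simp: free_pair_ring_sel)

lemma free_pair_mult_closed:
  assumes "u \<in> carrier F" "v \<in> carrier F"
  shows "u \<otimes>\<^bsub>F\<^esub> v \<in> carrier F"
  using assms(1)
proof (induction rule: free_pair_induct)
  case (one a b)
  note ab = this
  show ?case
    using assms(2)
  proof (induction rule: free_pair_induct)
    case zero
    then show ?case by (simp add: free_pair_mult_0 free_pair_0_closed)
  next
    case (one c d)
    then show ?case
      using ab by (simp add: free_pair_mult_of frag_of_closed)
  next
    case (diff u v)
    then show ?case by (simp add: free_pair_mult_diff free_pair_diff_closed)
  qed
qed (simp_all add: free_pair_mult_0 free_pair_mult_diff free_pair_diff_closed free_pair_0_closed)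

lemma free_pair_mult_comm:
  assumes "u \<in> carrier F" "v \<in> carrier F"
  shows "u \<otimes>\<^bsub>F\<^esub> v = v \<otimes>\<^bsub>F\<^esub> u"
  using assms(1)
proof (induction rule: free_pair_induct)
  case (one a b)
  note ab = this
  show ?case
    using assms(2)
    by (induction rule: free_pair_induct)
      (simp_all add: free_pair_mult_0 free_pair_mult_diff free_pair_mult_of A.m_comm B.m_comm ab)
qed (simp_all add: free_pair_mult_0 free_pair_mult_diff)

lemma free_pair_mult_assoc:
  assumes "u \<in> carrier F" "v \<in> carrier F" "w \<in> carrier F"
  shows "u \<otimes>\<^bsub>F\<^esub> v \<otimes>\<^bsub>F\<^esub> w = u \<otimes>\<^bsub>F\<^esub> (v \<otimes>\<^bsub>F\<^esub> w)"
  using assms(1)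
proof (induction rule: free_pair_induct)
  case (one a b)
  note ab = this
  show ?case
    using assms(2)
  proof (induction rule: free_pair_induct)
    case (one c d)
    note cd = this
    show ?case
      using assms(3)
      by (induction rule: free_pair_induct)
        (simp_all add: free_pair_mult_0 free_pair_mult_diff free_pair_mult_of A.m_assoc B.m_assoc ab cd)
  qed (simp_all add: free_pair_mult_0 free_pair_mult_diff)
qed (simp_all add: free_pair_mult_0 free_pair_mult_diff)

lemma cring_free_pair_ring: "cring F"
proof (rule cringI)
  show "abelian_group F"
  proof (rule abelian_groupI)
    fix x assume "x \<in> carrier F"
    then show "\<exists>y\<in>carrier F. y \<oplus>\<^bsub>F\<^esub> x = \<zero>\<^bsub>F\<^esub>"
      by (intro bexI[of _ "- x"]) (auto simp: free_pair_ring_sel)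
  next
    fix x y assume "x \<in> carrier F" "y \<in> carrier F"
    then show "x \<oplus>\<^bsub>F\<^esub> y \<in> carrier F"
      using Poly_Mapping.keys_add[of x y] by (auto simp: free_pair_ring_sel)
  qed (simp_all add: free_pair_ring_sel add_ac)
  show "comm_monoid F"
  proof (rule comm_monoidI)
    fix x assume "x \<in> carrier F"
    then show "\<one>\<^bsub>F\<^esub> \<otimes>\<^bsub>F\<^esub> x = x"
      unfolding free_pair_ring_sel(3)
      by (induction rule: free_pair_induct)
        (simp_all add: free_pair_mult_0 free_pair_mult_diff free_pair_mult_of)
  qed (use free_pair_mult_closed free_pair_mult_assoc free_pair_mult_comm frag_of_closed in
      \<open>simp_all add: free_pair_ring_sel(3)\<close>)
qed (simp add: free_pair_ring_sel free_pair_mult_add)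

sublocale F: cring F by (rule cring_free_pair_ring)

lemma free_pair_neg: "u \<in> carrier F \<Longrightarrow> \<ominus>\<^bsub>F\<^esub> u = - u"
  by (rule F.minus_equality) (auto simp: free_pair_ring_sel)

lemma inv_add_monoid_free_pair: "u \<in> carrier F \<Longrightarrow> inv\<^bsub>add_monoid F\<^esub> u = - u"
  using free_pair_neg[of u] unfolding a_inv_def .

definition relators where
  "relators = {frag_of (a \<oplus>\<^bsub>A\<^esub> a', b) - frag_of (a, b) - frag_of (a', b) | a a' b.
       a \<in> carrier A \<and> a' \<in> carrier A \<and> b \<in> carrier B} \<union>
     {frag_of (a, b \<oplus>\<^bsub>B\<^esub> b') - frag_of (a, b) - frag_of (a, b') | a b b'.
       a \<in> carrier A \<and> b \<in> carrier B \<and> b' \<in> carrier B}"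

lemma relatorsI:
  "a \<in> carrier A \<Longrightarrow> a' \<in> carrier A \<Longrightarrow> b \<in> carrier B \<Longrightarrow>
    frag_of (a \<oplus>\<^bsub>A\<^esub> a', b) - frag_of (a, b) - frag_of (a', b) \<in> relators"
  "a \<in> carrier A \<Longrightarrow> b \<in> carrier B \<Longrightarrow> b' \<in> carrier B \<Longrightarrow>
    frag_of (a, b \<oplus>\<^bsub>B\<^esub> b') - frag_of (a, b) - frag_of (a, b') \<in> relators"
  unfolding relators_def by blast+

lemma relators_closed: "relators \<subseteq> carrier F"
  unfolding relators_def by (auto intro!: free_pair_diff_closed frag_of_closed)

text \<open>By distributivity in \<open>A\<close> or in \<open>B\<close>, a basis pair times a
  relator is a relator of the same kind. This is why the additive subgroup generated by the relators
  is already an ideal.\<close>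

lemma relators_mult:
  assumes "a \<in> carrier A" "b \<in> carrier B" "r \<in> relators"
  shows "frag_of (a, b) \<otimes>\<^bsub>F\<^esub> r \<in> relators"
proof -
  from assms(3) consider
      c c' d where "c \<in> carrier A" "c' \<in> carrier A" "d \<in> carrier B"
        "r = frag_of (c \<oplus>\<^bsub>A\<^esub> c', d) - frag_of (c, d) - frag_of (c', d)"
    | c d d' where "c \<in> carrier A" "d \<in> carrier B" "d' \<in> carrier B"
        "r = frag_of (c, d \<oplus>\<^bsub>B\<^esub> d') - frag_of (c, d) - frag_of (c, d')"
    unfolding relators_def by blast
  then show ?thesis
  proof cases
    case 1
    then have "frag_of (a, b) \<otimes>\<^bsub>F\<^esub> r =
        frag_of (a \<otimes>\<^bsub>A\<^esub> c \<oplus>\<^bsub>A\<^esub> a \<otimes>\<^bsub>A\<^esub> c', b \<otimes>\<^bsub>B\<^esub> d) - frag_of (a \<otimes>\<^bsub>A\<^esub> c, b \<otimes>\<^bsub>B\<^esub> d) - frag_of (a \<otimes>\<^bsub>A\<^esub> c', b \<otimes>\<^bsub>B\<^esub> d)"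
      using assms by (simp add: free_pair_mult_diff free_pair_mult_of A.r_distr)
    then show ?thesis
      using assms(1,2) 1(1-3) relatorsI(1) by simp
  next
    case 2
    then have "frag_of (a, b) \<otimes>\<^bsub>F\<^esub> r =
        frag_of (a \<otimes>\<^bsub>A\<^esub> c, b \<otimes>\<^bsub>B\<^esub> d \<oplus>\<^bsub>B\<^esub> b \<otimes>\<^bsub>B\<^esub> d') - frag_of (a \<otimes>\<^bsub>A\<^esub> c, b \<otimes>\<^bsub>B\<^esub> d) - frag_of (a \<otimes>\<^bsub>A\<^esub> c, b \<otimes>\<^bsub>B\<^esub> d')"
      using assms by (simp add: free_pair_mult_diff free_pair_mult_of B.r_distr)
    then show ?thesis
      using assms(1,2) 2(1-3) relatorsI(2) by simp
  qed
qed

lemma tensor_relations_alt: "T = generate (add_monoid F) relators"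
  by (simp add: tensor_relations_def relators_def)

lemma tensor_relations_subgroup: "subgroup T (add_monoid F)"
  unfolding tensor_relations_alt
  by (rule group.generate_is_subgroup[OF F.a_group]) (use relators_closed in auto)

lemma tensor_relations_subset: "T \<subseteq> carrier F"
  using subgroup.subset[OF tensor_relations_subgroup] by simp

lemma tensor_relations_diff:
  assumes "u \<in> T" "v \<in> T"
  shows "u - v \<in> T"
proof -
  have "v \<in> carrier F" using assms tensor_relations_subset by auto
  then have "- v \<in> T"
    using subgroup.m_inv_closed[OF tensor_relations_subgroup assms(2)]
    by (simp only: inv_add_monoid_free_pair)
  from subgroup.m_closed[OF tensor_relations_subgroup assms(1) this]
  show ?thesis by (simp add: free_pair_ring_sel(4))
qed

lemma tensor_relations_0: "0 \<in> T"
  using subgroup.one_closed[OF tensor_relations_subgroup] by (simp add: free_pair_ring_sel)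

lemma tensor_relations_induct [consumes 1, case_names zero rel diff]:
  assumes "w \<in> T" "P 0" "\<And>r. r \<in> relators \<Longrightarrow> P r" "\<And>u v. P u \<Longrightarrow> P v \<Longrightarrow> P (u - v)"
  shows "P w"
  using assms(1) unfolding tensor_relations_alt
proof (induction rule: generate.induct)
  case one
  then show ?case using assms(2) by (simp add: free_pair_ring_sel)
next
  case (incl h)
  then show ?case by (rule assms(3))
next
  case (inv h)
  then have "inv\<^bsub>add_monoid F\<^esub> h = 0 - h"
    using relators_closed inv_add_monoid_free_pair by auto
  then show ?case
    using assms(4)[OF assms(2) assms(3)[OF inv]] by (simp only:)
next
  case (eng h1 h2)
  have "P (h1 - (0 - h2))" by (intro assms(4)[OF _ assms(4)] eng assms(2))
  then show ?case by (simp add: free_pair_ring_sel)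
qed

lemma ideal_tensor_relations: "ideal T F"
proof (rule idealI[OF F.ring_axioms tensor_relations_subgroup])
  fix w u assume w: "w \<in> T" and u: "u \<in> carrier F"
  show *: "u \<otimes>\<^bsub>F\<^esub> w \<in> T"
    using w
  proof (induction rule: tensor_relations_induct)
    case (rel r)
    show ?case
      using u
    proof (induction rule: free_pair_induct)
      case (one a b)
      then show ?case
        unfolding tensor_relations_alt using relators_mult rel by (blast intro: generate.incl)
    qed (simp_all add: free_pair_mult_0 free_pair_mult_diff tensor_relations_0 tensor_relations_diff)
  qed (simp_all add: free_pair_mult_0 free_pair_mult_diff tensor_relations_0 tensor_relations_diff)
  then show "w \<otimes>\<^bsub>F\<^esub> u \<in> T"
    using u w tensor_relations_subset free_pair_mult_comm[of u w] by auto
qed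

lemma ideal_tensor_subgroup: "abelian_subgroup T F"
  by (rule abelian_subgroupI3[OF _ F.abelian_group_axioms])
    (unfold additive_subgroup_def, rule tensor_relations_subgroup)

lemma tensor_hom: "ring_hom_cring F (tensor_ring A B) ((+>\<^bsub>F\<^esub>) T)"
  unfolding tensor_ring_def
  by (rule ideal.rcos_ring_hom_cring[OF ideal_tensor_relations cring_free_pair_ring])

lemma frag_of_pow:
  assumes "a \<in> carrier A"
  shows "frag_of (a, \<one>\<^bsub>B\<^esub>) [^]\<^bsub>F\<^esub> (k :: nat) = frag_of (a [^]\<^bsub>A\<^esub> k, \<one>\<^bsub>B\<^esub>)"
  using assms by (induction k) (simp_all add: free_pair_mult_of free_pair_ring_sel(3))

lemma frag_of_finprod:
  assumes "finite K" "y \<in> K \<rightarrow> carrier A"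
  shows "(\<Otimes>\<^bsub>F\<^esub>k\<in>K. frag_of (y k, \<one>\<^bsub>B\<^esub>)) = frag_of (\<Otimes>\<^bsub>A\<^esub>k\<in>K. y k, \<one>\<^bsub>B\<^esub>)"
  using assms
proof (induction K rule: finite_induct)
  case empty
  then show ?case by (simp add: free_pair_ring_sel(3))
next
  case (insert k K)
  then have "(\<lambda>k. frag_of (y k, \<one>\<^bsub>B\<^esub>)) \<in> K \<rightarrow> carrier F"
    by (auto intro!: frag_of_closed)
  with insert show ?case
    by (simp add: free_pair_mult_of frag_of_closed)
qed

lemma finsum_free_pair:
  assumes "finite K" "y \<in> K \<rightarrow> carrier F"
  shows "finsum F y K = sum y K"
  using assms by (induction K rule: finite_induct) (simp_all add: free_pair_ring_sel(2,4))

lemma sum_free_pair_closed: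
  assumes "finite K" "y \<in> K \<rightarrow> carrier F"
  shows "sum y K \<in> carrier F"
  using finsum_free_pair[OF assms] F.finsum_closed[OF assms(2)] by simp

text \<open>The quotient map is a ring homomorphism and the pairs (a, 1) multiply as in
  \<open>A\<close>, so the evaluation can be done in the free ring. The outcome is one coset with an
  explicit representative, to which membership in \<open>T\<close> can be applied.\<close>

lemma mpoly_eval_tensor_ring:
  assumes fin: "finite {m. f m \<noteq> \<zero>\<^bsub>B\<^esub>}" and f: "\<And>m. f m \<in> carrier B"
    and supp: "\<And>m. f m \<noteq> \<zero>\<^bsub>B\<^esub> \<Longrightarrow> set_mset m \<subseteq> I" and x: "x \<in> I \<rightarrow> carrier A"
  shows "mpoly_eval B (tensor_ring A B) (\<lambda>c. tensor A B \<one>\<^bsub>A\<^esub> c) (\<lambda>k. tensor A B (x k) \<one>\<^bsub>B\<^esub>) f =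
    T +>\<^bsub>F\<^esub> (\<Sum>m | f m \<noteq> \<zero>\<^bsub>B\<^esub>. frag_of (\<Otimes>\<^bsub>A\<^esub>k\<in>set_mset m. x k [^]\<^bsub>A\<^esub> count m k, f m))"
proof -
  let ?Q = "tensor_ring A B" and ?S = "{m. f m \<noteq> \<zero>\<^bsub>B\<^esub>}"
  let ?h = "(+>\<^bsub>F\<^esub>) T"
  interpret h: ring_hom_cring F ?Q ?h by (rule tensor_hom)
  let ?M = "\<lambda>m. \<Otimes>\<^bsub>A\<^esub>k\<in>set_mset m. x k [^]\<^bsub>A\<^esub> count m k"
  have hom_pow: "?h u [^]\<^bsub>?Q\<^esub> j = ?h (u [^]\<^bsub>F\<^esub> j)" if "u \<in> carrier F" for u and j :: nat
    using that by (induction j) simp_all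
  have mono: "tensor A B \<one>\<^bsub>A\<^esub> (f m) \<otimes>\<^bsub>?Q\<^esub>
      (\<Otimes>\<^bsub>?Q\<^esub>k\<in>set_mset m. tensor A B (x k) \<one>\<^bsub>B\<^esub> [^]\<^bsub>?Q\<^esub> count m k) = ?h (frag_of (?M m, f m))"
    and M: "?M m \<in> carrier A" if m: "m \<in> ?S" for m
  proof -
    have xk: "x k \<in> carrier A" if "k \<in> set_mset m" for k
      using that supp[of m] m x by auto
    then have y: "(\<lambda>k. x k [^]\<^bsub>A\<^esub> count m k) \<in> set_mset m \<rightarrow> carrier A" by simp
    then show M: "?M m \<in> carrier A" by simp
    have c0: "(\<lambda>k. frag_of (x k [^]\<^bsub>A\<^esub> count m k, \<one>\<^bsub>B\<^esub>)) \<in> set_mset m \<rightarrow> carrier F"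
      using xk by (intro Pi_I frag_of_closed) auto
    have "(\<Otimes>\<^bsub>?Q\<^esub>k\<in>set_mset m. tensor A B (x k) \<one>\<^bsub>B\<^esub> [^]\<^bsub>?Q\<^esub> count m k) =
        (\<Otimes>\<^bsub>?Q\<^esub>k\<in>set_mset m. ?h (frag_of (x k [^]\<^bsub>A\<^esub> count m k, \<one>\<^bsub>B\<^esub>)))"
      using xk by (intro h.S.finprod_cong')
        (simp_all add: tensor_def hom_pow frag_of_closed frag_of_pow)
    also have "\<dots> = ?h (\<Otimes>\<^bsub>F\<^esub>k\<in>set_mset m. frag_of (x k [^]\<^bsub>A\<^esub> count m k, \<one>\<^bsub>B\<^esub>))"
      by (simp only: h.hom_finprod[OF c0] o_def)
    also have "\<dots> = ?h (frag_of (?M m, \<one>\<^bsub>B\<^esub>))"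
      using y by (simp add: frag_of_finprod)
    finally show "tensor A B \<one>\<^bsub>A\<^esub> (f m) \<otimes>\<^bsub>?Q\<^esub>
      (\<Otimes>\<^bsub>?Q\<^esub>k\<in>set_mset m. tensor A B (x k) \<one>\<^bsub>B\<^esub> [^]\<^bsub>?Q\<^esub> count m k) = ?h (frag_of (?M m, f m))"
      using M f by (simp add: tensor_def h.hom_mult[symmetric] frag_of_closed free_pair_mult_of)
  qed
  have c: "(\<lambda>m. frag_of (?M m, f m)) \<in> ?S \<rightarrow> carrier F"
    by (intro Pi_I frag_of_closed M f)
  have "mpoly_eval B ?Q (\<lambda>c. tensor A B \<one>\<^bsub>A\<^esub> c) (\<lambda>k. tensor A B (x k) \<one>\<^bsub>B\<^esub>) f =
      (\<Oplus>\<^bsub>?Q\<^esub>m\<in>?S. ?h (frag_of (?M m, f m)))"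
    unfolding mpoly_eval_def using mono c by (intro h.S.finsum_cong') (auto simp: Pi_iff)
  also have "\<dots> = ?h (\<Oplus>\<^bsub>F\<^esub>m\<in>?S. frag_of (?M m, f m))"
    using c by (simp add: h.hom_finsum o_def)
  also have "\<dots> = ?h (\<Sum>m\<in>?S. frag_of (?M m, f m))"
    by (simp only: finsum_free_pair[OF fin c])
  finally show ?thesis .
qed

end

section \<open>Supports of indexed polynomials and detection of relations\<close>

lemma (in ring) indexed_pset_support:
  assumes "f \<in> indexed_pset I (carrier R)"
  shows "finite {m. f m \<noteq> \<zero>}"
    and indexed_pset_coeff_closed: "\<And>m. f m \<in> carrier R"
    and indexed_pset_monomial: "\<And>m. f m \<noteq> \<zero> \<Longrightarrow> set_mset m \<subseteq> I"
proof -
  show "f m \<in> carrier R" for m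
    using indexed_pset_in_carrier[OF subset_refl assms] by (simp add: carrier_coeff_def)
  show "finite {m. f m \<noteq> \<zero>}"
    using assms
  proof (induction rule: indexed_pset.induct)
    case (indexed_const k)
    have "{m. indexed_const k m \<noteq> \<zero>} \<subseteq> {{#}}" by (auto simp: indexed_const_def)
    then show ?case by (rule finite_subset) simp
  next
    case (indexed_padd P Q)
    have "{m. indexed_padd P Q m \<noteq> \<zero>} \<subseteq> {m. P m \<noteq> \<zero>} \<union> {m. Q m \<noteq> \<zero>}"
      by (auto simp: indexed_padd_def)
    then show ?case by (rule finite_subset) (simp add: indexed_padd)
  next
    case (indexed_pmult P i)
    have "{m. indexed_pmult P i m \<noteq> \<zero>} \<subseteq> add_mset i ` {m. P m \<noteq> \<zero>}"
    proof
      fix m assume "m \<in> {m. indexed_pmult P i m \<noteq> \<zero>}"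
      then have "i \<in># m" "P (m - {#i#}) \<noteq> \<zero>" by (auto simp: indexed_pmult_def split: if_splits)
      then show "m \<in> add_mset i ` {m. P m \<noteq> \<zero>}"
        by (intro image_eqI[of _ _ "m - {#i#}"]) auto
    qed
    then show ?case by (rule finite_subset) (simp add: indexed_pmult)
  qed
  show "set_mset m \<subseteq> I" if "f m \<noteq> \<zero>" for m
    using assms that
  proof (induction arbitrary: m rule: indexed_pset.induct)
    case (indexed_const k)
    then show ?case by (simp add: indexed_const_def split: if_splits)
  next
    case (indexed_padd P Q)
    then have "P m \<noteq> \<zero> \<or> Q m \<noteq> \<zero>" by (auto simp: indexed_padd_def)
    then show ?case using indexed_padd.IH by (elim disjE)
  next
    case (indexed_pmult P i)
    then have m: "i \<in># m" "P (m - {#i#}) \<noteq> \<zero>" by (simp_all add: indexed_pmult_def split: if_splits)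
    then have "set_mset (m - {#i#}) \<subseteq> I" by (intro indexed_pmult.IH)
    moreover have "set_mset m = insert i (set_mset (m - {#i#}))"
      using m(1) by (metis insert_DiffM set_mset_add_mset_insert)
    ultimately show ?case using indexed_pmult.hyps by simp
  qed
qed

text \<open>The map (a, b) to \<phi>(a) b is biadditive modulo p, hence factors through the tensor
  product with F_p. Applying it to the vanishing evaluation gives a congruence between
  integers.\<close>

lemma mpoly_relation_imp_functional_zero:
  fixes p :: int and A :: "('a, 'm) ring_scheme"
  defines "Fp \<equiv> residue_ring p"
  assumes "cring A" "1 < p" and f: "f \<in> mpolys Fp I" and x: "x \<in> I \<rightarrow> carrier A"
    and \<phi>: "\<And>a b. a \<in> carrier A \<Longrightarrow> b \<in> carrier A \<Longrightarrow> [\<phi> (a \<oplus>\<^bsub>A\<^esub> b) = \<phi> a + \<phi> b] (mod p)"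
    and vanishes: "mpoly_eval Fp (tensor_ring A Fp) (\<lambda>c. tensor A Fp \<one>\<^bsub>A\<^esub> c)
       (\<lambda>k. tensor A Fp (x k) \<one>\<^bsub>Fp\<^esub>) f = \<zero>\<^bsub>tensor_ring A Fp\<^esub>"
  shows "[(\<Sum>m | f m \<noteq> \<zero>\<^bsub>Fp\<^esub>. \<phi> (\<Otimes>\<^bsub>A\<^esub>k\<in>set_mset m. x k [^]\<^bsub>A\<^esub> count m k) * f m) = 0] (mod p)"
proof -
  interpret residues p Fp by unfold_locales (use assms in simp_all)
  interpret A: cring A by fact
  interpret cring_pair A Fp ..
  note supp = indexed_pset_support[OF f]
  let ?M = "\<lambda>m. \<Otimes>\<^bsub>A\<^esub>k\<in>set_mset m. x k [^]\<^bsub>A\<^esub> count m k"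
  let ?S = "{m. f m \<noteq> \<zero>\<^bsub>Fp\<^esub>}"
  have M: "?M m \<in> carrier A" if "f m \<noteq> \<zero>\<^bsub>Fp\<^esub>" for m
    by (rule A.finprod_closed) (use supp(3)[OF that] x in auto)
  let ?w = "\<Sum>m\<in>?S. frag_of (?M m, f m)"
  have w: "?w \<in> carrier F"
    by (rule sum_free_pair_closed[OF supp(1)]) (use M supp(2) in \<open>auto intro!: frag_of_closed\<close>)
  have "T +>\<^bsub>F\<^esub> ?w = \<zero>\<^bsub>tensor_ring A Fp\<^esub>"
    unfolding vanishes[symmetric]
    by (rule mpoly_eval_tensor_ring[symmetric]) (use supp x in auto)
  \<comment> \<open>A representative lies in its own coset; as that coset is the zero class
    \<open>T\<close>, the representative is itself a tensor relation.\<close>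
  moreover have "?w \<in> T +>\<^bsub>F\<^esub> ?w"
    by (rule abelian_subgroup.a_rcos_self[OF ideal_tensor_subgroup w])
  ultimately have wT: "?w \<in> T"
    by (simp add: tensor_ring_def FactRing_def)
  \<comment> \<open>\<open>frag_extend\<close> takes values in free abelian groups, so the integers
    appear as the free abelian group on the single element \<open>()\<close>, read off as its
    coefficient.\<close>
  define ev where "ev w = Poly_Mapping.lookup
    (frag_extend (\<lambda>(a, b). frag_cmul (\<phi> a * b) (frag_of ())) w) ()" for w
  have ev_diff: "ev (u - v) = ev u - ev v" for u v
    by (simp add: ev_def frag_extend_diff lookup_minus)
  have ev_of: "ev (frag_of (a, b)) = \<phi> a * b" for a b
    by (simp add: ev_def)
  have ev0: "ev 0 = 0" by (simp add: ev_def)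
  have "[ev w = 0] (mod p)" if "w \<in> T" for w
    using that
  proof (induction rule: tensor_relations_induct)
    case (rel r)
    from rel consider
      c c' d where "c \<in> carrier A" "c' \<in> carrier A"
        "r = frag_of (c \<oplus>\<^bsub>A\<^esub> c', d) - frag_of (c, d) - frag_of (c', d)"
    | c d d' where "r = frag_of (c, d \<oplus>\<^bsub>Fp\<^esub> d') - frag_of (c, d) - frag_of (c, d')"
      unfolding relators_def by fast
    then show ?case
    proof cases
      case 1
      have "[\<phi> (c \<oplus>\<^bsub>A\<^esub> c') * d - \<phi> c * d - \<phi> c' * d = (\<phi> c + \<phi> c') * d - \<phi> c * d - \<phi> c' * d] (mod p)"
        by (intro cong_diff cong_mult cong_refl \<phi> 1)
      moreover have "ev r = \<phi> (c \<oplus>\<^bsub>A\<^esub> c') * d - \<phi> c * d - \<phi> c' * d"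
        by (simp add: 1(3) ev_diff ev_of)
      ultimately show ?thesis
        by (simp only: distrib_right add_diff_cancel_left' diff_self)
    next
      case 2
      \<comment> \<open>Addition in \<open>Fp\<close> returns a reduced residue, so the relators in
        the second argument are killed modulo p rather than exactly.\<close>
      have "[\<phi> c * ((d + d') mod p) - \<phi> c * d - \<phi> c * d' = \<phi> c * (d + d') - \<phi> c * d - \<phi> c * d'] (mod p)"
        by (intro cong_diff cong_mult cong_refl) (simp add: cong_def)
      moreover have "ev r = \<phi> c * ((d + d') mod p) - \<phi> c * d - \<phi> c * d'"
        by (simp add: 2 ev_diff ev_of res_add_eq)
      ultimately show ?thesis
        by (simp only: distrib_left add_diff_cancel_left' diff_self)
    qed
  next
    case (diff u v)
    then show ?case using cong_diff[OF diff] by (simp add: ev_diff)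
  qed (simp add: ev0)
  from this[OF wT] have "[ev ?w = 0] (mod p)" .
  moreover have "ev (\<Sum>m\<in>K. frag_of (?M m, f m)) = (\<Sum>m\<in>K. \<phi> (?M m) * f m)" if "finite K" for K
    using that
  proof (induction K rule: finite_induct)
    case (insert m K)
    have "ev (u + v) = ev u + ev v" for u v
      using ev_diff[of u "0 - v"] ev_diff[of 0 v] by (simp add: ev0)
    with insert show ?case by (simp add: ev_of)
  qed (simp add: ev0)
  ultimately show ?thesis using supp(1) by simp
qed

section \<open>Exterior powers and determinants\<close>

text \<open>The principal minor on rows and columns \<open>S\<close>, as a Leibniz sum over
  permutations of \<open>S\<close> itself. In this form it does not depend on an enumeration of
  \<open>S\<close> and matches the sub-sums of the Leibniz expansion of a larger
  determinant.\<close>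

definition perm_minor :: "'a::comm_ring_1 mat \<Rightarrow> nat set \<Rightarrow> 'a" where
  "perm_minor A S = (\<Sum>\<pi> | \<pi> permutes S. of_int (sign \<pi>) * (\<Prod>j\<in>S. A $$ (j, \<pi> j)))"

text \<open>Conjugation by the enumeration \<open>I\<close> carries the permutations of the
  positions to the permutations of \<open>set I\<close> and preserves signs.\<close>

lemma det_submatrix_eq_perm_minor:
  fixes A :: "'a::comm_ring_1 mat"
  assumes "distinct I"
  shows "det (mat (length I) (length I) (\<lambda>(a, b). A $$ (I ! a, I ! b))) = perm_minor A (set I)"
proof -
  let ?k = "length I" and ?f = "\<lambda>a. I ! a"
  have bij: "bij_betw ?f {0..<?k} (set I)"
    using bij_betw_nth[OF assms, of "{0..<?k}" "set I"] by (simp add: lessThan_atLeast0)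
  then have inj: "inj_on ?f {0..<?k}" and im: "?f ` {0..<?k} = set I"
    by (auto simp: bij_betw_def)
  have bijp: "bij_betw (map_permutation {0..<?k} ?f) {\<sigma>. \<sigma> permutes {0..<?k}} {\<pi>. \<pi> permutes set I}"
  proof (rule bij_betw_byWitness[where f' = "map_permutation (set I) (inv_into {0..<?k} ?f)"])
    show "\<forall>a\<in>{\<sigma>. \<sigma> permutes {0..<?k}}.
       map_permutation (set I) (inv_into {0..<?k} ?f) (map_permutation {0..<?k} ?f a) = a"
      using map_permutation_compose_inv[OF bij] inv_into_f_f[OF inj] by auto
    show "\<forall>a'\<in>{\<pi>. \<pi> permutes set I}.
       map_permutation {0..<?k} ?f (map_permutation (set I) (inv_into {0..<?k} ?f) a') = a'"
      using map_permutation_compose_inv[OF bij_betw_inv_into[OF bij]] f_inv_into_f[of _ ?f "{0..<?k}"]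
        im by auto
  qed (use map_permutation_permutes[OF bij] map_permutation_permutes[OF bij_betw_inv_into[OF bij]] in auto)
  have "perm_minor A (set I) = (\<Sum>\<sigma> | \<sigma> permutes {0..<?k}.
      of_int (sign (map_permutation {0..<?k} ?f \<sigma>)) *
      (\<Prod>j\<in>set I. A $$ (j, map_permutation {0..<?k} ?f \<sigma> j)))"
    unfolding perm_minor_def by (rule sum.reindex_bij_betw[OF bijp, symmetric])
  also have "\<dots> = (\<Sum>\<sigma> | \<sigma> permutes {0..<?k}. of_int (sign \<sigma>) *
      (\<Prod>a = 0..<?k. A $$ (I ! a, I ! \<sigma> a)))"
  proof (rule sum.cong[OF refl])
    fix \<sigma> assume "\<sigma> \<in> {\<sigma>. \<sigma> permutes {0..<?k}}"
    then have \<sigma>: "\<sigma> permutes {0..<?k}" by simp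
    have "(\<Prod>j\<in>set I. A $$ (j, map_permutation {0..<?k} ?f \<sigma> j)) =
        (\<Prod>a = 0..<?k. A $$ (I ! a, map_permutation {0..<?k} ?f \<sigma> (I ! a)))"
      by (rule prod.reindex_bij_betw[OF bij, symmetric])
    also have "\<dots> = (\<Prod>a = 0..<?k. A $$ (I ! a, I ! \<sigma> a))"
      by (rule prod.cong[OF refl]) (simp add: map_permutation_apply[OF inj])
    finally show "of_int (sign (map_permutation {0..<?k} ?f \<sigma>)) *
        (\<Prod>j\<in>set I. A $$ (j, map_permutation {0..<?k} ?f \<sigma> j)) =
        of_int (sign \<sigma>) * (\<Prod>a = 0..<?k. A $$ (I ! a, I ! \<sigma> a))"
      using sign_map_permutation[OF inj \<sigma>] by simp
  qed
  also have "\<dots> = (\<Sum>\<sigma> | \<sigma> permutes {0..<?k}. of_int (sign \<sigma>) * (\<Prod>a = 0..<?k.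
      mat ?k ?k (\<lambda>(a, b). A $$ (I ! a, I ! b)) $$ (a, \<sigma> a)))"
    by (intro sum.cong refl arg_cong2[of _ _ _ _ "(*)"] prod.cong) (auto dest: permutes_in_image)
  also have "\<dots> = det (mat ?k ?k (\<lambda>(a, b). A $$ (I ! a, I ! b)))"
    by (subst det_def') (rule mat_carrier, simp)
  finally show ?thesis by simp
qed

lemma bij_betw_set_ext_basis:
  "bij_betw set (set (ext_basis d k)) {S. S \<subseteq> {0..<d} \<and> card S = k}"
proof -
  have d: "I \<in> set (subseqs [0..<d]) \<Longrightarrow> card (set I) = length I" for I
    using subseqs_distinctD[of I "[0..<d]"] by (simp add: distinct_card)
  have "inj_on set (set (subseqs [0..<d]))"
    using distinct_set_subseqs[OF distinct_upt, of 0 d] unfolding distinct_map by blast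
  moreover have "set ` set (ext_basis d k) = {S. S \<subseteq> {0..<d} \<and> card S = k}"
  proof (intro equalityI subsetI)
    fix S assume "S \<in> set ` set (ext_basis d k)"
    then obtain I where I: "I \<in> set (subseqs [0..<d])" "length I = k" "S = set I"
      by (auto simp: ext_basis_def)
    from I(1) have "set I \<in> set ` set (subseqs [0..<d])" by (rule imageI)
    then have "set I \<in> Pow (set [0..<d])" unfolding subseqs_powset .
    then show "S \<in> {S. S \<subseteq> {0..<d} \<and> card S = k}" using I d[of I] by simp
  next
    fix S assume "S \<in> {S. S \<subseteq> {0..<d} \<and> card S = k}"
    then have S: "S \<in> Pow (set [0..<d])" "card S = k" by auto
    from S(1) obtain I where I: "I \<in> set (subseqs [0..<d])" "S = set I"
      unfolding subseqs_powset[symmetric] by (rule imageE)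
    then have "I \<in> set (ext_basis d k)" using S d[of I] by (simp add: ext_basis_def)
    then show "S \<in> set ` set (ext_basis d k)" using I by blast
  qed
  moreover have "set (ext_basis d k) \<subseteq> set (subseqs [0..<d])"
    by (auto simp: ext_basis_def)
  ultimately show ?thesis
    unfolding bij_betw_def by (meson inj_on_subset)
qed

lemma trace_ext_power:
  fixes A :: "'a::comm_ring_1 mat"
  assumes "dim_row A = d"
  shows "mat_trace (ext_power k A) = (\<Sum>S | S \<subseteq> {0..<d} \<and> card S = k. perm_minor A S)"
proof -
  let ?B = "ext_basis d k"
  have dist: "distinct ?B"
    using distinct_set_subseqs[OF distinct_upt, of 0 d]
    unfolding ext_basis_def distinct_map by (intro distinct_filter) blast
  have I: "distinct I" "length I = k" if "I \<in> set ?B" for I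
    using that subseqs_distinctD[OF _ distinct_upt, of I 0 d] unfolding ext_basis_def set_filter by blast+
  have "mat_trace (ext_power k A) =
      (\<Sum>r<length ?B. det (mat k k (\<lambda>(a, b). A $$ (?B ! r ! a, ?B ! r ! b))))"
    unfolding mat_trace_def ext_power_def Let_def dim_row_mat assms
    by (rule sum.cong[OF refl]) (simp only: lessThan_iff index_mat split)
  also have "\<dots> = (\<Sum>r<length ?B. perm_minor A (set (?B ! r)))"
     
  proof (intro sum.cong refl)
    fix r assume "r \<in> {..<length ?B}"
    then have "?B ! r \<in> set ?B" by simp
    from det_submatrix_eq_perm_minor[OF I(1)[OF this], of A] I(2)[OF this]
    show "det (mat k k (\<lambda>(a, b). A $$ (?B ! r ! a, ?B ! r ! b))) = perm_minor A (set (?B ! r))"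
      by (simp only:)
  qed
  also have "\<dots> = (\<Sum>I\<in>set ?B. perm_minor A (set I))"
    by (rule sum.reindex_bij_betw[OF bij_betw_nth[OF dist refl refl]])
  also have "\<dots> = (\<Sum>S | S \<subseteq> {0..<d} \<and> card S = k. perm_minor A S)"
    by (rule sum.reindex_bij_betw[OF bij_betw_set_ext_basis])
  finally show ?thesis .
qed

text \<open>In the Leibniz expansion each factor contributes its entry of t A or its entry of the
  identity. If \<open>S\<close> is the set of indices with the first choice, the identity entries
  force the permutation to fix the complement of \<open>S\<close>, which leaves the principal minor
  on \<open>S\<close> times t^|S|. Grouping by |S| yields the traces of the exterior powers.\<close>

lemma det_one_plus_smult:
  fixes A :: "'a::comm_ring_1 mat"
  assumes A: "A \<in> carrier_mat d d"
  shows "det (1\<^sub>m d + t \<cdot>\<^sub>m A) = (\<Sum>k\<le>d. mat_trace (ext_power k A) * t ^ k)"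
proof -
  let ?U = "{0..<d}"
  let ?s = "\<lambda>\<pi>. of_int (sign \<pi>) :: 'a"
  have "det (1\<^sub>m d + t \<cdot>\<^sub>m A) =
      (\<Sum>\<pi> | \<pi> permutes ?U. ?s \<pi> * (\<Prod>j\<in>?U. t * A $$ (j, \<pi> j) + (if j = \<pi> j then 1 else 0)))"
  proof -
    have "(1\<^sub>m d + t \<cdot>\<^sub>m A) $$ (j, \<pi> j) = t * A $$ (j, \<pi> j) + (if j = \<pi> j then 1 else 0)"
      if "\<pi> permutes ?U" "j \<in> ?U" for \<pi> j
      using A that permutes_in_image[OF that(1), of j] by simp
    then show ?thesis
      using A by (subst det_def'[of _ d]) (auto intro!: sum.cong simp del: index_add_mat index_smult_mat)
  qed
  also have "\<dots> = (\<Sum>\<pi> | \<pi> permutes ?U. \<Sum>S\<in>Pow ?U. ?s \<pi> *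
      ((\<Prod>j\<in>S. t * A $$ (j, \<pi> j)) * (\<Prod>j\<in>?U - S. if j = \<pi> j then 1 else 0)))"
    by (simp only: prod_add[OF finite_atLeastLessThan] sum_distrib_left)
  also have "\<dots> = (\<Sum>S\<in>Pow ?U. \<Sum>\<pi> | \<pi> permutes ?U. ?s \<pi> *
      ((\<Prod>j\<in>S. t * A $$ (j, \<pi> j)) * (\<Prod>j\<in>?U - S. if j = \<pi> j then 1 else 0)))"
    by (rule sum.swap)
  also have "\<dots> = (\<Sum>S\<in>Pow ?U. perm_minor A S * t ^ card S)"
  proof (rule sum.cong[OF refl])
    fix S assume S: "S \<in> Pow ?U"
    have pS: "\<pi> permutes S \<longleftrightarrow> \<pi> permutes ?U \<and> (\<forall>j\<in>?U - S. j = \<pi> j)" for \<pi>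
      using S permutes_subset[of \<pi> S ?U] permutes_superset[of \<pi> ?U S]
      by (metis DiffD2 Pow_iff permutes_not_in)
    have "(\<Sum>\<pi> | \<pi> permutes ?U. ?s \<pi> *
      ((\<Prod>j\<in>S. t * A $$ (j, \<pi> j)) * (\<Prod>j\<in>?U - S. if j = \<pi> j then 1 else 0))) =
      (\<Sum>\<pi> | \<pi> permutes ?U. if \<forall>j\<in>?U - S. j = \<pi> j then ?s \<pi> * (\<Prod>j\<in>S. t * A $$ (j, \<pi> j)) else 0)"
      proof (intro sum.cong refl, goal_cases)
      case (1 \<pi>)
      have "(\<Prod>j\<in>?U - S. if j = \<pi> j then 1 else 0 :: 'a) = (if \<forall>j\<in>?U - S. j = \<pi> j then 1 else 0)"
        by (auto intro!: prod_zero prod.neutral)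
      then show ?case by simp
    qed
    also have "\<dots> = (\<Sum>\<pi> | \<pi> permutes S. ?s \<pi> * (\<Prod>j\<in>S. t * A $$ (j, \<pi> j)))"
      unfolding pS by (subst sum.inter_filter[symmetric]) (auto simp: finite_permutations)
    also have "\<dots> = perm_minor A S * t ^ card S"
      by (simp add: perm_minor_def prod.distrib sum_distrib_left mult_ac)
    finally show "(\<Sum>\<pi> | \<pi> permutes ?U. ?s \<pi> *
      ((\<Prod>j\<in>S. t * A $$ (j, \<pi> j)) * (\<Prod>j\<in>?U - S. if j = \<pi> j then 1 else 0))) =
      perm_minor A S * t ^ card S" .
  qed
  also have "\<dots> = (\<Sum>k\<le>d. \<Sum>S\<in>{S \<in> Pow ?U. card S = k}. perm_minor A S * t ^ card S)"
    by (rule sum.group[symmetric]) (use card_mono[of ?U] in auto)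
  also have "\<dots> = (\<Sum>k\<le>d. mat_trace (ext_power k A) * t ^ k)"
    using A by (simp add: trace_ext_power sum_distrib_right Pow_def)
  finally show ?thesis .
qed

lemma ext_power_large:
  assumes "dim_row A < k"
  shows "mat_trace (ext_power k A) = 0"
proof -
  have "{S. S \<subseteq> {0..<dim_row A} \<and> card S = k} = {}"
  proof -
    have "card S \<le> dim_row A" if "S \<subseteq> {0..<dim_row A}" for S
      using card_mono[OF _ that] by simp
    with assms have "\<not> (S \<subseteq> {0..<dim_row A} \<and> card S = k)" for S
      by (meson leD)
    then show ?thesis by (simp only: empty_def) 
  qed
  then show ?thesis by (simp only: trace_ext_power[OF refl] sum.empty)
qed

text \<open>A Schur triangularisation of \<open>P\<close> is again idempotent, so its diagonal
  consists of zeros and ones and the determinant is the product along the diagonal. The exponent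
  counts the ones, that is, the rank of \<open>P\<close>.\<close>

lemma det_one_plus_idempotent:
  fixes P :: "complex mat"
  assumes P: "P \<in> carrier_mat d d" and idem: "P * P = P"
  shows "\<exists>m. \<forall>s. det (1\<^sub>m d + s \<cdot>\<^sub>m P) = (1 + s) ^ m"
proof -
  obtain es where "char_poly P = (\<Prod>a\<leftarrow>es. [:- a, 1:])"
    using char_poly_factorized[OF P] by auto
  then obtain B where B: "B \<in> carrier_mat d d" and tri: "upper_triangular B" and "similar_mat P B"
    using schur_decomposition_exists[OF P] by blast
  then obtain S T where w: "similar_mat_wit P B S T"
    by (auto simp: similar_mat_def)
  note w' = similar_mat_witD2[OF P w]
  note c = w'(5-7) P
  have ST: "S * T = 1\<^sub>m d" "T * S = 1\<^sub>m d" "P = S * B * T" using w' by auto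
  have B_eq: "B = T * P * S"
  proof -
    have "T * P * S = T * (S * B * T) * S" by (simp only: ST(3)[symmetric])
    also have "\<dots> = (T * S) * B * (T * S)"
      using c by (simp add: assoc_mult_mat[of _ d d _ d _ d])
    also have "\<dots> = B" using c ST(2) by simp
    finally show ?thesis ..
  qed
  have "B * B = T * (P * (S * T) * P) * S"
    unfolding B_eq using c(2,3,4) by (simp add: assoc_mult_mat[of _ d d _ d _ d])
  also have "\<dots> = T * (P * P) * S"
    using c(2,3,4) by (simp add: ST(1))
  also have "\<dots> = B"
    by (simp only: idem B_eq)
  finally have BB: "B * B = B" .
  have diag: "B $$ (j, j) \<in> {0, 1}" if j: "j < d" for j
  proof -
    have "B $$ (j, j) = (\<Sum>l = 0..<d. B $$ (j, l) * B $$ (l, j))"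
    proof -
      have "B $$ (j, j) = (B * B) $$ (j, j)" by (simp only: BB)
      also have "\<dots> = (\<Sum>l = 0..<d. B $$ (j, l) * B $$ (l, j))"
        using B j by (simp add: scalar_prod_def)
      finally show ?thesis .
    qed
    \<comment> \<open>For l < j the first factor lies below the diagonal, for l > j the second one
      does; only the square of the diagonal entry survives.\<close>
    also have "\<dots> = (\<Sum>l\<in>{j}. B $$ (j, l) * B $$ (l, j))"
    proof (rule sum.mono_neutral_right)
      show "\<forall>l\<in>{0..<d} - {j}. B $$ (j, l) * B $$ (l, j) = 0"
      proof
        fix l assume "l \<in> {0..<d} - {j}"
        then consider "l < j" | "j < l" "l < d" by fastforce
        then show "B $$ (j, l) * B $$ (l, j) = 0"
          using upper_triangularD[OF tri] B j by cases auto
      qed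
    qed (use j in auto)
    finally have "B $$ (j, j) * (B $$ (j, j) - 1) = 0" by (simp add: algebra_simps)
    then show ?thesis by simp
  qed
  have "det (1\<^sub>m d + s \<cdot>\<^sub>m P) = (1 + s) ^ card {j\<in>{0..<d}. B $$ (j, j) = 1}" for s
  proof -
    have "1\<^sub>m d + s \<cdot>\<^sub>m P = S * (1\<^sub>m d + s \<cdot>\<^sub>m B) * T"
    proof -
      have "S * (1\<^sub>m d + s \<cdot>\<^sub>m B) = S + s \<cdot>\<^sub>m (S * B)"
        using c(1-3) by (subst mult_add_distrib_mat[of _ d d _ d]) (auto simp: mult_smult_distrib[of _ d d _ d])
      also have "\<dots> * T = S * T + s \<cdot>\<^sub>m (S * B * T)"
        using c(1-3) by (subst add_mult_distrib_mat[of _ d d _ _ d]) (auto simp: mult_smult_assoc_mat[of _ d d _ d])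
      finally have "S * (1\<^sub>m d + s \<cdot>\<^sub>m B) * T = S * T + s \<cdot>\<^sub>m (S * B * T)" .
      then show ?thesis by (simp only: ST(1) ST(3)[symmetric])
    qed
    then have "similar_mat (1\<^sub>m d + s \<cdot>\<^sub>m P) (1\<^sub>m d + s \<cdot>\<^sub>m B)"
      using c ST(1,2) by (intro similar_matI[of _ _ S T d]) auto
    then have "det (1\<^sub>m d + s \<cdot>\<^sub>m P) = det (1\<^sub>m d + s \<cdot>\<^sub>m B)" by (rule det_similar)
    also have "\<dots> = prod_list (diag_mat (1\<^sub>m d + s \<cdot>\<^sub>m B))"
      using tri B by (intro det_upper_triangular[of _ d]) (auto simp: upper_triangular_def)
    also have "\<dots> = (\<Prod>j = 0..<d. if B $$ (j, j) = 1 then 1 + s else 1)"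
    proof -
      have "(1\<^sub>m d + s \<cdot>\<^sub>m B) $$ (j, j) = (if B $$ (j, j) = 1 then 1 + s else 1)" if "j < d" for j
        using B diag[OF that] that by auto
      then show ?thesis
        using B by (auto simp: prod_list_diag_prod intro!: prod.cong simp del: index_add_mat(1))
    qed
    also have "\<dots> = (1 + s) ^ card {j\<in>{0..<d}. B $$ (j, j) = 1}"
      by (simp add: prod.If_cases Int_def)
    finally show ?thesis .
  qed
  then show ?thesis by blast
qed

section \<open>Representations of a self-dual finite abelian group\<close>

lemma mat_trace_ext_power_1:
  fixes A :: "'a::comm_ring_1 mat"
  shows "mat_trace (ext_power 1 A) = mat_trace A"
proof -
  have S: "{S. S \<subseteq> {0..<dim_row A} \<and> card S = 1} = (\<lambda>j. {j}) ` {0..<dim_row A}"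
    by (auto simp: card_Suc_eq)
  have "mat_trace (ext_power 1 A) = (\<Sum>j\<in>{0..<dim_row A}. perm_minor A {j})"
    unfolding trace_ext_power[OF refl] S by (simp add: sum.reindex)
  then show ?thesis
    by (simp add: perm_minor_def mat_trace_def lessThan_atLeast0)
qed

section \<open>Integer powers of formal power series\<close>

definition fps_powi :: "'a::field fps \<Rightarrow> int \<Rightarrow> 'a fps" where
  "fps_powi f k = f ^ nat k * inverse f ^ nat (- k)"

lemma fps_powi_of_nat [simp]: "fps_powi f (int k) = f ^ k"
  by (simp add: fps_powi_def)

lemma fps_powi_0 [simp]: "fps_powi f 0 = 1"
  by (simp add: fps_powi_def)

text \<open>With an invertible constant term, a product of powers of f and its inverse depends only
  on the difference of the exponents. Integer exponents are required because virtual characters have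
  negative multiplicities.\<close>

lemma fps_powi_add:
  assumes "fps_nth f 0 \<noteq> 0"
  shows "fps_powi f (j + k) = fps_powi f j * fps_powi f k"
proof -
  have inv: "f ^ a * inverse f ^ a = 1" for a
    using inverse_mult_eq_1[OF assms] by (metis mult.commute power_mult_distrib power_one)
  have eq: "f ^ a * inverse f ^ b = f ^ c * inverse f ^ e" if "a + e = c + b" for a b c e
  proof -
    have "f ^ a * inverse f ^ b = (f ^ a * inverse f ^ b) * (f ^ e * inverse f ^ e)"
      by (simp only: inv mult_1_right)
    also have "\<dots> = f ^ (a + e) * inverse f ^ (b + e)"
      by (simp only: power_add mult_ac)
    also have "\<dots> = (f ^ c * inverse f ^ e) * (f ^ b * inverse f ^ b)"
      unfolding that by (simp only: power_add mult_ac)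
    also have "\<dots> = f ^ c * inverse f ^ e"
      by (simp only: inv mult_1_right)
    finally show ?thesis .
  qed
  have "nat (j + k) + (nat (- j) + nat (- k)) = (nat j + nat k) + nat (- (j + k))"
    by linarith
  from eq[OF this] have "fps_powi f (j + k) = f ^ (nat j + nat k) * inverse f ^ (nat (- j) + nat (- k))"
    by (simp only: fps_powi_def)
  also have "\<dots> = fps_powi f j * fps_powi f k"
    by (simp only: fps_powi_def power_add mult_ac)
  finally show ?thesis .
qed

lemma fps_powi_nth_0: "fps_nth f 0 = 1 \<Longrightarrow> fps_nth (fps_powi f k) 0 = 1"
  by (simp add: fps_powi_def fps_nth_power_0)

text \<open>A symmetric nondegenerate bicharacter identifies the group with its own character group,
  so characters can be named by group elements and multiplied as such. Symmetry lets a single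
  orthogonality relation serve for sums over the group and for sums over the characters.\<close>

locale self_dual_group = comm_group G for G :: "('a, 'b) monoid_scheme" (structure) +
  fixes \<chi> :: "'a \<Rightarrow> 'a \<Rightarrow> complex"
  assumes finite_carrier: "finite (carrier G)"
    and chi_mult: "\<And>a b g. a \<in> carrier G \<Longrightarrow> b \<in> carrier G \<Longrightarrow> g \<in> carrier G \<Longrightarrow>
      \<chi> (a \<otimes> b) g = \<chi> a g * \<chi> b g"
    and chi_sym: "\<And>a g. a \<in> carrier G \<Longrightarrow> g \<in> carrier G \<Longrightarrow> \<chi> a g = \<chi> g a"
    and chi_nonzero: "\<And>a g. a \<in> carrier G \<Longrightarrow> g \<in> carrier G \<Longrightarrow> \<chi> a g \<noteq> 0"
    and chi_nondegenerate: "\<And>a. a \<in> carrier G \<Longrightarrow> (\<And>g. g \<in> carrier G \<Longrightarrow> \<chi> a g = 1) \<Longrightarrow> a = \<one>"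
begin

lemma chi_one: "g \<in> carrier G \<Longrightarrow> \<chi> \<one> g = 1"
  using chi_mult[of \<one> \<one> g] chi_nonzero[of \<one> g] by simp

lemma chi_one_right: "a \<in> carrier G \<Longrightarrow> \<chi> a \<one> = 1"
  using chi_one[of a] chi_sym[of a \<one>] by simp

lemma chi_mult_right:
  "a \<in> carrier G \<Longrightarrow> g \<in> carrier G \<Longrightarrow> h \<in> carrier G \<Longrightarrow> \<chi> a (g \<otimes> h) = \<chi> a g * \<chi> a h"
  using chi_mult[of g h a] by (simp add: chi_sym[of a])

lemma chi_inv: "a \<in> carrier G \<Longrightarrow> g \<in> carrier G \<Longrightarrow> \<chi> (inv a) g = inverse (\<chi> a g)"
  using chi_mult[of a "inv a" g] chi_one[of g] inverse_unique[of "\<chi> a g" "\<chi> (inv a) g"] by simp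

section \<open>Fourier analysis with respect to the pairing\<close>

definition N :: complex where "N = of_nat (card (carrier G))"

lemma N_nonzero: "N \<noteq> 0"
  using finite_carrier by (auto simp: N_def)

lemma sum_translate:
  assumes "g \<in> carrier G"
  shows "(\<Sum>h\<in>carrier G. f (g \<otimes> h)) = (\<Sum>h\<in>carrier G. f h)"
proof (rule sum.reindex_bij_betw)
  show "bij_betw ((\<otimes>) g) (carrier G) (carrier G)"
    using assms by (simp add: bij_betw_def inj_on_cmult surj_const_mult)
qed

lemma sum_chi:
  assumes a: "a \<in> carrier G"
  shows "(\<Sum>g\<in>carrier G. \<chi> a g) = (if a = \<one> then N else 0)"
proof (cases "a = \<one>")
  case True
  then show ?thesis by (simp add: chi_one N_def)
next
  case False
  then obtain h where h: "h \<in> carrier G" "\<chi> a h \<noteq> 1"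
    using chi_nondegenerate[OF a] by blast
  have "(\<Sum>g\<in>carrier G. \<chi> a g) = (\<Sum>g\<in>carrier G. \<chi> a (h \<otimes> g))"
    by (rule sum_translate[OF h(1), symmetric])
  also have "\<dots> = \<chi> a h * (\<Sum>g\<in>carrier G. \<chi> a g)"
    unfolding sum_distrib_left by (rule sum.cong[OF refl]) (simp add: chi_mult_right a h)
  finally show ?thesis using h(2) False by simp
qed

lemma chi_orthogonal:
  assumes "a \<in> carrier G" "b \<in> carrier G"
  shows "(\<Sum>g\<in>carrier G. \<chi> a g * \<chi> (inv b) g) = (if a = b then N else 0)"
proof -
  have "(\<Sum>g\<in>carrier G. \<chi> a g * \<chi> (inv b) g) = (\<Sum>g\<in>carrier G. \<chi> (a \<otimes> inv b) g)"
    by (rule sum.cong[OF refl]) (simp add: chi_mult assms)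
  also have "\<dots> = (if a \<otimes> inv b = \<one> then N else 0)"
    by (rule sum_chi) (simp add: assms)
  also have "a \<otimes> inv b = \<one> \<longleftrightarrow> a = b"
    using assms by (metis inv_equality inv_inv inv_closed r_inv)
  finally show ?thesis .
qed

text \<open>Symmetry of the pairing exchanges characters and group elements, which turns this into
  \<open>chi_orthogonal\<close>.\<close>

lemma chi_orthogonal_dual:
  assumes "g \<in> carrier G" "h \<in> carrier G"
  shows "(\<Sum>a\<in>carrier G. \<chi> a g * \<chi> (inv a) h) = (if g = h then N else 0)"
proof -
  have "(\<Sum>a\<in>carrier G. \<chi> a g * \<chi> (inv a) h) = (\<Sum>a\<in>carrier G. \<chi> g a * \<chi> (inv h) a)"
  proof (rule sum.cong[OF refl])
    fix a assume a: "a \<in> carrier G"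
    then show "\<chi> a g * \<chi> (inv a) h = \<chi> g a * \<chi> (inv h) a"
      using chi_inv[of a h] chi_inv[of h a] assms by (simp add: chi_sym[of _ a])
  qed
  then show ?thesis using chi_orthogonal[OF assms] by simp
qed

definition comb :: "('a \<Rightarrow> int) \<Rightarrow> 'a \<Rightarrow> complex" where
  "comb c = (\<lambda>g\<in>carrier G. \<Sum>a\<in>carrier G. of_int (c a) * \<chi> a g)"

text \<open>The Fourier coefficient at \<open>a\<close>, forced into the integers by real part and
  floor. On integer combinations the rounding is exact by orthogonality, which also shows that the
  coefficients are determined by the function.\<close>

definition coef :: "('a \<Rightarrow> complex) \<Rightarrow> 'a \<Rightarrow> int" where
  "coef x a = \<lfloor>Re ((\<Sum>g\<in>carrier G. x g * \<chi> (inv a) g) / N)\<rfloor>"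

lemma coef_comb:
  assumes a: "a \<in> carrier G"
  shows "coef (comb c) a = c a"
proof -
  have "(\<Sum>g\<in>carrier G. comb c g * \<chi> (inv a) g) =
      (\<Sum>g\<in>carrier G. \<Sum>b\<in>carrier G. of_int (c b) * (\<chi> b g * \<chi> (inv a) g))"
    by (rule sum.cong[OF refl]) (simp add: comb_def sum_distrib_right mult.assoc)
  also have "\<dots> = (\<Sum>b\<in>carrier G. of_int (c b) * (\<Sum>g\<in>carrier G. \<chi> b g * \<chi> (inv a) g))"
    unfolding sum_distrib_left by (rule sum.swap)
  also have "\<dots> = (\<Sum>b\<in>carrier G. if b = a then of_int (c b) * N else 0)"
    by (rule sum.cong[OF refl]) (simp add: chi_orthogonal a)
  also have "\<dots> = of_int (c a) * N"
    using a finite_carrier by simp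
  finally show ?thesis
    using N_nonzero by (simp add: coef_def)
qed

text \<open>The Fourier projections of \<rho> are orthogonal idempotents, and \<rho>(g) is the sum
  of their multiples by \<chi>_a(g). Hence 1 + t \<rho>(g) is the product of the factors 1 + t
  \<chi>_a(g) P_a, and each factor has the determinant found for an idempotent.\<close>

lemma representation_det:
  assumes rep: "representation G d \<rho>"
  shows "\<exists>m :: 'a \<Rightarrow> nat. \<forall>g\<in>carrier G. \<forall>t.
    det (1\<^sub>m d + t \<cdot>\<^sub>m \<rho> g) = (\<Prod>a\<in>carrier G. (1 + \<chi> a g * t) ^ m a)"
proof -
  let ?M = "ring_mat TYPE(complex) d ()"
  interpret M: ring ?M by (rule ring_mat)
  have hom: "\<rho> \<in> hom G (units_of ?M)" using rep by (simp add: representation_def)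
  have car: "\<rho> g \<in> carrier_mat d d" if "g \<in> carrier G" for g
    using hom_in_carrier[OF hom that] by (auto simp: units_of_def Units_def ring_mat_simps)
  have mult: "\<rho> (g \<otimes> h) = \<rho> g * \<rho> h" if "g \<in> carrier G" "h \<in> carrier G" for g h
    using hom_mult[OF hom that] by (simp add: units_of_def ring_mat_simps)
  have one: "\<rho> \<one> = 1\<^sub>m d"
    using hom_one[OF hom is_group M.units_group] by (simp add: units_of_def ring_mat_simps)
  define r where "r g i j = \<rho> g $$ (i, j)" for g i j
  have r_mult: "r (g \<otimes> h) i j = (\<Sum>k<d. r g i k * r h k j)"
    if "g \<in> carrier G" "h \<in> carrier G" "i < d" "j < d" for g h i j
    using car[OF that(1)] car[OF that(2)] that
    by (simp add: r_def mult scalar_prod_def lessThan_atLeast0)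
  \<comment> \<open>Entry by entry, the projection onto the isotypic part of the character
    \<open>a\<close>: the average of \<chi>_a(h)^-1 \<rho>(h) over the group.\<close>
  define e where "e a i j = (\<Sum>h\<in>carrier G. \<chi> (inv a) h * r h i j) / N" for a i j
  \<comment> \<open>\<rho>(g) acts as the scalar \<chi>_b(g) on the image of the projection for b,
    as seen by replacing h with g h in the average.\<close>
  have re: "(\<Sum>k<d. r g i k * e b k j) = \<chi> b g * e b i j"
    if g: "g \<in> carrier G" and b: "b \<in> carrier G" and ij: "i < d" "j < d" for g b i j
  proof -
    have "(\<Sum>k<d. r g i k * e b k j) =
        (\<Sum>k<d. \<Sum>h\<in>carrier G. \<chi> (inv b) h * (r g i k * r h k j)) / N"
      by (simp add: e_def sum_divide_distrib sum_distrib_left mult_ac)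
    also have "\<dots> = (\<Sum>h\<in>carrier G. \<chi> (inv b) h * (\<Sum>k<d. r g i k * r h k j)) / N"
      unfolding sum_distrib_left by (subst sum.swap) (rule refl)
    also have "\<dots> = (\<Sum>h\<in>carrier G. \<chi> b g * (\<chi> (inv b) (g \<otimes> h) * r (g \<otimes> h) i j)) / N"
    proof -
      have "\<chi> (inv b) h * (\<Sum>k<d. r g i k * r h k j) = \<chi> b g * (\<chi> (inv b) (g \<otimes> h) * r (g \<otimes> h) i j)"
        if h: "h \<in> carrier G" for h
        using g b h ij chi_nonzero[OF b g] by (simp add: r_mult chi_mult_right chi_inv)
      then show ?thesis by simp
    qed
    also have "\<dots> = \<chi> b g * e b i j"
      unfolding sum_distrib_left[symmetric] e_def
      by (subst sum_translate[OF g, where f = "\<lambda>h. \<chi> (inv b) h * r h i j"]) simp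
    finally show ?thesis .
  qed
  have ee: "(\<Sum>k<d. e a i k * e b k j) = (if a = b then e b i j else 0)"
    if a: "a \<in> carrier G" and b: "b \<in> carrier G" and ij: "i < d" "j < d" for a b i j
  proof -
    have "(\<Sum>k<d. e a i k * e b k j) =
        (\<Sum>k<d. \<Sum>h\<in>carrier G. \<chi> (inv a) h * (r h i k * e b k j)) / N"
    proof -
      have "e a i k * e b k j = (\<Sum>h\<in>carrier G. \<chi> (inv a) h * (r h i k * e b k j)) / N" for k
        by (simp add: e_def[of a] sum_distrib_right mult.assoc)
      then show ?thesis by (simp only: sum_divide_distrib)
    qed
    also have "\<dots> = (\<Sum>h\<in>carrier G. \<chi> (inv a) h * (\<Sum>k<d. r h i k * e b k j)) / N"
      unfolding sum_distrib_left by (subst sum.swap) (rule refl)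
    also have "\<dots> = (\<Sum>h\<in>carrier G. (\<chi> b h * \<chi> (inv a) h) * e b i j) / N"
      by (rule arg_cong[where f = "\<lambda>z. z / N"], rule sum.cong[OF refl])
        (simp add: re[OF _ b ij] mult.assoc mult.left_commute)
    also have "\<dots> = (if a = b then e b i j else 0)"
      unfolding sum_distrib_right[symmetric] using N_nonzero by (simp add: chi_orthogonal a b)
    finally show ?thesis .
  qed
  \<comment> \<open>Fourier inversion: \<rho>(g) is recovered from its projections by the dual
    orthogonality relation.\<close>
  have r_eq: "r g i j = (\<Sum>a\<in>carrier G. \<chi> a g * e a i j)" if g: "g \<in> carrier G" for g i j
  proof -
    have "(\<Sum>a\<in>carrier G. \<chi> a g * e a i j) =
        (\<Sum>a\<in>carrier G. \<Sum>h\<in>carrier G. r h i j * (\<chi> a g * \<chi> (inv a) h)) / N"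
      by (simp add: e_def sum_divide_distrib sum_distrib_left mult_ac)
    also have "\<dots> = (\<Sum>h\<in>carrier G. r h i j * (\<Sum>a\<in>carrier G. \<chi> a g * \<chi> (inv a) h)) / N"
      unfolding sum_distrib_left by (subst sum.swap) (rule refl)
    also have "\<dots> = (\<Sum>h\<in>carrier G. if g = h then r h i j * N else 0) / N"
      by (rule arg_cong[where f = "\<lambda>z. z / N"], rule sum.cong[OF refl]) (simp add: chi_orthogonal_dual g)
    also have "\<dots> = r g i j"
      using g finite_carrier N_nonzero by simp
    finally show ?thesis ..
  qed
  define P where "P a = mat d d (\<lambda>(i, j). e a i j)" for a
  have P: "P a \<in> carrier_mat d d" for a by (simp add: P_def)
  \<comment> \<open>The projections do not involve g or t, so the exponents are chosen before both
    and form one multiplicity function for the whole representation.\<close>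
  have "\<forall>a\<in>carrier G. \<exists>m. \<forall>s. det (1\<^sub>m d + s \<cdot>\<^sub>m P a) = (1 + s) ^ m"
  proof
    fix a assume a: "a \<in> carrier G"
    show "\<exists>m. \<forall>s. det (1\<^sub>m d + s \<cdot>\<^sub>m P a) = (1 + s) ^ m"
  proof (rule det_one_plus_idempotent[OF P])
    show "P a * P a = P a"
    proof (rule eq_matI)
      fix i j assume "i < dim_row (P a)" "j < dim_col (P a)"
      then have ij: "i < d" "j < d" by (simp_all add: P_def)
      then have "(P a * P a) $$ (i, j) = (\<Sum>k<d. e a i k * e a k j)"
        by (simp add: P_def scalar_prod_def lessThan_atLeast0)
      then show "(P a * P a) $$ (i, j) = P a $$ (i, j)"
        using ij ee[OF a a ij] by (simp add: P_def)
    qed (simp_all add: P_def)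
  qed
  qed
  from bchoice[OF this] obtain m where
    m: "\<forall>a\<in>carrier G. \<forall>s. det (1\<^sub>m d + s \<cdot>\<^sub>m P a) = (1 + s) ^ m a" ..
  have "det (1\<^sub>m d + t \<cdot>\<^sub>m \<rho> g) = (\<Prod>a\<in>carrier G. (1 + \<chi> a g * t) ^ m a)" if g: "g \<in> carrier G" for g t
  proof -
    define s where "s a = \<chi> a g * t" for a
    define Q where "Q S = mat d d (\<lambda>(i, j). \<Sum>a\<in>S. s a * e a i j)" for S
    have Q: "Q S \<in> carrier_mat d d" for S by (simp add: Q_def)
    \<comment> \<open>Characters are added one at a time: for b outside \<open>S\<close> the product
      \<open>Q S * P b\<close> vanishes, so multiplying 1 + \<open>Q S\<close> by 1 +
      \<open>s b\<close> times \<open>P b\<close> just adds the new term.\<close>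
    have "det (1\<^sub>m d + Q S) = (\<Prod>a\<in>S. (1 + s a) ^ m a)" if "finite S" "S \<subseteq> carrier G" for S
      using that
    proof (induction S rule: finite_induct)
      case empty
      have "1\<^sub>m d + Q {} = 1\<^sub>m d" by (rule eq_matI) (simp_all add: Q_def)
      then show ?case by simp
    next
      case (insert b S)
      have QP: "Q S * P b = 0\<^sub>m d d"
      proof (rule eq_matI)
        fix i j assume "i < dim_row (0\<^sub>m d d :: complex mat)" "j < dim_col (0\<^sub>m d d :: complex mat)"
        then have ij: "i < d" "j < d" by simp_all
        then have "(Q S * P b) $$ (i, j) = (\<Sum>k<d. \<Sum>a\<in>S. s a * (e a i k * e b k j))"
          by (simp add: P_def Q_def scalar_prod_def lessThan_atLeast0 sum_distrib_right mult.assoc)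
        also have "\<dots> = (\<Sum>a\<in>S. s a * (\<Sum>k<d. e a i k * e b k j))"
          unfolding sum_distrib_left by (rule sum.swap)
        also have "\<dots> = 0"
          using insert.hyps insert.prems ij by (intro sum.neutral) (auto simp: ee subset_iff)
        finally show "(Q S * P b) $$ (i, j) = 0\<^sub>m d d $$ (i, j)" using ij by simp
      qed (simp_all add: P_def Q_def)
      have "(1\<^sub>m d + Q S) * (1\<^sub>m d + s b \<cdot>\<^sub>m P b) =
          (1\<^sub>m d + Q S) * 1\<^sub>m d + (1\<^sub>m d + Q S) * (s b \<cdot>\<^sub>m P b)"
        using P Q by (intro mult_add_distrib_mat[of _ d d _ d]) auto
      also have "(1\<^sub>m d + Q S) * (s b \<cdot>\<^sub>m P b) = s b \<cdot>\<^sub>m ((1\<^sub>m d + Q S) * P b)"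
        using P Q by (intro mult_smult_distrib[of _ d d _ d]) auto
      also have "(1\<^sub>m d + Q S) * P b = 1\<^sub>m d * P b + Q S * P b"
        using P Q by (intro add_mult_distrib_mat[of _ d d _ _ d]) auto
      also have "(1\<^sub>m d + Q S) * 1\<^sub>m d + s b \<cdot>\<^sub>m (1\<^sub>m d * P b + Q S * P b) = 1\<^sub>m d + Q (insert b S)"
        unfolding QP by (rule eq_matI) (use insert.hyps in \<open>simp_all add: P_def Q_def add_ac\<close>)
      finally have "1\<^sub>m d + Q (insert b S) = (1\<^sub>m d + Q S) * (1\<^sub>m d + s b \<cdot>\<^sub>m P b)" ..
      then have "det (1\<^sub>m d + Q (insert b S)) = det (1\<^sub>m d + Q S) * det (1\<^sub>m d + s b \<cdot>\<^sub>m P b)"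
        using P Q by (simp only:) (rule det_mult[of _ d], auto)
      then show ?case
        using insert by (simp add: m mult.commute)
    qed
    from this[OF finite_carrier subset_refl]
    have "det (1\<^sub>m d + Q (carrier G)) = (\<Prod>a\<in>carrier G. (1 + s a) ^ m a)" .
    moreover have "Q (carrier G) = t \<cdot>\<^sub>m \<rho> g"
      using car[OF g] g by (intro eq_matI)
        (simp_all add: Q_def s_def r_def[symmetric] r_eq sum_distrib_left mult_ac)
    ultimately show ?thesis by (simp add: s_def)
  qed
  then show ?thesis by blast
qed

end

section \<open>The character ring\<close>

lemma fps_nth_power_1: "fps_nth F 0 = (1::'a::comm_ring_1) \<Longrightarrow> fps_nth (F ^ k) 1 = of_nat k * fps_nth F 1"
proof (induction k)
  case (Suc k)
  have "fps_nth (F ^ Suc k) 1 = fps_nth F 0 * fps_nth (F ^ k) 1 + fps_nth F 1 * fps_nth (F ^ k) 0"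
    by (simp add: fps_mult_nth)
  then show ?case using Suc by (simp add: fps_nth_power_0 algebra_simps)
qed simp

lemma fps_nth_prod_0: "fps_nth (prod F S) 0 = (\<Prod>a\<in>S. fps_nth (F a) 0)"
  for F :: "'b \<Rightarrow> 'a::comm_ring_1 fps"
  by (induction S rule: infinite_finite_induct) simp_all

lemma fps_nth_prod_1:
  fixes F :: "'b \<Rightarrow> 'a::comm_ring_1 fps"
  assumes "finite S" "\<And>a. a \<in> S \<Longrightarrow> fps_nth (F a) 0 = 1"
  shows "fps_nth (prod F S) 1 = (\<Sum>a\<in>S. fps_nth (F a) 1)"
  using assms
proof (induction S rule: finite_induct)
  case (insert a S)
  have "fps_nth (prod F (insert a S)) 1 = fps_nth (F a) 0 * fps_nth (prod F S) 1 + fps_nth (F a) 1 * fps_nth (prod F S) 0"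
    using insert by (simp add: fps_mult_nth)
  then show ?case using insert by (simp add: fps_nth_prod_0)
qed simp

lemma fps_one_plus_X_power_nth:
  "fps_nth ((1 + fps_X) ^ m :: 'a::comm_ring_1 fps) j = of_nat (m choose j)"
proof (induction m arbitrary: j)
  case 0
  then show ?case by (cases j) simp_all
next
  case (Suc m)
  then show ?case by (cases j) (simp_all add: distrib_right fps_X_mult_nth del: fps_add_nth add: fps_add_nth)
qed

text \<open>Multiplication by 1/(1 - X) forms partial sums of coefficients, and partial sums of
  binomial coefficients along a diagonal are again binomial coefficients.\<close>

lemma fps_inverse_one_minus_X_power_nth:
  "fps_nth (inverse (1 - fps_X) ^ Suc i :: 'a::field_char_0 fps) k = of_nat ((i + k) choose k)"
proof (induction i arbitrary: k)
  case 0
  then show ?case by (simp add: fps_inverse_one_minus_fps_X)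
next
  case (Suc i)
  have "fps_nth (inverse (1 - fps_X) ^ Suc (Suc i) :: 'a fps) k =
      fps_nth (inverse (1 - fps_X) ^ Suc i * Abs_fps (\<lambda>n. 1) :: 'a fps) k"
    by (simp add: fps_inverse_one_minus_fps_X mult.commute)
  also have "\<dots> = (\<Sum>j\<le>k. of_nat ((i + j) choose j))"
    by (simp only: fps_mult_nth Suc.IH fps_nth_Abs_fps mult_1_right atLeast0AtMost)
  also have "\<dots> = of_nat ((Suc i + k) choose k)"
    using sum_choose_lower[of i k] by (simp flip: of_nat_sum)
  finally show ?case .
qed

section \<open>Integer combinations of linear characters and their exterior power series\<close>

context self_dual_group
begin

abbreviation R where "R \<equiv> char_ring G"

definition ch :: "'a \<Rightarrow> 'a \<Rightarrow> complex" where
  "ch a = (\<lambda>g\<in>carrier G. \<chi> a g)"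

lemma R_sel:
  "x \<oplus>\<^bsub>R\<^esub> y = (\<lambda>g\<in>carrier G. x g + y g)" "x \<otimes>\<^bsub>R\<^esub> y = (\<lambda>g\<in>carrier G. x g * y g)"
  "\<zero>\<^bsub>R\<^esub> = (\<lambda>g\<in>carrier G. 0)" "\<one>\<^bsub>R\<^esub> = (\<lambda>g\<in>carrier G. 1)"
  by (simp_all add: char_ring_def function_ring_def)

lemma comb_apply: "g \<in> carrier G \<Longrightarrow> comb c g = (\<Sum>a\<in>carrier G. of_int (c a) * \<chi> a g)"
  by (simp add: comb_def)

lemma comb_eqI:
  "x \<in> extensional (carrier G) \<Longrightarrow> (\<And>g. g \<in> carrier G \<Longrightarrow> x g = comb c g) \<Longrightarrow> x = comb c"
  by (rule extensionalityI[of _ "carrier G"]) (auto simp: comb_def)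

lemma comb_add: "(\<lambda>g\<in>carrier G. comb c g + comb d g) = comb (\<lambda>a. c a + d a)"
  by (rule comb_eqI) (simp_all add: comb_apply sum.distrib distrib_right)

lemma comb_neg: "(\<lambda>g\<in>carrier G. - comb c g) = comb (\<lambda>a. - c a)"
  by (rule comb_eqI) (simp_all add: comb_apply sum_negf)

lemma comb_zero: "(\<lambda>g\<in>carrier G. 0) = comb (\<lambda>a. 0)"
  by (rule comb_eqI) (simp_all add: comb_apply)

lemma comb_delta:
  assumes "a \<in> carrier G"
  shows "comb (\<lambda>b. if b = a then k else 0) = (\<lambda>g\<in>carrier G. of_int k * \<chi> a g)"
proof (rule comb_eqI[symmetric])
  fix g assume g: "g \<in> carrier G"
  have "comb (\<lambda>b. if b = a then k else 0) g = (\<Sum>b\<in>carrier G. if b = a then of_int k * \<chi> b g else 0)"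
    unfolding comb_apply[OF g] by (rule sum.cong) auto
  then show "(\<lambda>g\<in>carrier G. of_int k * \<chi> a g) g = comb (\<lambda>b. if b = a then k else 0) g"
    using assms g finite_carrier by simp
qed simp

lemma ch_eq_comb: "a \<in> carrier G \<Longrightarrow> ch a = comb (\<lambda>b. if b = a then 1 else 0)"
  by (simp add: comb_delta ch_def)

lemma comb_const: "(\<lambda>g\<in>carrier G. of_int k) = comb (\<lambda>b. if b = \<one> then k else 0)"
  by (subst comb_delta) (auto simp: chi_one)

text \<open>Linear characters multiply as the group elements that index them, so on coefficients the
  pointwise product is the convolution of the integral group ring.\<close>

lemma comb_mult:
  "(\<lambda>g\<in>carrier G. comb c g * comb d g) = comb (\<lambda>b. \<Sum>a\<in>carrier G. c a * d (inv a \<otimes> b))"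
proof (rule comb_eqI)
  fix g assume g: "g \<in> carrier G"
  have "comb c g * comb d g = (\<Sum>a\<in>carrier G. \<Sum>b\<in>carrier G. of_int (c a * d b) * \<chi> (a \<otimes> b) g)"
    unfolding comb_apply[OF g] sum_product by (intro sum.cong refl) (simp add: chi_mult g)
  also have "\<dots> = (\<Sum>a\<in>carrier G. \<Sum>b\<in>carrier G. of_int (c a * d (inv a \<otimes> b)) * \<chi> b g)"
  proof (rule sum.cong[OF refl])
    fix a assume a: "a \<in> carrier G"
    have "(\<Sum>b\<in>carrier G. of_int (c a * d b) * \<chi> (a \<otimes> b) g) =
        (\<Sum>b\<in>carrier G. of_int (c a * d (inv a \<otimes> (a \<otimes> b))) * \<chi> (a \<otimes> b) g)"
      by (rule sum.cong[OF refl]) (simp add: a inv_solve_left' m_assoc[symmetric])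
    also have "\<dots> = (\<Sum>b\<in>carrier G. of_int (c a * d (inv a \<otimes> b)) * \<chi> b g)"
      by (rule sum_translate[OF a])
    finally show "(\<Sum>b\<in>carrier G. of_int (c a * d b) * \<chi> (a \<otimes> b) g) =
      (\<Sum>b\<in>carrier G. of_int (c a * d (inv a \<otimes> b)) * \<chi> b g)" .
  qed
  also have "\<dots> = (\<Sum>b\<in>carrier G. \<Sum>a\<in>carrier G. of_int (c a * d (inv a \<otimes> b)) * \<chi> b g)"
    by (rule sum.swap)
  also have "\<dots> = comb (\<lambda>b. \<Sum>a\<in>carrier G. c a * d (inv a \<otimes> b)) g"
    unfolding comb_apply[OF g] by (simp add: sum_distrib_right)
  finally show "(\<lambda>g\<in>carrier G. comb c g * comb d g) g = comb (\<lambda>b. \<Sum>a\<in>carrier G. c a * d (inv a \<otimes> b)) g"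
    using g by simp
qed simp

text \<open>The value at g of the series \<Sum> \<lambda>^k(x) t^k for x = \<Sum> c_a \<chi>_a,
  where \<lambda>_t is multiplicative in x and equals 1 + \<chi>_a t on a linear character.\<close>

definition lser :: "('a \<Rightarrow> int) \<Rightarrow> 'a \<Rightarrow> complex fps" where
  "lser c g = (\<Prod>a\<in>carrier G. fps_powi (1 + fps_const (\<chi> a g) * fps_X) (c a))"

lemma lser_nth_0: "fps_nth (lser c g) 0 = 1"
  unfolding lser_def fps_nth_prod_0 by (intro prod.neutral ballI fps_powi_nth_0) simp

lemma lser_add: "lser (\<lambda>a. c a + d a) g = lser c g * lser d g"
  unfolding lser_def prod.distrib[symmetric] by (intro prod.cong refl fps_powi_add) simp

lemma lser_cong: "(\<And>a. a \<in> carrier G \<Longrightarrow> c a = d a) \<Longrightarrow> lser c g = lser d g"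
  unfolding lser_def by (rule prod.cong) auto

lemma lser_nat_nth_1: "fps_nth (lser (\<lambda>a. int (m a)) g) 1 = (\<Sum>a\<in>carrier G. of_nat (m a) * \<chi> a g)"
  unfolding lser_def fps_powi_of_nat
  by (subst fps_nth_prod_1[OF finite_carrier]) (simp_all add: fps_nth_power_0 fps_nth_power_1[unfolded One_nat_def])

lemma lser_delta:
  assumes "a \<in> carrier G"
  shows "lser (\<lambda>b. if b = a then k else 0) g = fps_powi (1 + fps_const (\<chi> a g) * fps_X) k"
proof -
  have "lser (\<lambda>b. if b = a then k else 0) g =
      (\<Prod>b\<in>carrier G. if b = a then fps_powi (1 + fps_const (\<chi> b g) * fps_X) k else 1)"
    unfolding lser_def by (rule prod.cong) auto
  then show ?thesis using assms finite_carrier by simp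
qed

text \<open>Both sides are coefficients of polynomials in t: one collects the traces of the exterior
  powers, the other is the factored determinant. They agree at every complex t and are therefore
  equal.\<close>

lemma representation_ext_power:
  assumes rep: "representation G d \<rho>"
  shows "\<exists>m. \<forall>g\<in>carrier G. \<forall>k. mat_trace (ext_power k (\<rho> g)) = fps_nth (lser (\<lambda>a. int (m a)) g) k"
proof -
  from representation_det[OF rep] obtain m where
    m: "\<forall>g\<in>carrier G. \<forall>t. det (1\<^sub>m d + t \<cdot>\<^sub>m \<rho> g) = (\<Prod>a\<in>carrier G. (1 + \<chi> a g * t) ^ m a)" ..
  have "mat_trace (ext_power k (\<rho> g)) = fps_nth (lser (\<lambda>a. int (m a)) g) k"
    if g: "g \<in> carrier G" for g k
  proof -
    have "\<rho> \<in> hom G (units_of (ring_mat TYPE(complex) d ()))" using rep by (simp add: representation_def)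
    from hom_in_carrier[OF this g] have car: "\<rho> g \<in> carrier_mat d d"
      by (auto simp: units_of_def Units_def ring_mat_simps)
    let ?p = "\<Prod>a\<in>carrier G. [:1, \<chi> a g:] ^ m a"
    let ?q = "\<Sum>k\<le>d. monom (mat_trace (ext_power k (\<rho> g))) k"
    have "poly ?q t = poly ?p t" for t
    proof -
      have "poly ?q t = det (1\<^sub>m d + t \<cdot>\<^sub>m \<rho> g)"
        by (simp add: det_one_plus_smult[OF car] poly_sum poly_monom)
      also have "\<dots> = poly ?p t"
        using m g by (simp add: poly_prod mult.commute)
      finally show ?thesis .
    qed
    then have pq: "?q = ?p" by (simp add: poly_eq_poly_eq_iff[symmetric] fun_eq_iff)
    have "lser (\<lambda>a. int (m a)) g = fps_of_poly ?p"
      unfolding lser_def fps_powi_of_nat by (simp only: fps_of_poly_prod fps_of_poly_power fps_of_poly_linear')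
    then have "fps_nth (lser (\<lambda>a. int (m a)) g) k = poly.coeff ?q k"
      unfolding pq by (simp only: fps_of_poly_nth)
    also have "\<dots> = (\<Sum>j\<le>d. if j = k then mat_trace (ext_power j (\<rho> g)) else 0)"
      by (simp only: coeff_sum coeff_monom)
    also have "\<dots> = mat_trace (ext_power k (\<rho> g))"
      using ext_power_large[of "\<rho> g" k] car by (cases "k \<le> d") simp_all
    finally show ?thesis ..
  qed
  then show ?thesis by blast
qed

text \<open>In degree 1 the exterior power is the representation itself, so the multiplicities that
  govern all exterior powers are already those of the character.\<close>

lemma rep_character_comb:
  assumes "\<forall>g\<in>carrier G. \<forall>k. mat_trace (ext_power k (\<rho> g)) = fps_nth (lser (\<lambda>a. int (m a)) g) k"
  shows "rep_character G \<rho> = comb (\<lambda>a. int (m a))"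
proof (rule comb_eqI)
  fix g assume g: "g \<in> carrier G"
  have "mat_trace (\<rho> g) = fps_nth (lser (\<lambda>a. int (m a)) g) 1"
    using assms g mat_trace_ext_power_1[of "\<rho> g"] by simp
  then show "rep_character G \<rho> g = comb (\<lambda>a. int (m a)) g"
    using g by (simp only: lser_nat_nth_1 comb_apply rep_character_def restrict_apply' of_int_of_nat_eq)
qed (simp add: rep_character_def)

section \<open>One-dimensional representations and the carrier of the character ring\<close>

lemma one_dimensional_representation:
  assumes a: "a \<in> carrier G"
  shows "representation G 1 (\<lambda>g. mat 1 1 (\<lambda>_. \<chi> a g))"
proof -
  let ?M = "ring_mat TYPE(complex) 1 ()"
  let ?\<rho> = "\<lambda>g. mat 1 1 (\<lambda>_. \<chi> a g)"
  have mult: "?\<rho> (g \<otimes> h) = ?\<rho> g * ?\<rho> h" if "g \<in> carrier G" "h \<in> carrier G" for g h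
    by (rule eq_matI) (simp_all add: scalar_prod_def chi_mult_right a that)
  have one: "?\<rho> \<one> = 1\<^sub>m 1"
    by (rule eq_matI) (simp_all add: chi_one_right a)
  have "?\<rho> g \<in> Units ?M" if g: "g \<in> carrier G" for g
    unfolding Units_def
  proof (intro CollectI conjI bexI)
    show "?\<rho> (inv g) \<otimes>\<^bsub>?M\<^esub> ?\<rho> g = \<one>\<^bsub>?M\<^esub>" "?\<rho> g \<otimes>\<^bsub>?M\<^esub> ?\<rho> (inv g) = \<one>\<^bsub>?M\<^esub>"
      using mult[of "inv g" g] mult[of g "inv g"] g one by (simp_all add: ring_mat_simps)
  qed (simp_all add: ring_mat_simps)
  then show ?thesis
    unfolding representation_def by (intro homI) (simp_all add: units_of_def ring_mat_simps mult del: One_nat_def)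
qed

text \<open>A nonzero vector of a one-dimensional space spans it, so the subspaces leave no room for
  a proper invariant one.\<close>

lemma ch_irreducible:
  assumes a: "a \<in> carrier G"
  shows "ch a \<in> irreducible_characters G"
proof -
  let ?\<rho> = "\<lambda>g. mat 1 1 (\<lambda>_. \<chi> a g)"
  have "W = {0\<^sub>v 1} \<or> W = carrier_vec 1"
    if W: "subspace class_ring W (module_vec TYPE(complex) 1)" for W
  proof -
    have sub: "submodule class_ring W (module_vec TYPE(complex) 1)"
      using W by (simp add: subspace_def)
    have Wc: "W \<subseteq> carrier_vec 1"
      using submodule.subset[OF sub] by (simp add: module_vec_simps)
    have smult: "c \<cdot>\<^sub>v w \<in> W" if "w \<in> W" for c w
      using submodule.smult_closed[OF sub, of c w] that by (simp add: module_vec_simps class_ring_simps)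
    show ?thesis
    proof (cases "W \<subseteq> {0\<^sub>v 1}")
      case True
      moreover have "0\<^sub>v 1 \<in> W"
        using submodule.zero_closed[OF sub] by (simp add: module_vec_simps)
      ultimately show ?thesis by auto
    next
      case False
      then obtain w where w: "w \<in> W" "w \<noteq> 0\<^sub>v 1" by auto
      then have wc: "w \<in> carrier_vec 1" using Wc by auto
      with w(2) have w0: "vec_index w 0 \<noteq> 0" by (auto simp: vec_eq_iff)
      have "v \<in> W" if v: "v \<in> carrier_vec 1" for v
      proof -
        have "v = (vec_index v 0 / vec_index w 0) \<cdot>\<^sub>v w"
          using v wc w0 by (intro eq_vecI) auto
        then show ?thesis using smult[OF w(1)] by metis
      qed
      then show ?thesis using Wc by auto
    qed
  qed
  then have "irreducible_rep G 1 ?\<rho>"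
    unfolding irreducible_rep_def using one_dimensional_representation[OF a] by simp
  moreover have "ch a = rep_character G ?\<rho>"
    by (auto simp: ch_def rep_character_def mat_trace_def)
  ultimately show ?thesis
    unfolding irreducible_characters_def by blast
qed

lemma representation_character:
  assumes "representation G d \<rho>"
  shows "rep_character G \<rho> \<in> range comb"
  using representation_ext_power[OF assms] rep_character_comb by blast

lemma function_ring_sel:
  "carrier (function_ring G) = carrier G \<rightarrow>\<^sub>E UNIV"
  "x \<oplus>\<^bsub>function_ring G\<^esub> y = (\<lambda>g\<in>carrier G. x g + y g)" "\<zero>\<^bsub>function_ring G\<^esub> = (\<lambda>g\<in>carrier G. 0)"
  by (simp_all add: function_ring_def)

lemma abelian_group_function_ring: "abelian_group (function_ring G)"
proof (rule abelian_groupI)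
  fix x assume x: "x \<in> carrier (function_ring G)"
  then show "\<zero>\<^bsub>function_ring G\<^esub> \<oplus>\<^bsub>function_ring G\<^esub> x = x"
    by (auto simp: function_ring_sel PiE_def extensional_def)
  show "\<exists>y\<in>carrier (function_ring G). y \<oplus>\<^bsub>function_ring G\<^esub> x = \<zero>\<^bsub>function_ring G\<^esub>"
    by (rule bexI[of _ "\<lambda>g\<in>carrier G. - x g"]) (auto simp: function_ring_sel)
next
  fix x y z :: "'a \<Rightarrow> complex"
  show "x \<oplus>\<^bsub>function_ring G\<^esub> y \<oplus>\<^bsub>function_ring G\<^esub> z = x \<oplus>\<^bsub>function_ring G\<^esub> (y \<oplus>\<^bsub>function_ring G\<^esub> z)"
    unfolding function_ring_sel by (rule restrict_ext) (simp add: add.assoc)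
  show "x \<oplus>\<^bsub>function_ring G\<^esub> y = y \<oplus>\<^bsub>function_ring G\<^esub> x"
    unfolding function_ring_sel by (rule restrict_ext) (simp add: add.commute)
qed (simp_all add: function_ring_sel)

lemma inv_function_ring:
  assumes "x \<in> carrier G \<rightarrow>\<^sub>E UNIV"
  shows "inv\<^bsub>add_monoid (function_ring G)\<^esub> x = (\<lambda>g\<in>carrier G. - x g)"
proof -
  interpret F: abelian_group "function_ring G" by (rule abelian_group_function_ring)
  have "\<ominus>\<^bsub>function_ring G\<^esub> x = (\<lambda>g\<in>carrier G. - x g)"
    by (rule F.minus_equality) (use assms in \<open>auto simp: function_ring_sel\<close>)
  then show ?thesis by (simp only: a_inv_def)
qed

text \<open>Every character is an integer combination of the \<chi>_a by the analysis of arbitrary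
  representations, and each \<chi>_a is itself an irreducible character. The two facts give the two
  inclusions.\<close>

lemma carrier_R: "carrier R = range comb"
proof -
  let ?F = "add_monoid (function_ring G)"
  have sub: "range comb \<subseteq> carrier G \<rightarrow>\<^sub>E UNIV" by (auto simp: comb_def)
  have irr: "irreducible_characters G \<subseteq> range comb"
    using representation_character by (auto simp: irreducible_characters_def irreducible_rep_def)
  have "x \<in> range comb" if "x \<in> generate ?F (irreducible_characters G)" for x
    using that
  proof (induction rule: generate.induct)
    case one
    then show ?case by (simp add: function_ring_sel comb_zero)
  next
    case (incl h)
    then show ?case using irr by auto
  next
    case (inv h)
    then obtain c where c: "h = comb c" using irr by auto
    then have "inv\<^bsub>?F\<^esub> h = comb (\<lambda>a. - c a)"
      using sub by (subst inv_function_ring) (auto simp: comb_neg)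
    then show ?case by simp
  next
    case (eng h1 h2)
    then obtain c d where "h1 = comb c" "h2 = comb d" by auto
    then show ?case by (simp add: function_ring_sel comb_add)
  qed
  moreover have "comb c \<in> generate ?F (irreducible_characters G)" for c
  proof -
    define Gen where "Gen = generate ?F (irreducible_characters G)"
    have zero: "(\<lambda>g\<in>carrier G. 0) \<in> Gen"
      using generate.one[of ?F "irreducible_characters G"]
      by (simp only: Gen_def function_ring_sel monoid.simps)
    have add: "(\<lambda>g\<in>carrier G. u g + v g) \<in> Gen"
      if "(\<lambda>g\<in>carrier G. u g) \<in> Gen" "(\<lambda>g\<in>carrier G. v g) \<in> Gen" for u v
    proof -
      have "(\<lambda>g\<in>carrier G. u g + v g) = (\<lambda>g\<in>carrier G. u g) \<otimes>\<^bsub>?F\<^esub> (\<lambda>g\<in>carrier G. v g)"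
        by (simp add: function_ring_sel cong: restrict_cong)
      then show ?thesis
        using generate.eng[OF that[unfolded Gen_def]] by (simp only: Gen_def)
    qed
    have pos: "(\<lambda>g\<in>carrier G. of_nat j * u g) \<in> Gen"
      if "(\<lambda>g\<in>carrier G. u g) \<in> Gen" for u :: "'a \<Rightarrow> complex" and j :: nat
    proof (induction j)
      case 0
      show ?case using zero by (simp only: of_nat_0 mult_zero_left)
    next
      case (Suc j)
      show ?case using add[OF that Suc.IH] by (simp only: of_nat_Suc distrib_right mult_1_left)
    qed
    have gen_mult: "(\<lambda>g\<in>carrier G. of_int k * \<chi> a g) \<in> Gen" if a: "a \<in> carrier G" for a and k :: int
    proof (cases "k \<ge> 0")
      case True
      have "(\<lambda>g\<in>carrier G. \<chi> a g) \<in> Gen"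
        using generate.incl[OF ch_irreducible[OF a]] by (simp only: ch_def Gen_def)
      from pos[OF this, of "nat k"] show ?thesis using True by (simp only: of_nat_nat)
    next
      case False
      have "inv\<^bsub>?F\<^esub> ch a = (\<lambda>g\<in>carrier G. - \<chi> a g)"
        by (subst inv_function_ring) (auto simp: ch_def)
      with generate.inv[OF ch_irreducible[OF a], of ?F]
      have "(\<lambda>g\<in>carrier G. - \<chi> a g) \<in> Gen"
        by (simp only: Gen_def)
      from pos[OF this, of "nat (- k)"]
      have "(\<lambda>g\<in>carrier G. of_int (- k) * - \<chi> a g) \<in> Gen" using False by (simp only: of_nat_nat)
      then show ?thesis by (simp only: of_int_minus minus_mult_minus)
    qed
    have "(\<lambda>g\<in>carrier G. \<Sum>a\<in>S. of_int (c a) * \<chi> a g) \<in> Gen" if "finite S" "S \<subseteq> carrier G" for S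
      using that
    proof (induction S rule: finite_induct)
      case empty
      show ?case using zero by (simp only: sum.empty)
    next
      case (insert a S)
      then show ?case
        using add[OF gen_mult[of a "c a"] insert.IH] by (simp only: sum.insert insert_subset simp_thms)
    qed
    from this[OF finite_carrier subset_refl] show ?thesis by (simp only: comb_def Gen_def)
  qed
  ultimately have "generate ?F (irreducible_characters G) = range comb" by blast
  then show ?thesis by (simp add: char_ring_def)
qed

lemma R_cring: "cring R"
proof (rule cringI)
  show "abelian_group R"
  proof (rule abelian_groupI)
    fix x assume "x \<in> carrier R"
    then obtain c where c: "x = comb c" by (auto simp: carrier_R)
    then show "\<zero>\<^bsub>R\<^esub> \<oplus>\<^bsub>R\<^esub> x = x"
      by (simp add: R_sel comb_zero comb_add)
    show "\<exists>y\<in>carrier R. y \<oplus>\<^bsub>R\<^esub> x = \<zero>\<^bsub>R\<^esub>"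
      using c by (intro bexI[of _ "comb (\<lambda>a. - c a)"]) (simp_all add: carrier_R R_sel comb_zero comb_add)
  qed (auto simp: carrier_R R_sel comb_add comb_zero add_ac)
  show "comm_monoid R"
  proof (rule comm_monoidI)
    show "\<one>\<^bsub>R\<^esub> \<in> carrier R" using comb_const[of 1] by (simp add: carrier_R R_sel)
    fix x assume "x \<in> carrier R"
    then obtain c where c: "x = comb c" by (auto simp: carrier_R)
    then show "\<one>\<^bsub>R\<^esub> \<otimes>\<^bsub>R\<^esub> x = x"
      by (auto simp: R_sel comb_def)
    fix y assume "y \<in> carrier R"
    then show "x \<otimes>\<^bsub>R\<^esub> y \<in> carrier R"
      using c by (auto simp: R_sel carrier_R comb_mult)
  next
    fix x y z
    show "x \<otimes>\<^bsub>R\<^esub> y \<otimes>\<^bsub>R\<^esub> z = x \<otimes>\<^bsub>R\<^esub> (y \<otimes>\<^bsub>R\<^esub> z)" "x \<otimes>\<^bsub>R\<^esub> y = y \<otimes>\<^bsub>R\<^esub> x"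
      unfolding R_sel by (rule restrict_ext; simp)+
  qed
next
  fix x y z
  show "(x \<oplus>\<^bsub>R\<^esub> y) \<otimes>\<^bsub>R\<^esub> z = x \<otimes>\<^bsub>R\<^esub> z \<oplus>\<^bsub>R\<^esub> y \<otimes>\<^bsub>R\<^esub> z"
    unfolding R_sel by (rule restrict_ext) (simp add: distrib_right)
qed

end

section \<open>Lambda and gamma operations\<close>

lemma fps_powi_mult: "fps_powi (f * h) k = fps_powi f k * fps_powi h k"
  for f h :: "complex fps"
  by (simp add: fps_powi_def power_mult_distrib fps_inverse_mult mult_ac)

lemma fps_powi_sum:
  assumes "fps_nth f 0 \<noteq> 0"
  shows "(\<Prod>a\<in>S. fps_powi f (c a)) = fps_powi f (\<Sum>a\<in>S. c a)"
  by (induction S rule: infinite_finite_induct) (simp_all add: fps_powi_add assms)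

lemma fps_powi_compose:
  fixes f u :: "complex fps"
  assumes "fps_nth u 0 = 0" "fps_nth f 0 \<noteq> 0"
  shows "fps_powi f k oo u = fps_powi (f oo u) k"
  unfolding fps_powi_def
  by (simp only: fps_compose_mult_distrib[OF assms(1)] fps_compose_power[OF assms(1)]
      fps_inverse_compose[OF assms, symmetric])

lemma fps_prod_compose:
  fixes u :: "complex fps"
  assumes "fps_nth u 0 = 0"
  shows "(\<Prod>a\<in>S. F a) oo u = (\<Prod>a\<in>S. F a oo u)"
  by (induction S rule: infinite_finite_induct) (simp_all add: fps_compose_mult_distrib[OF assms])

text \<open>For i from 1 to n the coefficient of X^n in (X/(1 - X))^i is binom(n - 1, n - i), which
  is the coefficient of X^(n - i) in (1 + X)^(n - 1). This makes \<lambda>^n(x + n - 1) the n-th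
  coefficient of the single series \<lambda>_u(x) with u = t/(1 - t), although the shift n - 1
  varies with n.\<close>

lemma fps_nth_compose_X_over_one_minus_X:
  fixes F :: "complex fps"
  shows "fps_nth (F oo (fps_X * inverse (1 - fps_X))) n = fps_nth (F * fps_powi (1 + fps_X) (int n - 1)) n"
proof (cases n)
  \<comment> \<open>Here the exponent is -1; only constant terms enter, and both are that of
    \<open>F\<close>.\<close>
  case 0
  then show ?thesis by (simp add: fps_powi_nth_0)
next
  case (Suc m)
  let ?u = "fps_X * inverse (1 - fps_X) :: complex fps"
  have "fps_nth (?u ^ i) n = of_nat (m choose (n - i))" if i: "i \<le> n" for i
  proof (cases i)
    case 0
    then show ?thesis using Suc by simp
  next
    case (Suc j)
    have "fps_nth (?u ^ i) n = fps_nth (fps_X ^ i * inverse (1 - fps_X) ^ Suc j) n"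
      by (simp only: power_mult_distrib Suc)
    also have "\<dots> = fps_nth (inverse (1 - fps_X) ^ Suc j) (n - i)"
      using i by (simp only: fps_X_power_mult_nth) simp
    also have "\<dots> = of_nat ((j + (n - i)) choose (n - i))"
      by (rule fps_inverse_one_minus_X_power_nth)
    also have "j + (n - i) = m"
      using i Suc \<open>n = Suc m\<close> by simp
    finally show ?thesis .
  qed
  then have "fps_nth (F oo ?u) n = (\<Sum>i = 0..n. fps_nth F i * of_nat (m choose (n - i)))"
    unfolding fps_compose_nth by (intro sum.cong refl) simp
  also have "\<dots> = fps_nth (F * (1 + fps_X) ^ m) n"
    by (simp only: fps_mult_nth fps_one_plus_X_power_nth)
  also have "(1 + fps_X) ^ m = fps_powi (1 + fps_X :: complex fps) (int n - 1)"
    using Suc by (simp flip: fps_powi_of_nat)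
  finally show ?thesis .
qed

lemma fps_inverse_one_plus_const_X:
  "inverse (1 + fps_const c * fps_X) = Abs_fps (\<lambda>k. (- c) ^ k)" for c :: complex
proof (rule fps_inverse_unique, rule fps_ext)
  fix k
  show "fps_nth ((1 + fps_const c * fps_X) * Abs_fps (\<lambda>k. (- c) ^ k)) k = fps_nth 1 k"
    by (cases k) (simp_all add: distrib_right mult.assoc fps_X_mult_nth)
qed

text \<open>A multiplicative filtration on functions on the group. It is instantiated twice: by the
  constant family of all virtual characters, to see that \<lambda>^n stays in the ring, and by
  \<open>J\<close>, to see that \<gamma>^n lands in degree n.\<close>

locale function_filtration = self_dual_group G \<chi>
  for G :: "('a, 'b) monoid_scheme" (structure) and \<chi> :: "'a \<Rightarrow> 'a \<Rightarrow> complex" +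
  fixes A :: "nat \<Rightarrow> ('a \<Rightarrow> complex) set"
  assumes A_zero: "(\<lambda>g\<in>carrier G. 0) \<in> A i"
    and A_one: "(\<lambda>g\<in>carrier G. 1) \<in> A 0"
    and A_add: "(\<lambda>g\<in>carrier G. x g) \<in> A i \<Longrightarrow> (\<lambda>g\<in>carrier G. y g) \<in> A i \<Longrightarrow>
      (\<lambda>g\<in>carrier G. x g + y g) \<in> A i"
    and A_neg: "(\<lambda>g\<in>carrier G. x g) \<in> A i \<Longrightarrow> (\<lambda>g\<in>carrier G. - x g) \<in> A i"
    and A_mult: "(\<lambda>g\<in>carrier G. x g) \<in> A i \<Longrightarrow> (\<lambda>g\<in>carrier G. y g) \<in> A j \<Longrightarrow>
      (\<lambda>g\<in>carrier G. x g * y g) \<in> A (i + j)"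
begin

lemma A_sum:
  assumes "finite S" "\<And>i. i \<in> S \<Longrightarrow> (\<lambda>g\<in>carrier G. F i g) \<in> A k"
  shows "(\<lambda>g\<in>carrier G. \<Sum>i\<in>S. F i g) \<in> A k"
  using assms
proof (induction S rule: finite_induct)
  case empty
  show ?case using A_zero by (simp only: sum.empty)
next
  case (insert i S)
  have "(\<lambda>g\<in>carrier G. F i g + (\<Sum>i\<in>S. F i g)) \<in> A k"
    by (rule A_add[OF insert.prems[OF insertI1] insert.IH[OF insert.prems[OF insertI2]]])
  then show ?case using insert.hyps by (simp only: sum.insert simp_thms)
qed

text \<open>A family of series, one for each g, whose k-th coefficient as a function of g lies in
  \<open>A k\<close>. Multiplicativity of the filtration makes such families closed under products,
  so a product formula can be checked factor by factor.\<close>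

definition coeffs_in :: "('a \<Rightarrow> complex fps) \<Rightarrow> bool" where
  "coeffs_in F \<longleftrightarrow> (\<forall>k. (\<lambda>g\<in>carrier G. fps_nth (F g) k) \<in> A k)"

lemma coeffs_in_one: "coeffs_in (\<lambda>g. 1)"
  unfolding coeffs_in_def
proof
  fix k
  show "(\<lambda>g\<in>carrier G. fps_nth 1 k) \<in> A k"
    using A_zero A_one by (cases k) simp_all
qed

lemma coeffs_in_mult:
  assumes "coeffs_in F" "coeffs_in H"
  shows "coeffs_in (\<lambda>g. F g * H g)"
  unfolding coeffs_in_def fps_mult_nth
proof
  fix k
  show "(\<lambda>g\<in>carrier G. \<Sum>i = 0..k. fps_nth (F g) i * fps_nth (H g) (k - i)) \<in> A k"
  proof (rule A_sum)
    fix i assume i: "i \<in> {0..k}"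
    have "(\<lambda>g\<in>carrier G. fps_nth (F g) i * fps_nth (H g) (k - i)) \<in> A (i + (k - i))"
      by (rule A_mult) (use assms in \<open>simp_all only: coeffs_in_def\<close>)
    then show "(\<lambda>g\<in>carrier G. fps_nth (F g) i * fps_nth (H g) (k - i)) \<in> A k"
      using i by simp
  qed simp
qed

lemma coeffs_in_power: "coeffs_in F \<Longrightarrow> coeffs_in (\<lambda>g. F g ^ j)"
  by (induction j) (simp_all add: coeffs_in_one coeffs_in_mult)

lemma coeffs_in_prod:
  assumes "finite S" "\<And>a. a \<in> S \<Longrightarrow> coeffs_in (F a)"
  shows "coeffs_in (\<lambda>g. \<Prod>a\<in>S. F a g)"
  using assms by (induction S rule: finite_induct) (simp_all add: coeffs_in_one coeffs_in_mult)

text \<open>Negative exponents are covered by the geometric series: the k-th coefficient of 1/(1 + u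
  X) is (-u)^k, a k-fold product of elements of degree 1.\<close>

lemma coeffs_in_powi:
  assumes u: "(\<lambda>g\<in>carrier G. u g) \<in> A 1"
  shows "coeffs_in (\<lambda>g. fps_powi (1 + fps_const (u g) * fps_X) j)"
proof -
  have "coeffs_in (\<lambda>g. 1 + fps_const (u g) * fps_X)"
    unfolding coeffs_in_def
  proof
    fix k :: nat
    consider "k = 0" | "k = 1" | "k > 1" by linarith
    then show "(\<lambda>g\<in>carrier G. fps_nth (1 + fps_const (u g) * fps_X) k) \<in> A k"
      using A_zero A_one u by cases simp_all
  qed
  moreover have "coeffs_in (\<lambda>g. inverse (1 + fps_const (u g) * fps_X))"
    unfolding coeffs_in_def fps_inverse_one_plus_const_X fps_nth_Abs_fps
  proof
    fix k
    show "(\<lambda>g\<in>carrier G. (- u g) ^ k) \<in> A k"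
    proof (induction k)
      case 0
      show ?case using A_one by (simp only: power_0)
    next
      case (Suc k)
      show ?case using A_mult[OF A_neg[OF u] Suc.IH] by (simp only: power_Suc plus_1_eq_Suc)
    qed
  qed
  ultimately show ?thesis
    unfolding fps_powi_def by (intro coeffs_in_mult coeffs_in_power)
qed

lemma coeffs_in_prod_powi:
  assumes "\<And>a. a \<in> carrier G \<Longrightarrow> (\<lambda>g\<in>carrier G. u a g) \<in> A 1"
  shows "coeffs_in (\<lambda>g. \<Prod>a\<in>carrier G. fps_powi (1 + fps_const (u a g) * fps_X) (c a))"
  by (intro coeffs_in_prod finite_carrier coeffs_in_powi assms)

end

section \<open>Existence and uniqueness of the lambda operations\<close>

context self_dual_group
begin

text \<open>For this constant family \<open>coeffs_in\<close> says that every coefficient is a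
  virtual character; this is how closure of the character ring under the \<lambda>^k is
  obtained.\<close>

lemma function_filtration_R: "function_filtration G \<chi> (\<lambda>_. range comb)"
proof unfold_locales
  show "(\<lambda>g\<in>carrier G. 0) \<in> range comb" by (simp only: comb_zero rangeI)
  show "(\<lambda>g\<in>carrier G. 1) \<in> range comb" using comb_const[of 1] by (simp only: of_int_1 rangeI)
  fix x y :: "'a \<Rightarrow> complex"
  assume "(\<lambda>g\<in>carrier G. x g) \<in> range comb"
  then obtain c where c: "(\<lambda>g\<in>carrier G. x g) = comb c" by auto
  then have x: "x g = comb c g" if "g \<in> carrier G" for g
    by (metis c restrict_apply' that)
  have "(\<lambda>g\<in>carrier G. - x g) = comb (\<lambda>a. - c a)"
    unfolding comb_neg[symmetric] by (rule restrict_ext) (simp add: x)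
  then show "(\<lambda>g\<in>carrier G. - x g) \<in> range comb" by (simp only: rangeI)
  assume "(\<lambda>g\<in>carrier G. y g) \<in> range comb"
  then obtain d where d: "(\<lambda>g\<in>carrier G. y g) = comb d" by auto
  then have y: "y g = comb d g" if "g \<in> carrier G" for g
    by (metis d restrict_apply' that)
  have "(\<lambda>g\<in>carrier G. x g + y g) = comb (\<lambda>a. c a + d a)"
    unfolding comb_add[symmetric] by (rule restrict_ext) (simp add: x y)
  then show "(\<lambda>g\<in>carrier G. x g + y g) \<in> range comb" by (simp only: rangeI)
  have "(\<lambda>g\<in>carrier G. x g * y g) = comb (\<lambda>b. \<Sum>a\<in>carrier G. c a * d (inv a \<otimes> b))"
    unfolding comb_mult[symmetric] by (rule restrict_ext) (simp add: x y)
  then show "(\<lambda>g\<in>carrier G. x g * y g) \<in> range comb" by (simp only: rangeI)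
qed

text \<open>The candidate for \<open>lambda_op\<close>, with the integer coefficients recovered from
  the function by \<open>coef\<close>. The outer restriction provides the extensionality that
  \<open>is_lambda_structure\<close> demands, without which the definite description would have no
  unique solution.\<close>

definition lam :: "nat \<Rightarrow> ('a \<Rightarrow> complex) \<Rightarrow> 'a \<Rightarrow> complex" where
  "lam k = (\<lambda>x\<in>carrier R. \<lambda>g\<in>carrier G. fps_nth (lser (coef x) g) k)"

lemma lam_comb: "lam k (comb c) = (\<lambda>g\<in>carrier G. fps_nth (lser c g) k)"
  unfolding lam_def carrier_R
  by (simp add: lser_cong[of "coef (comb c)" c] coef_comb)

lemma lam_closed: "lam k (comb c) \<in> carrier R"
proof -
  interpret function_filtration G \<chi> "\<lambda>_. range comb" by (rule function_filtration_R)
  have "(\<lambda>g\<in>carrier G. \<chi> a g) \<in> range comb" if "a \<in> carrier G" for a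
    using ch_eq_comb[OF that] by (simp add: ch_def)
  from coeffs_in_prod_powi[OF this, of "\<lambda>a. a" c]
  show ?thesis
    unfolding lam_comb carrier_R lser_def coeffs_in_def by blast
qed

lemma finsum_R:
  assumes "finite S" "f \<in> S \<rightarrow> carrier R"
  shows "finsum R f S = (\<lambda>g\<in>carrier G. \<Sum>i\<in>S. f i g)"
proof -
  interpret R: cring R by (rule R_cring)
  show ?thesis
    using assms
  proof (induction S rule: finite_induct)
    case empty
    then show ?case by (simp add: R_sel)
  next
    case (insert i S)
    then show ?case by (simp add: R_sel(1) cong: restrict_cong)
  qed
qed

lemma is_lambda_structure_lam: "is_lambda_structure G lam"
  unfolding is_lambda_structure_def Let_def
proof (intro conjI allI ballI impI)
  fix n
  show "lam n \<in> carrier R \<rightarrow>\<^sub>E carrier R"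
    using lam_closed by (auto simp: carrier_R) (simp add: lam_def carrier_R)
next
  fix d \<rho> n assume "representation G d \<rho>"
  from representation_ext_power[OF this] obtain m where
    m: "\<forall>g\<in>carrier G. \<forall>k. mat_trace (ext_power k (\<rho> g)) = fps_nth (lser (\<lambda>a. int (m a)) g) k" ..
  show "lam n (rep_character G \<rho>) = rep_character G (\<lambda>g. ext_power n (\<rho> g))"
    unfolding rep_character_comb[OF m] lam_comb rep_character_def[of G "\<lambda>g. ext_power n (\<rho> g)"]
    by (rule restrict_ext) (simp add: m)
next
  fix x assume "x \<in> carrier R"
  then show "lam 0 x = \<one>\<^bsub>R\<^esub>"
    by (auto simp: carrier_R lam_comb lser_nth_0 R_sel)
next
  fix n x y assume "x \<in> carrier R" "y \<in> carrier R"
  then obtain c d where cd: "x = comb c" "y = comb d" by (auto simp: carrier_R)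
  interpret R: cring R by (rule R_cring)
  have "(\<Oplus>\<^bsub>R\<^esub>i\<in>{..n}. lam i x \<otimes>\<^bsub>R\<^esub> lam (n - i) y) =
      (\<lambda>g\<in>carrier G. \<Sum>i\<in>{..n}. (lam i x \<otimes>\<^bsub>R\<^esub> lam (n - i) y) g)"
    by (rule finsum_R) (auto simp: cd lam_closed)
  also have "\<dots> = (\<lambda>g\<in>carrier G. fps_nth (lser c g * lser d g) n)"
    by (rule restrict_ext) (simp add: cd R_sel lam_comb fps_mult_nth atLeast0AtMost)
  also have "\<dots> = lam n (x \<oplus>\<^bsub>R\<^esub> y)"
    by (simp only: cd R_sel comb_add lam_comb lser_add)
  finally show "lam n (x \<oplus>\<^bsub>R\<^esub> y) = (\<Oplus>\<^bsub>R\<^esub>i\<in>{..n}. lam i x \<otimes>\<^bsub>R\<^esub> lam (n - i) y)" ..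
qed

lemma R_neg: "\<ominus>\<^bsub>R\<^esub> comb c = comb (\<lambda>a. - c a)"
proof -
  interpret R: cring R by (rule R_cring)
  show ?thesis
    by (rule R.minus_equality) (simp_all add: carrier_R R_sel comb_add comb_zero)
qed

lemma generate_irreducible: "carrier R = generate (add_monoid (function_ring G)) (irreducible_characters G)"
  by (simp add: char_ring_def)

text \<open>Two such families agree on irreducible characters, and agreement passes to sums by the
  addition formula. For -x, expand the operation of degree k at x + (-x) = 0: the term with i = 0 is
  the operation of degree k at -x, and all others involve -x only in lower degree, which calls for
  strong induction on k.\<close>

lemma is_lambda_structure_unique:
  assumes L: "is_lambda_structure G L" and L': "is_lambda_structure G L'"
  shows "L = L'"
proof -
  interpret R: cring R by (rule R_cring)
  let ?F = "add_monoid (function_ring G)"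
  note L = L[unfolded is_lambda_structure_def Let_def] and L' = L'[unfolded is_lambda_structure_def Let_def]
  have cl: "L k x \<in> carrier R" "L' k x \<in> carrier R" if "x \<in> carrier R" for k x
    using L L' that by auto
  have rep: "L k (rep_character G \<rho>) = L' k (rep_character G \<rho>)" if "representation G d \<rho>" for k d \<rho>
    using L L' that by metis
  have zero: "L 0 x = \<one>\<^bsub>R\<^esub>" "L' 0 x = \<one>\<^bsub>R\<^esub>" if "x \<in> carrier R" for x
    using L L' that by auto
  have add: "L k (x \<oplus>\<^bsub>R\<^esub> y) = (\<Oplus>\<^bsub>R\<^esub>i\<in>{..k}. L i x \<otimes>\<^bsub>R\<^esub> L (k - i) y)"
    "L' k (x \<oplus>\<^bsub>R\<^esub> y) = (\<Oplus>\<^bsub>R\<^esub>i\<in>{..k}. L' i x \<otimes>\<^bsub>R\<^esub> L' (k - i) y)"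
    if "x \<in> carrier R" "y \<in> carrier R" for k x y
    using L L' that by blast+
  define good where "good x \<longleftrightarrow> (\<forall>k. L k x = L' k x)" for x
  have good_add: "good (x \<oplus>\<^bsub>R\<^esub> y)" if "x \<in> carrier R" "y \<in> carrier R" "good x" "good y" for x y
    using that by (simp add: good_def add)
  have good_0: "good \<zero>\<^bsub>R\<^esub>"
  proof -
    \<comment> \<open>The zero-dimensional representation has character 0, so the value at 0 is
      prescribed by the exterior powers.\<close>
    have "representation G 0 (\<lambda>g. 1\<^sub>m 0)"
      unfolding representation_def
      by (intro homI) (auto simp: units_of_def Units_def ring_mat_simps)
    moreover have "rep_character G (\<lambda>g. 1\<^sub>m 0) = \<zero>\<^bsub>R\<^esub>"
      by (simp add: rep_character_def mat_trace_def R_sel)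
    ultimately show ?thesis
      unfolding good_def using rep by metis
  qed
  have good_neg: "good (\<ominus>\<^bsub>R\<^esub> x)" if x: "x \<in> carrier R" and g: "good x" for x
    unfolding good_def
  proof
    fix k
    show "L k (\<ominus>\<^bsub>R\<^esub> x) = L' k (\<ominus>\<^bsub>R\<^esub> x)"
    proof (induction k rule: less_induct)
      case (less k)
      \<comment> \<open>Isolates the term with i = 0 in the addition formula, for either of the two
        families \<open>M\<close>.\<close>
      have split: "M k \<zero>\<^bsub>R\<^esub> = M k (\<ominus>\<^bsub>R\<^esub> x) \<oplus>\<^bsub>R\<^esub> (\<Oplus>\<^bsub>R\<^esub>i\<in>{1..k}. M i x \<otimes>\<^bsub>R\<^esub> M (k - i) (\<ominus>\<^bsub>R\<^esub> x))"
        if cl: "\<And>k x. x \<in> carrier R \<Longrightarrow> M k x \<in> carrier R" and M0: "M 0 x = \<one>\<^bsub>R\<^esub>"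
          and add: "M k (x \<oplus>\<^bsub>R\<^esub> \<ominus>\<^bsub>R\<^esub> x) = (\<Oplus>\<^bsub>R\<^esub>i\<in>{..k}. M i x \<otimes>\<^bsub>R\<^esub> M (k - i) (\<ominus>\<^bsub>R\<^esub> x))" for M
      proof -
        have "{..k} = insert 0 {1..k}" by auto
        then have "(\<Oplus>\<^bsub>R\<^esub>i\<in>{..k}. M i x \<otimes>\<^bsub>R\<^esub> M (k - i) (\<ominus>\<^bsub>R\<^esub> x)) =
            M 0 x \<otimes>\<^bsub>R\<^esub> M (k - 0) (\<ominus>\<^bsub>R\<^esub> x) \<oplus>\<^bsub>R\<^esub> (\<Oplus>\<^bsub>R\<^esub>i\<in>{1..k}. M i x \<otimes>\<^bsub>R\<^esub> M (k - i) (\<ominus>\<^bsub>R\<^esub> x))"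
          using x cl by (simp only:) (rule R.finsum_insert, auto)
        then show ?thesis
          using add x cl M0 by (simp add: R.r_neg)
      qed
      have "L k \<zero>\<^bsub>R\<^esub> = L k (\<ominus>\<^bsub>R\<^esub> x) \<oplus>\<^bsub>R\<^esub> (\<Oplus>\<^bsub>R\<^esub>i\<in>{1..k}. L i x \<otimes>\<^bsub>R\<^esub> L (k - i) (\<ominus>\<^bsub>R\<^esub> x))"
        by (rule split) (use x cl zero add in auto)
      moreover have "L' k \<zero>\<^bsub>R\<^esub> = L' k (\<ominus>\<^bsub>R\<^esub> x) \<oplus>\<^bsub>R\<^esub> (\<Oplus>\<^bsub>R\<^esub>i\<in>{1..k}. L' i x \<otimes>\<^bsub>R\<^esub> L' (k - i) (\<ominus>\<^bsub>R\<^esub> x))"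
        by (rule split) (use x cl zero add in auto)
      moreover have "(\<Oplus>\<^bsub>R\<^esub>i\<in>{1..k}. L i x \<otimes>\<^bsub>R\<^esub> L (k - i) (\<ominus>\<^bsub>R\<^esub> x)) =
          (\<Oplus>\<^bsub>R\<^esub>i\<in>{1..k}. L' i x \<otimes>\<^bsub>R\<^esub> L' (k - i) (\<ominus>\<^bsub>R\<^esub> x))"
        using g x cl less.IH by (intro R.finsum_cong') (auto simp: good_def)
      moreover have "L k \<zero>\<^bsub>R\<^esub> = L' k \<zero>\<^bsub>R\<^esub>" using good_0 by (simp add: good_def)
      ultimately have "L k (\<ominus>\<^bsub>R\<^esub> x) \<oplus>\<^bsub>R\<^esub> (\<Oplus>\<^bsub>R\<^esub>i\<in>{1..k}. L' i x \<otimes>\<^bsub>R\<^esub> L' (k - i) (\<ominus>\<^bsub>R\<^esub> x)) =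
          L' k (\<ominus>\<^bsub>R\<^esub> x) \<oplus>\<^bsub>R\<^esub> (\<Oplus>\<^bsub>R\<^esub>i\<in>{1..k}. L' i x \<otimes>\<^bsub>R\<^esub> L' (k - i) (\<ominus>\<^bsub>R\<^esub> x))"
        by (simp only:)
      moreover have "(\<Oplus>\<^bsub>R\<^esub>i\<in>{1..k}. L' i x \<otimes>\<^bsub>R\<^esub> L' (k - i) (\<ominus>\<^bsub>R\<^esub> x)) \<in> carrier R"
        using x cl by (intro R.finsum_closed) auto
      ultimately show ?case
        by (subst (asm) R.add.right_cancel) (use x cl in auto)
    qed
  qed
  have "good x \<and> x \<in> carrier R" if "x \<in> generate ?F (irreducible_characters G)" for x
    using that
  proof (induction rule: generate.induct)
    case one
    have "\<one>\<^bsub>?F\<^esub> = \<zero>\<^bsub>R\<^esub>" by (simp add: R_sel function_ring_sel)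
    then show ?case using good_0 by (simp only:) simp
  next
    case (incl h)
    then obtain d \<rho> where \<rho>: "representation G d \<rho>" "h = rep_character G \<rho>"
      by (auto simp: irreducible_characters_def irreducible_rep_def)
    then have "good h" using rep[OF \<rho>(1)] by (simp add: good_def)
    then show ?case using \<rho> representation_character by (auto simp: carrier_R)
  next
    case (inv h)
    then obtain d \<rho> where \<rho>: "representation G d \<rho>" "h = rep_character G \<rho>"
      by (auto simp: irreducible_characters_def irreducible_rep_def)
    then have "good h" using rep[OF \<rho>(1)] by (simp add: good_def)
    have h: "h \<in> carrier R" using \<rho> representation_character by (auto simp: carrier_R)
    then obtain c where c: "h = comb c" by (auto simp: carrier_R)
    have "inv\<^bsub>?F\<^esub> h = \<ominus>\<^bsub>R\<^esub> h"
      unfolding c R_neg by (subst inv_function_ring) (auto simp: comb_neg, simp add: comb_def)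
    then show ?case using good_neg[OF h \<open>good h\<close>] h by (simp only:) simp
  next
    case (eng h1 h2)
    have "h1 \<otimes>\<^bsub>?F\<^esub> h2 = h1 \<oplus>\<^bsub>R\<^esub> h2" by (simp add: R_sel function_ring_sel)
    then show ?case using eng good_add by (simp only:) simp
  qed
  then have "L k x = L' k x" if "x \<in> carrier R" for k x
    using that unfolding generate_irreducible good_def by blast
  moreover have "L k x = L' k x" if "x \<notin> carrier R" for k x
  proof -
    have "L k \<in> carrier R \<rightarrow>\<^sub>E carrier R" "L' k \<in> carrier R \<rightarrow>\<^sub>E carrier R"
      using L L' by blast+
    from PiE_arb[OF this(1) that] PiE_arb[OF this(2) that] show ?thesis by (simp only:)
  qed
  ultimately show ?thesis by (intro ext) metis
qed

lemma lambda_op_eq: "lambda_op G = lam"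
  unfolding lambda_op_def
  using is_lambda_structure_lam is_lambda_structure_unique by (intro the_equality) auto

text \<open>The shift n - 1 in \<open>gamma_op\<close> equals -1 for n = 0, hence integer
  multiples.\<close>

lemma add_pow_one: "add_pow R (k :: int) \<one>\<^bsub>R\<^esub> = (\<lambda>g\<in>carrier G. of_int k)"
proof -
  interpret R: cring R by (rule R_cring)
  have nat: "add_pow R j \<one>\<^bsub>R\<^esub> = (\<lambda>g\<in>carrier G. of_nat j)" for j :: nat
  proof (induction j)
    case 0
    then show ?case by (simp add: R_sel)
  next
    case (Suc j)
    have "add_pow R (Suc j) \<one>\<^bsub>R\<^esub> = add_pow R j \<one>\<^bsub>R\<^esub> \<oplus>\<^bsub>R\<^esub> \<one>\<^bsub>R\<^esub>"
      by (rule R.add.nat_pow_Suc)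
    also have "\<dots> = (\<lambda>g\<in>carrier G. of_nat (Suc j))"
      unfolding Suc.IH unfolding R_sel by (rule restrict_ext) simp
    finally show ?case .
  qed
  show ?thesis
  proof (cases "k \<ge> 0")
    case True
    then have "add_pow R k \<one>\<^bsub>R\<^esub> = add_pow R (nat k) \<one>\<^bsub>R\<^esub>"
      unfolding add_pow_def int_pow_def2 by (simp only: linorder_not_less[symmetric] if_False)
    then show ?thesis using True by (simp add: nat of_nat_nat)
  next
    case False
    then have "add_pow R k \<one>\<^bsub>R\<^esub> = \<ominus>\<^bsub>R\<^esub> add_pow R (nat (- k)) \<one>\<^bsub>R\<^esub>"
      unfolding add_pow_def int_pow_def2 a_inv_def by (simp only: linorder_not_le if_True)
    also have "\<dots> = \<ominus>\<^bsub>R\<^esub> (\<lambda>g\<in>carrier G. of_int (- k))"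
      using False by (simp add: nat of_nat_nat)
    also have "\<dots> = comb (\<lambda>a. - (if a = \<one> then - k else 0))"
      unfolding comb_const R_neg ..
    also have "\<dots> = (\<lambda>g\<in>carrier G. of_int k)"
      unfolding comb_neg[symmetric] comb_const[symmetric] by (rule restrict_ext) simp
    finally show ?thesis .
  qed
qed

text \<open>Under t to t/(1 - t) a factor 1 + \<chi> t becomes (1 + (\<chi> - 1) t)/(1 - t). The
  total exponent of the denominator is the sum of the coefficients, which is 0 on the augmentation
  ideal.\<close>

lemma gamma_op_comb:
  assumes c: "(\<Sum>a\<in>carrier G. c a) = 0"
  shows "gamma_op G n (comb c) =
    (\<lambda>g\<in>carrier G. fps_nth (\<Prod>a\<in>carrier G. fps_powi (1 + fps_const (\<chi> a g - 1) * fps_X) (c a)) n)"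
proof -
  have "gamma_op G n (comb c) = lam n (comb (\<lambda>a. c a + (if a = \<one> then int n - 1 else 0)))"
    unfolding gamma_op_def Let_def lambda_op_eq add_pow_one comb_const by (simp only: R_sel comb_add)
  also have "\<dots> = (\<lambda>g\<in>carrier G. fps_nth (lser c g * fps_powi (1 + fps_X) (int n - 1)) n)"
    unfolding lam_comb lser_add by (rule restrict_ext) (simp add: lser_delta chi_one)
  also have "\<dots> = (\<lambda>g\<in>carrier G. fps_nth (\<Prod>a\<in>carrier G. fps_powi (1 + fps_const (\<chi> a g - 1) * fps_X) (c a)) n)"
  proof (rule restrict_ext)
    fix g assume g: "g \<in> carrier G"
    let ?v = "inverse (1 - fps_X) :: complex fps"
    let ?u = "fps_X * ?v"
    have v: "fps_nth ?v 0 \<noteq> 0" "(1 - fps_X) * ?v = 1"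
      by (simp_all add: inverse_mult_eq_1')
    have "(1 + fps_const (\<chi> a g) * fps_X) oo ?u = (1 + fps_const (\<chi> a g - 1) * fps_X) * ?v" for a
    proof -
      have "(1 + fps_const (\<chi> a g) * fps_X) oo ?u = 1 + fps_const (\<chi> a g) * ?u"
        by (simp add: fps_compose_add_distrib fps_compose_mult_distrib)
      also have "\<dots> = ((1 - fps_X) + fps_const (\<chi> a g) * fps_X) * ?v"
        by (simp only: distrib_right v mult.assoc)
      also have "(1 - fps_X) + fps_const (\<chi> a g) * fps_X = 1 + fps_const (\<chi> a g - 1) * fps_X"
        by (simp add: fps_const_sub[symmetric] algebra_simps del: fps_const_sub)
      finally show ?thesis .
    qed
    then have "lser c g oo ?u = (\<Prod>a\<in>carrier G. fps_powi (1 + fps_const (\<chi> a g - 1) * fps_X) (c a)) *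
        (\<Prod>a\<in>carrier G. fps_powi ?v (c a))"
      unfolding lser_def by (simp add: fps_prod_compose fps_powi_compose fps_powi_mult prod.distrib)
    also have "(\<Prod>a\<in>carrier G. fps_powi ?v (c a)) = 1"
      by (simp only: fps_powi_sum[OF v(1)] c fps_powi_0)
    finally show "fps_nth (lser c g * fps_powi (1 + fps_X) (int n - 1)) n =
      fps_nth (\<Prod>a\<in>carrier G. fps_powi (1 + fps_const (\<chi> a g - 1) * fps_X) (c a)) n"
      using fps_nth_compose_X_over_one_minus_X[of "lser c g" n] by simp
  qed
  finally show ?thesis .
qed

end

section \<open>The gamma filtration\<close>

lemma fps_powi_nth_1:
  fixes F :: "complex fps"
  assumes "fps_nth F 0 = 1"
  shows "fps_nth (fps_powi F k) 1 = of_int k * fps_nth F 1"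
proof -
  have "fps_nth (F * inverse F) 1 = 0"
    using assms by (simp add: inverse_mult_eq_1')
  then have inv: "fps_nth (inverse F) 1 = - fps_nth F 1"
    using assms by (simp add: fps_mult_nth add_eq_0_iff2)
  have inv0: "fps_nth (inverse F) 0 = 1" using assms by simp
  have "fps_nth (fps_powi F k) 1 = fps_nth (F ^ nat k) 1 + fps_nth (inverse F ^ nat (- k)) 1"
    unfolding fps_powi_def using assms inv0 by (simp add: fps_mult_nth fps_nth_power_0)
  also have "\<dots> = of_nat (nat k) * fps_nth F 1 - of_nat (nat (- k)) * fps_nth F 1"
    unfolding fps_nth_power_1[OF assms] fps_nth_power_1[OF inv0] inv by simp
  also have "\<dots> = (of_nat (nat k) - of_nat (nat (- k))) * fps_nth F 1"
    by (simp only: left_diff_distrib)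
  also have "of_nat (nat k) - of_nat (nat (- k)) = (of_int k :: complex)"
    by (cases "k \<ge> 0") (simp_all add: of_nat_nat)
  finally show ?thesis .
qed

context self_dual_group
begin

lemma lam_1: "lam 1 (comb c) = comb c"
proof -
  have "fps_nth (lser c g) 1 = (\<Sum>a\<in>carrier G. of_int (c a) * \<chi> a g)" for g
  proof -
    have F: "fps_nth (1 + fps_const z * fps_X) 0 = 1" "fps_nth (1 + fps_const z * fps_X) 1 = z" for z :: complex
      by simp_all
    show ?thesis
      unfolding lser_def
      by (subst fps_nth_prod_1[OF finite_carrier])
        (simp_all only: fps_powi_nth_0[OF F(1)] fps_powi_nth_1[OF F(1)] F(2))
  qed
  then show ?thesis unfolding lam_comb by (simp only: comb_def)
qed

text \<open>The shift n - 1 is 0 and \<lambda>^1 is the identity. It is through this that the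
  elements \<chi>_k - 1, and hence all monomials in them, are products of values of
  \<gamma>.\<close>

lemma gamma_op_1: "gamma_op G 1 (comb c) = comb c"
proof -
  have "comb c \<oplus>\<^bsub>R\<^esub> (\<lambda>g\<in>carrier G. of_int 0) = comb c"
    unfolding comb_const by (simp only: R_sel comb_add if_cancel add_0_right)
  moreover have "int 1 - 1 = 0" by simp
  ultimately show ?thesis
    unfolding gamma_op_def Let_def lambda_op_eq add_pow_one by (simp only: lam_1)
qed

text \<open>Each linear character is 1 at the identity, so the degree of a combination is the sum of
  its coefficients.\<close>

lemma augmentation_ideal_comb:
  "comb c \<in> augmentation_ideal G \<longleftrightarrow> (\<Sum>a\<in>carrier G. c a) = 0"
proof -
  have "comb c \<one> = of_int (\<Sum>a\<in>carrier G. c a)"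
    by (simp add: comb_apply chi_one_right)
  then show ?thesis
    unfolding augmentation_ideal_def carrier_R
    by (simp only: mem_Collect_eq rangeI simp_thms of_int_eq_0_iff)
qed

end

context function_filtration
begin

lemma A_int_mult:
  assumes "(\<lambda>g\<in>carrier G. x g) \<in> A i"
  shows "(\<lambda>g\<in>carrier G. of_int k * x g) \<in> A i"
proof -
  have nat: "(\<lambda>g\<in>carrier G. of_nat j * y g) \<in> A i" if "(\<lambda>g\<in>carrier G. y g) \<in> A i" for y and j :: nat
  proof (induction j)
    case 0
    show ?case using A_zero by (simp only: of_nat_0 mult_zero_left)
  next
    case (Suc j)
    show ?case using A_add[OF that Suc.IH] by (simp only: of_nat_Suc distrib_right mult_1_left)
  qed
  show ?thesis
  proof (cases "k \<ge> 0")
    case True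
    from nat[OF assms, of "nat k"] show ?thesis using True by (simp only: of_nat_nat)
  next
    case False
    from nat[OF A_neg[OF assms], of "nat (- k)"]
    have "(\<lambda>g\<in>carrier G. of_int (- k) * - x g) \<in> A i" using False by (simp only: of_nat_nat)
    then show ?thesis by (simp only: of_int_minus minus_mult_minus)
  qed
qed

text \<open>By the product formula the \<gamma> series of x is built from factors 1 + (\<chi>_a - 1)
  t and their inverses, whose k-th coefficients have filtration degree k.\<close>

lemma gamma_op_in_filtration:
  assumes "\<And>a. a \<in> carrier G \<Longrightarrow> (\<lambda>g\<in>carrier G. \<chi> a g - 1) \<in> A 1"
    and "x \<in> augmentation_ideal G"
  shows "gamma_op G n x \<in> A n"
proof -
  obtain c where c: "x = comb c"
    using assms(2) by (auto simp: augmentation_ideal_def carrier_R)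
  then have "(\<Sum>a\<in>carrier G. c a) = 0" using assms(2) augmentation_ideal_comb by simp
  from gamma_op_comb[OF this] show ?thesis
    unfolding c using coeffs_in_prod_powi[OF assms(1)] by (simp only: coeffs_in_def)
qed

end

text \<open>What the computation of the filtration and of generators of the graded ring uses about
  the product decomposition. The orders of the factors enter only with the relations.\<close>

locale generated_self_dual_group = self_dual_group G \<chi>
  for G :: "('a, 'b) monoid_scheme" (structure) and \<chi> :: "'a \<Rightarrow> 'a \<Rightarrow> complex" +
  fixes K :: "'k set" and e :: "'k \<Rightarrow> 'a"
  assumes finite_K: "finite K"
    and e_closed: "\<And>k. k \<in> K \<Longrightarrow> e k \<in> carrier G"
    and chi_generated: "\<And>a. a \<in> carrier G \<Longrightarrow>
      \<exists>m :: 'k \<Rightarrow> nat. \<forall>g\<in>carrier G. \<chi> a g = (\<Prod>k\<in>K. \<chi> (e k) g ^ m k)"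
begin

section \<open>The span of the monomials of degree at least d\<close>

definition mon :: "'k multiset \<Rightarrow> 'a \<Rightarrow> complex" where
  "mon M g = (\<Prod>k\<in>#M. \<chi> (e k) g - 1)"

lemma mon_empty: "mon {#} g = 1"
  by (simp add: mon_def)

lemma mon_add_mset: "mon (add_mset k M) g = (\<chi> (e k) g - 1) * mon M g"
  by (simp add: mon_def)

lemma mon_union: "mon (M + M') g = mon M g * mon M' g"
  by (simp add: mon_def)

text \<open>The integral span of the monomials of degree at least d in the elements \<chi>_k - 1.
  Each step adds an integer multiple of one monomial, so sums, negatives and products are all
  handled by an induction with one nontrivial case.\<close>

inductive_set J :: "nat \<Rightarrow> ('a \<Rightarrow> complex) set" for d where
  J_zero: "(\<lambda>g\<in>carrier G. 0) \<in> J d"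
| J_step: "(\<lambda>g\<in>carrier G. x g) \<in> J d \<Longrightarrow> set_mset M \<subseteq> K \<Longrightarrow> d \<le> size M \<Longrightarrow>
    (\<lambda>g\<in>carrier G. x g + of_int c * mon M g) \<in> J d"

lemma J_extensional: "y \<in> J d \<Longrightarrow> (\<lambda>g\<in>carrier G. y g) = y"
  by (erule J.cases) (simp_all only: restrict_restrict Int_absorb)

lemma J_mon_mult:
  assumes "set_mset M \<subseteq> K" "d \<le> size M"
  shows "(\<lambda>g\<in>carrier G. of_int c * mon M g) \<in> J d"
  using J_step[OF J_zero assms, of c] by (simp only: add_0_left)

text \<open>Members of \<open>J\<close> are restricted functions, while the claims concern pointwise
  expressions. The rule therefore lets y be known only up to its values on the carrier.\<close>

lemma J_induct_fun [consumes 1, case_names zero step]: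
  assumes "(\<lambda>g\<in>carrier G. y g) \<in> J d"
    and "\<And>y. (\<And>g. g \<in> carrier G \<Longrightarrow> y g = 0) \<Longrightarrow> P y"
    and "\<And>x y M c. (\<lambda>g\<in>carrier G. x g) \<in> J d \<Longrightarrow> P x \<Longrightarrow> set_mset M \<subseteq> K \<Longrightarrow> d \<le> size M \<Longrightarrow>
      (\<And>g. g \<in> carrier G \<Longrightarrow> y g = x g + of_int c * mon M g) \<Longrightarrow> P y"
  shows "P y"
proof -
  have "z \<in> J d \<Longrightarrow> (\<And>g. g \<in> carrier G \<Longrightarrow> y g = z g) \<Longrightarrow> P y" for z y
  proof (induction z arbitrary: y rule: J.induct)
    case J_zero
    then show ?case by (intro assms(2)) simp
  next
    case (J_step x M c)
    have "P x" by (rule J_step.IH) simp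
    then show ?case
      by (rule assms(3)[where x = x and y = y and M = M and c = c, OF J_step.hyps(1) _ J_step.hyps(2,3)]) (simp add: J_step.prems)
  qed
  from this[OF assms(1)] show ?thesis by simp
qed

lemma J_cong: "(\<And>g. g \<in> carrier G \<Longrightarrow> x g = y g) \<Longrightarrow> (\<lambda>g\<in>carrier G. x g) \<in> J d \<Longrightarrow> (\<lambda>g\<in>carrier G. y g) \<in> J d"
  by (metis (no_types, lifting) restrict_ext)

lemma J_antimono:
  assumes "y \<in> J j" "i \<le> j"
  shows "y \<in> J i"
  using assms(1)
proof (induction rule: J.induct)
  case J_zero
  show ?case by (rule J.J_zero)
next
  case (J_step x M c)
  show ?case
    by (rule J.J_step[OF J_step.IH J_step.hyps(2)]) (use J_step.hyps(3) assms(2) in simp)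
qed

lemma J_add:
  assumes "(\<lambda>g\<in>carrier G. x g) \<in> J d" "(\<lambda>g\<in>carrier G. y g) \<in> J d"
  shows "(\<lambda>g\<in>carrier G. x g + y g) \<in> J d"
  using assms(2)
proof (induction rule: J_induct_fun)
  case (zero u)
  show ?case by (rule J_cong[OF _ assms(1)]) (simp add: zero)
next
  case (step z u M c)
  from J_step[OF step.IH step.hyps(2,3), of c] show ?case
    by (rule J_cong[rotated]) (simp add: step.hyps(4))
qed

lemma J_neg:
  assumes "(\<lambda>g\<in>carrier G. x g) \<in> J d"
  shows "(\<lambda>g\<in>carrier G. - x g) \<in> J d"
  using assms
proof (induction rule: J_induct_fun)
  case (zero u)
  show ?case by (rule J_cong[OF _ J_zero]) (simp add: zero)
next
  case (step z u M c)
  from J_step[OF step.IH step.hyps(2,3), of "- c"] show ?case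
    by (rule J_cong[rotated]) (simp add: step.hyps(4))
qed

lemma J_mult_mon:
  assumes "(\<lambda>g\<in>carrier G. x g) \<in> J i" "set_mset M \<subseteq> K" "j \<le> size M"
  shows "(\<lambda>g\<in>carrier G. x g * (of_int c * mon M g)) \<in> J (i + j)"
  using assms(1)
proof (induction rule: J_induct_fun)
  case (zero u)
  show ?case by (rule J_cong[OF _ J_zero]) (simp add: zero)
next
  case (step z u M' c')
  have "set_mset (M' + M) \<subseteq> K" "i + j \<le> size (M' + M)"
    using step.hyps(2,3) assms by simp_all
  from J_step[OF step.IH this, of "c' * c"] show ?case
    by (rule J_cong[rotated]) (simp add: step.hyps(4) mon_union algebra_simps)
qed

lemma J_mult:
  assumes "(\<lambda>g\<in>carrier G. x g) \<in> J i" "(\<lambda>g\<in>carrier G. y g) \<in> J j"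
  shows "(\<lambda>g\<in>carrier G. x g * y g) \<in> J (i + j)"
  using assms(2)
proof (induction rule: J_induct_fun)
  case (zero u)
  show ?case by (rule J_cong[OF _ J_zero]) (simp add: zero)
next
  case (step z u M c)
  from J_add[OF step.IH J_mult_mon[OF assms(1) step.hyps(2,3), of c]] show ?case
    by (rule J_cong[rotated]) (simp add: step.hyps(4) distrib_left)
qed

lemma J_one: "(\<lambda>g\<in>carrier G. 1) \<in> J 0"
  using J_mon_mult[of "{#}" 0 1] by (simp add: mon_empty)

sublocale J: function_filtration G \<chi> J
  by unfold_locales (rule J_zero J_one J_add J_neg J_mult; assumption?)+

text \<open>x y - 1 = (x - 1)(y - 1) + (x - 1) + (y - 1). Hence the functions congruent to 1 modulo
  \<open>J 1\<close> are closed under products, which carries the claim from the generating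
  characters to all characters.\<close>

lemma J_one_plus_mult:
  assumes "(\<lambda>g\<in>carrier G. x g - 1) \<in> J 1" "(\<lambda>g\<in>carrier G. y g - 1) \<in> J 1"
  shows "(\<lambda>g\<in>carrier G. x g * y g - 1) \<in> J 1"
proof -
  have "(\<lambda>g\<in>carrier G. (x g - 1) * (y g - 1)) \<in> J 1"
    by (rule J_antimono[OF J_mult[OF assms]]) simp
  from J_add[OF this J_add[OF assms]] show ?thesis
    by (rule J_cong[rotated]) (simp add: algebra_simps)
qed

lemma chi_minus_one_in_J:
  assumes "a \<in> carrier G"
  shows "(\<lambda>g\<in>carrier G. \<chi> a g - 1) \<in> J 1"
proof -
  from chi_generated[OF assms] obtain m where
    m: "\<forall>g\<in>carrier G. \<chi> a g = (\<Prod>k\<in>K. \<chi> (e k) g ^ m k)" by blast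
  have e: "(\<lambda>g\<in>carrier G. \<chi> (e k) g - 1) \<in> J 1" if "k \<in> K" for k
    using J_mon_mult[of "{#k#}" 1 1] that by (simp add: mon_def)
  have pow: "(\<lambda>g\<in>carrier G. \<chi> (e k) g ^ j - 1) \<in> J 1" if "k \<in> K" for k j
  proof (induction j)
    case 0
    show ?case using J_zero by (simp only: power_0 diff_self)
  next
    case (Suc j)
    from J_one_plus_mult[OF e[OF that] Suc.IH] show ?case by (simp only: power_Suc)
  qed
  have "(\<lambda>g\<in>carrier G. (\<Prod>k\<in>S. \<chi> (e k) g ^ m k) - 1) \<in> J 1" if "finite S" "S \<subseteq> K" for S :: "'k set"
    using that
  proof (induction S rule: finite_induct)
    case empty
    show ?case using J_zero by (simp only: prod.empty diff_self)
  next
    case (insert k S)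
    then have k: "k \<in> K" and S: "S \<subseteq> K" by simp_all
    from J_one_plus_mult[OF pow[OF k] insert.IH[OF S]] show ?case
      by (simp only: prod.insert[OF insert.hyps])
  qed
  from this[OF finite_K subset_refl] show ?thesis
    by (rule J_cong[rotated]) (simp add: m)
qed

lemma J_subset_R: "J d \<subseteq> range comb"
proof
  interpret C: function_filtration G \<chi> "\<lambda>_. range comb" by (rule function_filtration_R)
  have chi: "(\<lambda>g\<in>carrier G. \<chi> a g - 1) \<in> range comb" if "a \<in> carrier G" for a
  proof -
    have "(\<lambda>g\<in>carrier G. \<chi> a g) \<in> range comb" using ch_eq_comb[OF that] by (simp add: ch_def)
    from C.A_add[OF this C.A_neg[OF C.A_one]] show ?thesis
      by (simp only: add_uminus_conv_diff)
  qed
  have mon: "(\<lambda>g\<in>carrier G. mon M g) \<in> range comb" if "set_mset M \<subseteq> K" for M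
    using that
  proof (induction M)
    case empty
    show ?case using C.A_one by (simp only: mon_empty)
  next
    case (add k M)
    then have k: "k \<in> K" and M: "set_mset M \<subseteq> K" by simp_all
    from C.A_mult[OF chi[OF e_closed[OF k]] add.IH[OF M]] show ?case
      by (simp only: mon_add_mset)
  qed
  fix y assume "y \<in> J d"
  then show "y \<in> range comb"
  proof (induction rule: J.induct)
    case J_zero
    show ?case by (rule C.A_zero)
  next
    case (J_step x M c)
    show ?case by (rule C.A_add[OF J_step.IH C.A_int_mult[OF mon[OF J_step.hyps(2)]]])
  qed
qed

lemma J_combE:
  assumes "x \<in> J d"
  obtains c where "x = comb c"
  using subsetD[OF J_subset_R assms] by (elim rangeE) (rule that)

lemma J_minus:
  assumes x: "x \<in> J d"
  shows "\<ominus>\<^bsub>R\<^esub> x \<in> J d"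
proof -
  obtain c where c: "x = comb c" using x by (rule J_combE)
  have "\<ominus>\<^bsub>R\<^esub> x = (\<lambda>g\<in>carrier G. - x g)"
    by (simp only: c R_neg comb_neg)
  then show ?thesis using J_neg[of x d] x by (simp only: J_extensional[OF x])
qed

lemma J_plus: "x \<in> J d \<Longrightarrow> y \<in> J d \<Longrightarrow> x \<oplus>\<^bsub>R\<^esub> y \<in> J d"
  using J_add[of x d y] J_extensional[of x d] J_extensional[of y d] by (simp only: R_sel)

lemma J_times: "x \<in> J i \<Longrightarrow> y \<in> J j \<Longrightarrow> x \<otimes>\<^bsub>R\<^esub> y \<in> J (i + j)"
  using J_mult[of x i y j] J_extensional[of x i] J_extensional[of y j] by (simp only: R_sel)

lemma J_zero': "\<zero>\<^bsub>R\<^esub> \<in> J d"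
  using J_zero by (simp only: R_sel)

lemma J_one': "\<one>\<^bsub>R\<^esub> \<in> J 0"
  using J_one by (simp only: R_sel)

lemma J_carrier: "x \<in> J d \<Longrightarrow> x \<in> carrier R"
  unfolding carrier_R by (rule subsetD[OF J_subset_R])

definition Jmon :: "'k multiset \<Rightarrow> 'a \<Rightarrow> complex" where
  "Jmon M = (\<lambda>g\<in>carrier G. mon M g)"

lemma Jmon_in_J: "set_mset M \<subseteq> K \<Longrightarrow> d \<le> size M \<Longrightarrow> Jmon M \<in> J d"
  using J_mon_mult[of M d 1] by (simp add: Jmon_def)

text \<open>Each \<gamma>^i(x) lies in \<open>J i\<close> and \<open>J\<close> is multiplicative,
  which bounds the filtration from above. Conversely a monomial of degree at least n is a product of
  values of \<gamma>^1, one for each of its factors.\<close>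

lemma gamma_filtration_eq: "gamma_filtration G n = J n"
proof -
  interpret R: cring R by (rule R_cring)
  let ?gens = "{foldr (\<lambda>(i, x) y. gamma_op G i x \<otimes>\<^bsub>R\<^esub> y) ps \<one>\<^bsub>R\<^esub> | ps.
           snd ` set ps \<subseteq> augmentation_ideal G \<and> n \<le> sum_list (map fst ps)}"
  let ?g = "generate (add_monoid R) ?gens"
  have prod: "foldr (\<lambda>(i, x) y. gamma_op G i x \<otimes>\<^bsub>R\<^esub> y) ps \<one>\<^bsub>R\<^esub> \<in> J (sum_list (map fst ps))"
    if "snd ` set ps \<subseteq> augmentation_ideal G" for ps
    using that
  proof (induction ps)
    case Nil
    show ?case using J_one' by simp
  next
    case (Cons q ps)
    obtain i x where q: "q = (i, x)" by (cases q)
    have "gamma_op G i x \<in> J i"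
      using Cons.prems by (intro J.gamma_op_in_filtration chi_minus_one_in_J) (simp_all add: q)
    with Cons show ?case by (simp add: q J_times)
  qed
  have gens: "h \<in> J n" if "h \<in> ?gens" for h
  proof -
    from that obtain ps where ps: "h = foldr (\<lambda>(i, x) y. gamma_op G i x \<otimes>\<^bsub>R\<^esub> y) ps \<one>\<^bsub>R\<^esub>"
      "snd ` set ps \<subseteq> augmentation_ideal G" "n \<le> sum_list (map fst ps)" by (elim CollectE exE conjE)
    show ?thesis unfolding ps(1) by (rule J_antimono[OF prod[OF ps(2)] ps(3)])
  qed
  have "x \<in> J n" if "x \<in> ?g" for x
    using that
  proof (induction rule: generate.induct)
    case one
    show ?case using J_zero' by simp
  next
    case (incl h)
    then show ?case by (rule gens)
  next
    case (inv h)
    then show ?case using J_minus[OF gens[OF inv]] by (simp only: a_inv_def)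
  next
    case (eng h1 h2)
    then show ?case using J_plus by simp
  qed
  moreover have "x \<in> ?g" if "x \<in> J n" for x
    using that
  proof (induction rule: J.induct)
    case J_zero
    show ?case
      unfolding R_sel(3)[symmetric] using generate.one[of "add_monoid R" ?gens] by (simp only: monoid.simps)
  next
    case (J_step x M c)
    have aug: "(\<lambda>g\<in>carrier G. \<chi> (e k) g - 1) \<in> augmentation_ideal G"
      "gamma_op G 1 (\<lambda>g\<in>carrier G. \<chi> (e k) g - 1) = (\<lambda>g\<in>carrier G. \<chi> (e k) g - 1)" if kK: "k \<in> K" for k
    proof -
      have "(\<lambda>g\<in>carrier G. \<chi> (e k) g - 1) \<in> carrier R"
        by (rule J_carrier[OF chi_minus_one_in_J[OF e_closed[OF kK]]])
      then show "(\<lambda>g\<in>carrier G. \<chi> (e k) g - 1) \<in> augmentation_ideal G"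
        unfolding augmentation_ideal_def by (simp add: chi_one_right e_closed[OF kK])
      obtain c where "(\<lambda>g\<in>carrier G. \<chi> (e k) g - 1) = comb c"
        using chi_minus_one_in_J[OF e_closed[OF kK]] by (rule J_combE)
      then show "gamma_op G 1 (\<lambda>g\<in>carrier G. \<chi> (e k) g - 1) = (\<lambda>g\<in>carrier G. \<chi> (e k) g - 1)"
        by (simp only: gamma_op_1)
    qed
    \<comment> \<open>The list contains (1, \<chi>_k - 1) once for every occurrence of k in
      \<open>M\<close>, so that its total degree is the size of \<open>M\<close>.\<close>
    have "\<exists>ps. snd ` set ps \<subseteq> augmentation_ideal G \<and> sum_list (map fst ps) = size M \<and>
        foldr (\<lambda>(i, x) y. gamma_op G i x \<otimes>\<^bsub>R\<^esub> y) ps \<one>\<^bsub>R\<^esub> = Jmon M"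
      using J_step.hyps(2)
    proof (induction M)
      case empty
      show ?case by (rule exI[of _ "[]"]) (simp add: Jmon_def mon_empty R_sel)
    next
      case (add k M)
      then obtain ps where ps: "snd ` set ps \<subseteq> augmentation_ideal G" "sum_list (map fst ps) = size M"
        "foldr (\<lambda>(i, x) y. gamma_op G i x \<otimes>\<^bsub>R\<^esub> y) ps \<one>\<^bsub>R\<^esub> = Jmon M" by auto
      have k: "k \<in> K" using add.prems by simp
      have "(\<lambda>g\<in>carrier G. \<chi> (e k) g - 1) \<otimes>\<^bsub>R\<^esub> Jmon M = Jmon (add_mset k M)"
        unfolding R_sel Jmon_def mon_add_mset by (rule restrict_ext) simp
      then show ?case
        using ps aug[OF k] by (intro exI[of _ "(1, \<lambda>g\<in>carrier G. \<chi> (e k) g - 1) # ps"]) simp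
    qed
    then obtain ps where ps: "snd ` set ps \<subseteq> augmentation_ideal G" "sum_list (map fst ps) = size M"
        "foldr (\<lambda>(i, x) y. gamma_op G i x \<otimes>\<^bsub>R\<^esub> y) ps \<one>\<^bsub>R\<^esub> = Jmon M" by auto
    have M: "Jmon M \<in> ?g"
      unfolding ps(3)[symmetric]
      by (rule generate.incl, rule CollectI, rule exI[of _ ps], intro conjI refl ps(1))
        (use J_step.hyps(3) ps(2) in simp)
    have sub: "subgroup ?g (add_monoid R)"
    proof (rule group.generate_is_subgroup[OF R.a_group])
      show "?gens \<subseteq> carrier (add_monoid R)" using gens J_carrier by auto
    qed
    have neg: "\<ominus>\<^bsub>R\<^esub> y \<in> ?g" if "y \<in> ?g" for y
      using subgroup.m_inv_closed[OF sub that] by (simp only: a_inv_def)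
    have plus: "y \<oplus>\<^bsub>R\<^esub> z \<in> ?g" if "y \<in> ?g" "z \<in> ?g" for y z
      using subgroup.m_closed[OF sub that] by simp
    have nat: "(\<lambda>g\<in>carrier G. x g + of_nat j * y g) \<in> ?g" if "(\<lambda>g\<in>carrier G. y g) \<in> ?g" for y and j :: nat
    proof (induction j)
      case 0
      show ?case using J_step.IH by (simp only: of_nat_0 mult_zero_left add_0_right)
    next
      case (Suc j)
      have "(\<lambda>g\<in>carrier G. x g + of_nat (Suc j) * y g) =
          (\<lambda>g\<in>carrier G. y g) \<oplus>\<^bsub>R\<^esub> (\<lambda>g\<in>carrier G. x g + of_nat j * y g)"
        unfolding R_sel by (rule restrict_ext) (simp add: algebra_simps)
      then show ?case using plus[OF that Suc.IH] by (simp only:)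
    qed
    show ?case
    proof (cases "c \<ge> 0")
      case True
      from nat[OF M[unfolded Jmon_def], of "nat c"] show ?thesis using True by (simp only: of_nat_nat)
    next
      case False
      obtain c' where c': "Jmon M = comb c'"
        using Jmon_in_J[OF J_step.hyps(2,3)] by (rule J_combE)
      have "\<ominus>\<^bsub>R\<^esub> Jmon M = (\<lambda>g\<in>carrier G. - mon M g)"
        unfolding c' R_neg comb_neg[symmetric] unfolding c'[symmetric] Jmon_def by (rule restrict_ext) simp
      with neg[OF M] have "(\<lambda>g\<in>carrier G. - mon M g) \<in> ?g" by (simp only:)
      from nat[OF this, of "nat (- c)"]
      have "(\<lambda>g\<in>carrier G. x g + of_int (- c) * - mon M g) \<in> ?g" using False by (simp only: of_nat_nat)
      then show ?thesis by (simp only: of_int_minus minus_mult_minus)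
    qed
  qed
  ultimately have "?g = J n" by blast
  then show ?thesis by (simp only: gamma_filtration_def Let_def)
qed

end

section \<open>The graded ring\<close>

text \<open>The index \<open>j\<close> may or may not occur in \<open>m\<close>; both products are
  compared over the common index set with \<open>j\<close> inserted, where an index of count 0
  contributes 1.\<close>

lemma (in comm_monoid) finprod_count_add_mset:
  assumes "j \<in> A" "set_mset m \<subseteq> A" "x \<in> A \<rightarrow> carrier G"
  shows "(\<Otimes>k\<in>set_mset (add_mset j m). x k [^] count (add_mset j m) k) =
    x j \<otimes> (\<Otimes>k\<in>set_mset m. x k [^] count m k)"
proof -
  let ?S = "insert j (set_mset m)"
  have x: "x k \<in> carrier G" if "k \<in> ?S" for k using that assms by auto
  have "(\<Otimes>k\<in>?S. x k [^] count (add_mset j m) k) =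
      (\<Otimes>k\<in>?S. (if j = k then x k else \<one>) \<otimes> x k [^] count m k)"
    using x by (intro finprod_cong') (auto simp: m_comm)
  also have "\<dots> = (\<Otimes>k\<in>?S. if j = k then x k else \<one>) \<otimes> (\<Otimes>k\<in>?S. x k [^] count m k)"
    using x by (intro finprod_multf) auto
  also have "(\<Otimes>k\<in>?S. if j = k then x k else \<one>) = x j"
    using x by (intro finprod_singleton) auto
  also have "(\<Otimes>k\<in>?S. x k [^] count m k) = (\<Otimes>k\<in>set_mset m. x k [^] count m k)"
    using x by (intro finprod_mono_neutral_cong_right) (auto simp: not_in_iff)
  finally show ?thesis by simp
qed

context generated_self_dual_group
begin

interpretation R: cring R by (rule R_cring)
interpretation U: UP_cring R "UP R" by unfold_locales

section \<open>Cosets of the filtration and the graded pieces\<close>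

lemma J_subgroup: "subgroup (J d) (add_monoid R)"
proof (rule group.subgroupI[OF R.a_group])
  show "J d \<subseteq> carrier (add_monoid R)" using J_carrier by auto
  show "J d \<noteq> {}" using J_zero' by auto
  show "inv\<^bsub>add_monoid R\<^esub> x \<in> J d" if "x \<in> J d" for x
    using J_minus[OF that] by (simp only: a_inv_def)
  show "x \<otimes>\<^bsub>add_monoid R\<^esub> y \<in> J d" if "x \<in> J d" "y \<in> J d" for x y
    using J_plus[OF that] by simp
qed

lemma J_abelian_subgroup: "abelian_subgroup (J d) R"
  by (rule abelian_subgroupI3[OF additive_subgroup.intro[OF J_subgroup] R.abelian_group_axioms])

lemma J_finsum: "finite S \<Longrightarrow> f \<in> S \<rightarrow> J d \<Longrightarrow> finsum R f S \<in> J d"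
proof (induction S rule: finite_induct)
  case empty
  then show ?case using J_zero' by simp
next
  case (insert i S)
  then have "f \<in> S \<rightarrow> carrier R" "f i \<in> carrier R" using J_carrier by auto
  then show ?case using insert J_plus by simp
qed

lemma coset_plus:
  "x \<in> carrier R \<Longrightarrow> y \<in> carrier R \<Longrightarrow> (J d +>\<^bsub>R\<^esub> x) <+>\<^bsub>R\<^esub> (J d +>\<^bsub>R\<^esub> y) = J d +>\<^bsub>R\<^esub> (x \<oplus>\<^bsub>R\<^esub> y)"
  by (rule abelian_subgroup.a_rcos_sum[OF J_abelian_subgroup])

lemma coset_zero: "x \<in> J d \<Longrightarrow> J d +>\<^bsub>R\<^esub> x = J d"
  using abelian_subgroup.a_rcos_const[OF J_abelian_subgroup] .

lemma graded_piece_sel: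
  "carrier (graded_piece G n) = (\<lambda>x. J (Suc n) +>\<^bsub>R\<^esub> x) ` J n"
  "\<one>\<^bsub>graded_piece G n\<^esub> = J (Suc n)"
  "A \<otimes>\<^bsub>graded_piece G n\<^esub> B = A <+>\<^bsub>R\<^esub> B"
  unfolding graded_piece_def gamma_filtration_eq A_FactGroup_def FactGroup_def
  by (auto simp: RCOSETS_def a_r_coset_def r_coset_def set_add_def set_mult_def)

lemma graded_piece_comm_group: "comm_group (graded_piece G n)"
proof (rule comm_groupI)
  let ?Q = "graded_piece G n"
  show "\<one>\<^bsub>?Q\<^esub> \<in> carrier ?Q"
    using imageI[OF J_zero'[of n], of "\<lambda>x. J (Suc n) +>\<^bsub>R\<^esub> x"]
    by (simp only: graded_piece_sel coset_zero[OF J_zero'])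
  fix A assume "A \<in> carrier ?Q"
  then obtain x where x: "A = J (Suc n) +>\<^bsub>R\<^esub> x" "x \<in> J n" by (auto simp: graded_piece_sel)
  note xc = J_carrier[OF x(2)]
  show "\<one>\<^bsub>?Q\<^esub> \<otimes>\<^bsub>?Q\<^esub> A = A"
    using coset_plus[OF R.zero_closed xc, of "Suc n"] xc
    by (simp only: graded_piece_sel x coset_zero[OF J_zero'] R.l_zero)
  show "\<exists>B\<in>carrier ?Q. B \<otimes>\<^bsub>?Q\<^esub> A = \<one>\<^bsub>?Q\<^esub>"
  proof (rule bexI)
    show "J (Suc n) +>\<^bsub>R\<^esub> (\<ominus>\<^bsub>R\<^esub> x) \<in> carrier ?Q"
      unfolding graded_piece_sel by (rule imageI[OF J_minus[OF x(2)]])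
    show "(J (Suc n) +>\<^bsub>R\<^esub> (\<ominus>\<^bsub>R\<^esub> x)) \<otimes>\<^bsub>?Q\<^esub> A = \<one>\<^bsub>?Q\<^esub>"
      by (simp only: graded_piece_sel x coset_plus[OF R.a_inv_closed[OF xc] xc] R.l_neg[OF xc] coset_zero[OF J_zero'])
  qed
  fix B assume "B \<in> carrier ?Q"
  then obtain y where y: "B = J (Suc n) +>\<^bsub>R\<^esub> y" "y \<in> J n" by (auto simp: graded_piece_sel)
  note yc = J_carrier[OF y(2)]
  show "A \<otimes>\<^bsub>?Q\<^esub> B \<in> carrier ?Q"
    by (simp only: graded_piece_sel x(1) y(1) coset_plus[OF xc yc]) (rule imageI[OF J_plus[OF x(2) y(2)]])
  show "A \<otimes>\<^bsub>?Q\<^esub> B = B \<otimes>\<^bsub>?Q\<^esub> A"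
    by (simp only: graded_piece_sel x(1) y(1) coset_plus[OF xc yc] coset_plus[OF yc xc] R.a_comm[OF xc yc])
  fix C assume "C \<in> carrier ?Q"
  then obtain z where z: "C = J (Suc n) +>\<^bsub>R\<^esub> z" "z \<in> J n" by (auto simp: graded_piece_sel)
  note zc = J_carrier[OF z(2)]
  show "A \<otimes>\<^bsub>?Q\<^esub> B \<otimes>\<^bsub>?Q\<^esub> C = A \<otimes>\<^bsub>?Q\<^esub> (B \<otimes>\<^bsub>?Q\<^esub> C)"
    by (simp only: graded_piece_sel x(1) y(1) z(1) coset_plus xc yc zc R.a_closed R.a_assoc)
qed

abbreviation RG where "RG \<equiv> graded_char_ring G"

lemma RG_sel:
  "carrier RG = {u. (\<forall>n. u n \<in> carrier (graded_piece G n)) \<and> finite {n. u n \<noteq> J (Suc n)}}"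
  "\<zero>\<^bsub>RG\<^esub> = (\<lambda>n. J (Suc n))"
  "u \<oplus>\<^bsub>RG\<^esub> v = (\<lambda>n. u n <+>\<^bsub>R\<^esub> v n)"
  "\<one>\<^bsub>RG\<^esub> = (\<lambda>n. if n = 0 then J 1 +>\<^bsub>R\<^esub> \<one>\<^bsub>R\<^esub> else J (Suc n))"
  "u \<otimes>\<^bsub>RG\<^esub> v = (\<lambda>n. finprod (graded_piece G n)
        (\<lambda>i. rcoset_mult R (J (Suc n)) (u i) (v (n - i))) {..n})"
  using comm_group.axioms(2)[OF graded_piece_comm_group]
  by (simp_all add: graded_char_ring_def carrier_sum_group PiE_UNIV_domain gamma_filtration_eq
      graded_piece_sel Pi_iff restrict_def cong: if_cong)

section \<open>The Rees ring and its map onto the graded ring\<close>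

definition rees :: "(nat \<Rightarrow> 'a \<Rightarrow> complex) set" where
  "rees = {u \<in> carrier (UP R). \<forall>n. u n \<in> J n}"

abbreviation B where "B \<equiv> (UP R)\<lparr>carrier := rees\<rparr>"

text \<open>Reduction of the n-th coefficient modulo \<open>J (Suc n)\<close>. On the Rees ring this
  is a surjective homomorphism to the graded ring, which thereby inherits associativity and
  distributivity.\<close>

definition cosets :: "(nat \<Rightarrow> 'a \<Rightarrow> complex) \<Rightarrow> nat \<Rightarrow> ('a \<Rightarrow> complex) set" where
  "cosets u = (\<lambda>n. J (Suc n) +>\<^bsub>R\<^esub> u n)"

lemma UP_sel:
  assumes "u \<in> carrier (UP R)" "v \<in> carrier (UP R)"
  shows "(u \<oplus>\<^bsub>UP R\<^esub> v) n = u n \<oplus>\<^bsub>R\<^esub> v n"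
    and "(u \<otimes>\<^bsub>UP R\<^esub> v) n = (\<Oplus>\<^bsub>R\<^esub>i\<in>{..n}. u i \<otimes>\<^bsub>R\<^esub> v (n - i))"
    and "(\<ominus>\<^bsub>UP R\<^esub> u) n = \<ominus>\<^bsub>R\<^esub> u n"
    and "u n \<in> carrier R"
proof -
  have up: "u \<in> up R" "v \<in> up R"
    using assms unfolding UP_def by (simp_all only: partial_object.simps)
  show "(u \<oplus>\<^bsub>UP R\<^esub> v) n = u n \<oplus>\<^bsub>R\<^esub> v n"
    and "(u \<otimes>\<^bsub>UP R\<^esub> v) n = (\<Oplus>\<^bsub>R\<^esub>i\<in>{..n}. u i \<otimes>\<^bsub>R\<^esub> v (n - i))"
    unfolding UP_def by (simp_all only: ring.simps monoid.simps up_ring.simps partial_object.simps restrict_apply' up)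
  have c: "up_ring.coeff (UP R) w n = w n" if "w \<in> carrier (UP R)" for w
    using that unfolding UP_def by (simp only: up_ring.simps partial_object.simps restrict_apply')
  show "(\<ominus>\<^bsub>UP R\<^esub> u) n = \<ominus>\<^bsub>R\<^esub> u n"
    using U.coeff_a_inv[OF assms(1), of n] c[OF assms(1)] c[OF U.UP_a_inv_closed[OF assms(1)]] by simp
  show "u n \<in> carrier R" using U.coeff_closed[OF assms(1), of n] c[OF assms(1)] by simp
qed

lemma UP_one: "\<one>\<^bsub>UP R\<^esub> = (\<lambda>n. if n = 0 then \<one>\<^bsub>R\<^esub> else \<zero>\<^bsub>R\<^esub>)"
  by (simp add: UP_def)

lemma UP_zero: "\<zero>\<^bsub>UP R\<^esub> = (\<lambda>n. \<zero>\<^bsub>R\<^esub>)"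
  by (simp add: UP_def)

lemma rees_UP: "u \<in> rees \<Longrightarrow> u \<in> carrier (UP R)" and rees_J: "u \<in> rees \<Longrightarrow> u n \<in> J n"
  by (auto simp: rees_def)

lemma subring_rees: "subring rees (UP R)"
proof (rule U.P.subringI)
  show "rees \<subseteq> carrier (UP R)" using rees_UP by blast
  show "\<one>\<^bsub>UP R\<^esub> \<in> rees"
    unfolding rees_def mem_Collect_eq
    by (intro conjI U.UP_one_closed) (simp add: UP_one J_one' J_zero')
  fix u assume u: "u \<in> rees"
  show "\<ominus>\<^bsub>UP R\<^esub> u \<in> rees"
    unfolding rees_def mem_Collect_eq
    using u by (intro conjI U.UP_a_inv_closed allI) (simp_all add: rees_UP UP_sel(3)[OF rees_UP rees_UP] J_minus rees_J)
  fix v assume v: "v \<in> rees"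
  show "u \<oplus>\<^bsub>UP R\<^esub> v \<in> rees"
    unfolding rees_def mem_Collect_eq
    using u v by (intro conjI U.UP_a_closed allI) (simp_all add: rees_UP UP_sel(1)[OF rees_UP rees_UP] J_plus rees_J)
  show "u \<otimes>\<^bsub>UP R\<^esub> v \<in> rees"
    unfolding rees_def mem_Collect_eq
  proof (intro conjI allI)
    show "u \<otimes>\<^bsub>UP R\<^esub> v \<in> carrier (UP R)" using u v rees_UP by simp
    fix n
    have "u i \<otimes>\<^bsub>R\<^esub> v (n - i) \<in> J n" if "i \<le> n" for i
      using J_times[OF rees_J[OF u, of i] rees_J[OF v, of "n - i"]] that by simp
    then show "(u \<otimes>\<^bsub>UP R\<^esub> v) n \<in> J n"
      unfolding UP_sel(2)[OF rees_UP[OF u] rees_UP[OF v]] by (intro J_finsum) auto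
  qed
qed

lemma rees_cring: "cring B"
proof -
  have "subcring rees (UP R)" by (rule U.P.subcringI'[OF subring_rees])
  then show ?thesis using U.P.subcring_iff[OF subringE(1)[OF subring_rees]] by simp
qed

text \<open>In (h + u)(h' + v) the terms h h', h v and u h' all have filtration degree above i + j.
  So all products of representatives have the same coset, and the union defining
  \<open>rcoset_mult\<close> collapses to it.\<close>

lemma coset_mult:
  assumes u: "u \<in> J i" and v: "v \<in> J j"
  shows "rcoset_mult R (J (Suc (i + j))) (J (Suc i) +>\<^bsub>R\<^esub> u) (J (Suc j) +>\<^bsub>R\<^esub> v) =
    J (Suc (i + j)) +>\<^bsub>R\<^esub> (u \<otimes>\<^bsub>R\<^esub> v)"
proof -
  note c = J_carrier[OF u] J_carrier[OF v]
  have *: "J (Suc (i + j)) +>\<^bsub>R\<^esub> (a \<otimes>\<^bsub>R\<^esub> b) = J (Suc (i + j)) +>\<^bsub>R\<^esub> (u \<otimes>\<^bsub>R\<^esub> v)"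
    if "a \<in> J (Suc i) +>\<^bsub>R\<^esub> u" "b \<in> J (Suc j) +>\<^bsub>R\<^esub> v" for a b
  proof -
    from that obtain h h' where h: "h \<in> J (Suc i)" "a = h \<oplus>\<^bsub>R\<^esub> u" and h': "h' \<in> J (Suc j)" "b = h' \<oplus>\<^bsub>R\<^esub> v"
      unfolding a_r_coset_def' by blast
    note c' = J_carrier[OF h(1)] J_carrier[OF h'(1)]
    let ?w = "h \<otimes>\<^bsub>R\<^esub> h' \<oplus>\<^bsub>R\<^esub> h \<otimes>\<^bsub>R\<^esub> v \<oplus>\<^bsub>R\<^esub> u \<otimes>\<^bsub>R\<^esub> h'"
    have "h \<otimes>\<^bsub>R\<^esub> h' \<in> J (Suc (i + j))" by (rule J_antimono[OF J_times[OF h(1) h'(1)]]) simp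
    moreover have "h \<otimes>\<^bsub>R\<^esub> v \<in> J (Suc (i + j))" by (rule J_antimono[OF J_times[OF h(1) v]]) simp
    moreover have "u \<otimes>\<^bsub>R\<^esub> h' \<in> J (Suc (i + j))" by (rule J_antimono[OF J_times[OF u h'(1)]]) simp
    ultimately have w: "?w \<in> J (Suc (i + j))" by (intro J_plus)
    have "a \<otimes>\<^bsub>R\<^esub> b = ?w \<oplus>\<^bsub>R\<^esub> u \<otimes>\<^bsub>R\<^esub> v"
      unfolding h h' using c c' by algebra
    then have "J (Suc (i + j)) +>\<^bsub>R\<^esub> (a \<otimes>\<^bsub>R\<^esub> b) = (J (Suc (i + j)) +>\<^bsub>R\<^esub> ?w) <+>\<^bsub>R\<^esub> (J (Suc (i + j)) +>\<^bsub>R\<^esub> (u \<otimes>\<^bsub>R\<^esub> v))"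
      using coset_plus[OF J_carrier[OF w] R.m_closed[OF c]] by (simp only:)
    also have "\<dots> = (J (Suc (i + j)) +>\<^bsub>R\<^esub> \<zero>\<^bsub>R\<^esub>) <+>\<^bsub>R\<^esub> (J (Suc (i + j)) +>\<^bsub>R\<^esub> (u \<otimes>\<^bsub>R\<^esub> v))"
      by (simp only: coset_zero[OF w] coset_zero[OF J_zero'])
    also have "\<dots> = J (Suc (i + j)) +>\<^bsub>R\<^esub> (u \<otimes>\<^bsub>R\<^esub> v)"
      using coset_plus[OF R.zero_closed R.m_closed[OF c]] c by simp
    finally show ?thesis .
  qed
  have self: "u \<in> J (Suc i) +>\<^bsub>R\<^esub> u" "v \<in> J (Suc j) +>\<^bsub>R\<^esub> v"
    using abelian_subgroup.a_rcos_self[OF J_abelian_subgroup] c by blast+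
  show ?thesis
    unfolding rcoset_mult_def
  proof (intro equalityI subsetI)
    fix z assume "z \<in> (\<Union>a\<in>J (Suc i) +>\<^bsub>R\<^esub> u. \<Union>b\<in>J (Suc j) +>\<^bsub>R\<^esub> v. J (Suc (i + j)) +>\<^bsub>R\<^esub> a \<otimes>\<^bsub>R\<^esub> b)"
    then obtain a b where "a \<in> J (Suc i) +>\<^bsub>R\<^esub> u" "b \<in> J (Suc j) +>\<^bsub>R\<^esub> v" "z \<in> J (Suc (i + j)) +>\<^bsub>R\<^esub> a \<otimes>\<^bsub>R\<^esub> b"
      by (elim UN_E)
    then show "z \<in> J (Suc (i + j)) +>\<^bsub>R\<^esub> (u \<otimes>\<^bsub>R\<^esub> v)" using * by (simp only:)
  next
    fix z assume "z \<in> J (Suc (i + j)) +>\<^bsub>R\<^esub> (u \<otimes>\<^bsub>R\<^esub> v)"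
    then show "z \<in> (\<Union>a\<in>J (Suc i) +>\<^bsub>R\<^esub> u. \<Union>b\<in>J (Suc j) +>\<^bsub>R\<^esub> v. J (Suc (i + j)) +>\<^bsub>R\<^esub> a \<otimes>\<^bsub>R\<^esub> b)"
      by (intro UN_I[OF self(1)] UN_I[OF self(2)])
  qed
qed

lemma finprod_cosets:
  assumes "finite S" "f \<in> S \<rightarrow> J n"
  shows "finprod (graded_piece G n) (\<lambda>i. J (Suc n) +>\<^bsub>R\<^esub> f i) S = J (Suc n) +>\<^bsub>R\<^esub> finsum R f S"
proof -
  interpret Q: comm_group "graded_piece G n" by (rule graded_piece_comm_group)
  show ?thesis
    using assms
  proof (induction S rule: finite_induct)
    case empty
    then show ?case by (simp add: graded_piece_sel coset_zero[OF J_zero'])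
  next
    case (insert i S)
    then have f: "f \<in> S \<rightarrow> J n" "f i \<in> J n" by auto
    then have fc: "f \<in> S \<rightarrow> carrier R" "f i \<in> carrier R" using J_carrier by auto
    have "finprod (graded_piece G n) (\<lambda>i. J (Suc n) +>\<^bsub>R\<^esub> f i) (insert i S) =
        (J (Suc n) +>\<^bsub>R\<^esub> f i) <+>\<^bsub>R\<^esub> finprod (graded_piece G n) (\<lambda>i. J (Suc n) +>\<^bsub>R\<^esub> f i) S"
      using insert.hyps f by (subst Q.finprod_insert) (auto simp: graded_piece_sel)
    also have "\<dots> = J (Suc n) +>\<^bsub>R\<^esub> (f i \<oplus>\<^bsub>R\<^esub> finsum R f S)"
      unfolding insert.IH[OF f(1)] using fc by (intro coset_plus R.finsum_closed)
    also have "f i \<oplus>\<^bsub>R\<^esub> finsum R f S = finsum R f (insert i S)"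
      using insert.hyps fc by (intro R.finsum_insert[symmetric])
    finally show ?case .
  qed
qed

lemma cosets_hom: "cosets \<in> Ring.ring_hom B RG"
proof (rule ring_hom_memI)
  fix u assume "u \<in> carrier B"
  then have u: "u \<in> rees" by simp
  show "cosets u \<in> carrier RG"
    unfolding RG_sel
  proof (intro CollectI conjI allI)
    show "cosets u n \<in> carrier (graded_piece G n)" for n
      unfolding cosets_def graded_piece_sel by (rule imageI[OF rees_J[OF u]])
    obtain N where "bound \<zero>\<^bsub>R\<^esub> N u"
      using rees_UP[OF u] by (auto simp: UP_def up_def)
    then have "u n = \<zero>\<^bsub>R\<^esub>" if "n > N" for n using that by (auto simp: bound_def)
    then have "cosets u n = J (Suc n)" if "n > N" for n
      using that by (simp add: cosets_def coset_zero[OF J_zero'])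
    then have "{n. cosets u n \<noteq> J (Suc n)} \<subseteq> {..N}" using not_less by blast
    then show "finite {n. cosets u n \<noteq> J (Suc n)}" by (rule finite_subset) simp
  qed
  fix v assume "v \<in> carrier B"
  then have v: "v \<in> rees" by simp
  note uv = UP_sel[OF rees_UP[OF u] rees_UP[OF v]]
  show "cosets (u \<oplus>\<^bsub>B\<^esub> v) = cosets u \<oplus>\<^bsub>RG\<^esub> cosets v"
    unfolding RG_sel cosets_def
    by (rule ext) (simp add: uv(1) coset_plus J_carrier[OF rees_J[OF u]] J_carrier[OF rees_J[OF v]])
  show "cosets (u \<otimes>\<^bsub>B\<^esub> v) = cosets u \<otimes>\<^bsub>RG\<^esub> cosets v"
    unfolding RG_sel
  proof
    fix n
    interpret Q: comm_group "graded_piece G n" by (rule graded_piece_comm_group)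
    have uvJ: "u i \<otimes>\<^bsub>R\<^esub> v (n - i) \<in> J n" if "i \<le> n" for i
      using J_times[OF rees_J[OF u, of i] rees_J[OF v, of "n - i"]] that by simp
    have "finprod (graded_piece G n) (\<lambda>i. rcoset_mult R (J (Suc n)) (cosets u i) (cosets v (n - i))) {..n} =
        finprod (graded_piece G n) (\<lambda>i. J (Suc n) +>\<^bsub>R\<^esub> (u i \<otimes>\<^bsub>R\<^esub> v (n - i))) {..n}"
    proof (rule Q.finprod_cong')
      show "(\<lambda>i. J (Suc n) +>\<^bsub>R\<^esub> (u i \<otimes>\<^bsub>R\<^esub> v (n - i))) \<in> {..n} \<rightarrow> carrier (graded_piece G n)"
        unfolding graded_piece_sel using uvJ by blast
      fix i assume "i \<in> {..n}"
      then show "rcoset_mult R (J (Suc n)) (cosets u i) (cosets v (n - i)) = J (Suc n) +>\<^bsub>R\<^esub> (u i \<otimes>\<^bsub>R\<^esub> v (n - i))"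
        using coset_mult[OF rees_J[OF u, of i] rees_J[OF v, of "n - i"]] by (simp add: cosets_def)
    qed simp
    also have "\<dots> = J (Suc n) +>\<^bsub>R\<^esub> (\<Oplus>\<^bsub>R\<^esub>i\<in>{..n}. u i \<otimes>\<^bsub>R\<^esub> v (n - i))"
      by (rule finprod_cosets) (use uvJ in auto)
    also have "\<dots> = cosets (u \<otimes>\<^bsub>B\<^esub> v) n"
      by (simp add: cosets_def uv(2))
    finally show "cosets (u \<otimes>\<^bsub>B\<^esub> v) n =
      finprod (graded_piece G n) (\<lambda>i. rcoset_mult R (J (Suc n)) (cosets u i) (cosets v (n - i))) {..n}" ..
  qed
next
  show "cosets \<one>\<^bsub>B\<^esub> = \<one>\<^bsub>RG\<^esub>"
    unfolding RG_sel cosets_def by (rule ext) (simp add: UP_one coset_zero[OF J_zero'])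
qed

lemma cosets_surj: "cosets ` rees = carrier RG"
proof (intro equalityI subsetI)
  fix v assume "v \<in> cosets ` rees"
  then show "v \<in> carrier RG" using ring_hom_closed[OF cosets_hom] by auto
next
  fix v assume v: "v \<in> carrier RG"
  \<comment> \<open>Trivial cosets get the representative 0, so that the finite support of
    \<open>v\<close> makes the chosen family a polynomial.\<close>
  have "\<forall>n. \<exists>x. x \<in> J n \<and> v n = J (Suc n) +>\<^bsub>R\<^esub> x \<and> (v n = J (Suc n) \<longrightarrow> x = \<zero>\<^bsub>R\<^esub>)"
  proof
    fix n
    show "\<exists>x. x \<in> J n \<and> v n = J (Suc n) +>\<^bsub>R\<^esub> x \<and> (v n = J (Suc n) \<longrightarrow> x = \<zero>\<^bsub>R\<^esub>)"
    proof (cases "v n = J (Suc n)")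
      case True
      then show ?thesis
        by (intro exI[of _ "\<zero>\<^bsub>R\<^esub>"]) (simp add: J_zero' coset_zero[OF J_zero'])
    next
      case False
      have "v n \<in> (\<lambda>x. J (Suc n) +>\<^bsub>R\<^esub> x) ` J n"
        using v by (simp add: RG_sel graded_piece_sel)
      with False show ?thesis by blast
    qed
  qed
  from choice[OF this] obtain u where
    u: "\<forall>n. u n \<in> J n \<and> v n = J (Suc n) +>\<^bsub>R\<^esub> u n \<and> (v n = J (Suc n) \<longrightarrow> u n = \<zero>\<^bsub>R\<^esub>)" ..
  note uJ = spec[OF u, THEN conjunct1]
    and uv = spec[OF u, THEN conjunct2, THEN conjunct1]
    and u0 = spec[OF u, THEN conjunct2, THEN conjunct2, THEN mp]
  have "finite {n. v n \<noteq> J (Suc n)}" using v by (simp add: RG_sel)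
  then obtain N where N: "\<forall>n\<in>{n. v n \<noteq> J (Suc n)}. n \<le> N"
    by (meson finite_nat_set_iff_bounded_le)
  have "bound \<zero>\<^bsub>R\<^esub> N u"
  proof
    fix n assume "N < n"
    then have "v n = J (Suc n)" using N by fastforce
    then show "u n = \<zero>\<^bsub>R\<^esub>" by (rule u0)
  qed
  then have "u \<in> rees"
    using uJ J_carrier by (auto simp: rees_def UP_def up_def)
  moreover have "v = cosets u" by (rule ext) (simp only: cosets_def uv)
  ultimately show "v \<in> cosets ` rees" by simp
qed

lemma cosets_zero: "cosets \<zero>\<^bsub>UP R\<^esub> = \<zero>\<^bsub>RG\<^esub>"
  unfolding RG_sel cosets_def UP_zero by (simp add: coset_zero[OF J_zero'])

lemma RG_cring: "cring RG"
proof -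
  interpret B: cring B by (rule rees_cring)
  \<comment> \<open>The image ring has carrier and zero replaced by their images; surjectivity and
    \<open>cosets_zero\<close> make it \<open>RG\<close> itself.\<close>
  have "ring (RG\<lparr>carrier := cosets ` carrier B, zero := cosets \<zero>\<^bsub>B\<^esub>\<rparr>)"
    by (rule B.ring_hom_imp_img_ring[OF cosets_hom])
  moreover have "RG\<lparr>carrier := cosets ` carrier B, zero := cosets \<zero>\<^bsub>B\<^esub>\<rparr> = RG"
    using cosets_surj cosets_zero by simp
  ultimately have ring: "ring RG" by simp
  moreover have "comm_monoid RG"
  proof (rule monoid.monoid_comm_monoidI[OF ring.is_monoid[OF ring]])
    fix x y assume "x \<in> carrier RG" "y \<in> carrier RG"
    then obtain u v where uv: "u \<in> carrier B" "x = cosets u" "v \<in> carrier B" "y = cosets v"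
      unfolding cosets_surj[symmetric] by auto
    then show "x \<otimes>\<^bsub>RG\<^esub> y = y \<otimes>\<^bsub>RG\<^esub> x"
      using ring_hom_mult[OF cosets_hom, of u v] ring_hom_mult[OF cosets_hom, of v u] B.m_comm[of u v]
      by (simp only:)
  qed
  ultimately show ?thesis by (rule cring.intro)
qed

interpretation RG: cring RG by (rule RG_cring)

section \<open>Homogeneous classes and generation in degree 1\<close>

definition cls :: "nat \<Rightarrow> ('a \<Rightarrow> complex) \<Rightarrow> nat \<Rightarrow> ('a \<Rightarrow> complex) set" where
  "cls d y = cosets (UnivPoly.monom (UP R) y d)"

lemma monom_apply: "y \<in> carrier R \<Longrightarrow> UnivPoly.monom (UP R) y d = (\<lambda>n. if n = d then y else \<zero>\<^bsub>R\<^esub>)"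
  by (simp add: UP_def)

lemma monom_rees: "y \<in> J d \<Longrightarrow> UnivPoly.monom (UP R) y d \<in> rees"
  unfolding rees_def using U.monom_closed[OF J_carrier] J_carrier J_zero' by (simp add: monom_apply)

lemma cls_apply:
  assumes "y \<in> J d"
  shows "cls d y = (\<lambda>n. if n = d then J (Suc d) +>\<^bsub>R\<^esub> y else J (Suc n))"
  unfolding cls_def cosets_def monom_apply[OF J_carrier[OF assms]]
  by (rule ext) (simp add: coset_zero[OF J_zero'])

lemma cls_closed: "y \<in> J d \<Longrightarrow> cls d y \<in> carrier RG"
  unfolding cls_def using ring_hom_closed[OF cosets_hom, of "UnivPoly.monom (UP R) y d"] monom_rees by simp

lemma cls_add:
  assumes "y \<in> J d" "z \<in> J d"
  shows "cls d (y \<oplus>\<^bsub>R\<^esub> z) = cls d y \<oplus>\<^bsub>RG\<^esub> cls d z"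
  using ring_hom_add[OF cosets_hom, of "UnivPoly.monom (UP R) y d" "UnivPoly.monom (UP R) z d"] assms
    U.monom_add[OF J_carrier[OF assms(1)] J_carrier[OF assms(2)], of d]
  by (simp add: cls_def monom_rees)

lemma cls_mult:
  assumes "y \<in> J d" "z \<in> J d'"
  shows "cls (d + d') (y \<otimes>\<^bsub>R\<^esub> z) = cls d y \<otimes>\<^bsub>RG\<^esub> cls d' z"
  using ring_hom_mult[OF cosets_hom, of "UnivPoly.monom (UP R) y d" "UnivPoly.monom (UP R) z d'"] assms
    U.monom_mult[OF J_carrier[OF assms(1)] J_carrier[OF assms(2)], of d d']
  by (simp add: cls_def monom_rees)

lemma cls_vanish:
  assumes "y \<in> J (Suc d)"
  shows "cls d y = \<zero>\<^bsub>RG\<^esub>"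
proof -
  have "y \<in> J d" by (rule J_antimono[OF assms]) simp
  then show ?thesis
    unfolding RG_sel by (intro ext) (simp add: cls_apply coset_zero[OF assms])
qed

lemma cls_one: "cls 0 \<one>\<^bsub>R\<^esub> = \<one>\<^bsub>RG\<^esub>"
  by (simp only: cls_apply[OF J_one'] RG_sel One_nat_def)

definition gr_gen :: "'k \<Rightarrow> nat \<Rightarrow> ('a \<Rightarrow> complex) set" where
  "gr_gen k = cls 1 (Jmon {#k#})"

lemma gr_gen_closed: "k \<in> K \<Longrightarrow> gr_gen k \<in> carrier RG"
  unfolding gr_gen_def by (rule cls_closed[OF Jmon_in_J]) simp_all

lemma gr_gen_homogeneous: "k \<in> K \<Longrightarrow> gr_gen k \<in> homogeneous_elements G 1"
  using gr_gen_closed[of k] cls_apply[OF Jmon_in_J[of "{#k#}" 1]]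
  by (simp add: homogeneous_elements_def graded_piece_sel gr_gen_def)

lemma Jmon_add_mset: "Jmon (add_mset k M) = Jmon {#k#} \<otimes>\<^bsub>R\<^esub> Jmon M"
  unfolding R_sel Jmon_def by (rule restrict_ext) (simp add: mon_def)

lemma cls_add_mset:
  assumes "k \<in> K" "set_mset M \<subseteq> K"
  shows "cls (size (add_mset k M)) (Jmon (add_mset k M)) = gr_gen k \<otimes>\<^bsub>RG\<^esub> cls (size M) (Jmon M)"
proof -
  have "Jmon {#k#} \<in> J 1" by (rule Jmon_in_J) (use assms in auto)
  from cls_mult[OF this Jmon_in_J[OF assms(2) order_refl]] show ?thesis
    unfolding Jmon_add_mset[of k M] gr_gen_def size_add_mset by (simp only: plus_1_eq_Suc)
qed

text \<open>Writes the class of a monomial in the shape of a term of \<open>mpoly_eval\<close>, a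
  product of powers over the distinct variables.\<close>

lemma cls_Jmon:
  assumes "set_mset M \<subseteq> K"
  shows "cls (size M) (Jmon M) = (\<Otimes>\<^bsub>RG\<^esub>k\<in>set_mset M. gr_gen k [^]\<^bsub>RG\<^esub> count M k)"
  using assms
proof (induction M)
  case empty
  have "Jmon {#} = \<one>\<^bsub>R\<^esub>" by (simp only: Jmon_def mon_empty R_sel)
  then show ?case by (simp add: cls_one)
next
  case (add k M)
  then have k: "k \<in> K" and M: "set_mset M \<subseteq> K" by simp_all
  have "cls (size (add_mset k M)) (Jmon (add_mset k M)) = gr_gen k \<otimes>\<^bsub>RG\<^esub> cls (size M) (Jmon M)"
    by (rule cls_add_mset[OF k M])
  also have "\<dots> = (\<Otimes>\<^bsub>RG\<^esub>j\<in>set_mset (add_mset k M). gr_gen j [^]\<^bsub>RG\<^esub> count (add_mset k M) j)"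
    unfolding add.IH[OF M]
    by (rule RG.finprod_count_add_mset[OF k M, symmetric]) (use gr_gen_closed in auto)
  finally show ?case .
qed

lemma int_multiple_in_subgroup:
  assumes S: "subgroup S (add_monoid R)" and y: "(\<lambda>g\<in>carrier G. y g) \<in> S"
  shows "(\<lambda>g\<in>carrier G. of_int c * y g) \<in> S"
proof -
  have nat: "(\<lambda>g\<in>carrier G. of_nat j * z g) \<in> S" if "(\<lambda>g\<in>carrier G. z g) \<in> S" for z and j :: nat
  proof (induction j)
    case 0
    show ?case using subgroup.one_closed[OF S] by (simp only: of_nat_0 mult_zero_left R_sel monoid.simps)
  next
    case (Suc j)
    have "(\<lambda>g\<in>carrier G. of_nat (Suc j) * z g) = (\<lambda>g\<in>carrier G. z g) \<oplus>\<^bsub>R\<^esub> (\<lambda>g\<in>carrier G. of_nat j * z g)"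
      unfolding R_sel by (rule restrict_ext) (simp add: distrib_right)
    then show ?case using subgroup.m_closed[OF S that Suc.IH] by (simp only: monoid.simps)
  qed
  show ?thesis
  proof (cases "c \<ge> 0")
    case True
    from nat[OF y, of "nat c"] show ?thesis using True by (simp only: of_nat_nat)
  next
    case False
    have "(\<lambda>g\<in>carrier G. y g) \<in> range comb"
      using subsetD[OF subgroup.subset[OF S] y] unfolding carrier_R[symmetric] by simp
    then obtain c' where c': "(\<lambda>g\<in>carrier G. y g) = comb c'" by (rule rangeE)
    have "\<ominus>\<^bsub>R\<^esub> (\<lambda>g\<in>carrier G. y g) = (\<lambda>g\<in>carrier G. - y g)"
      unfolding c' R_neg comb_neg[symmetric] unfolding c'[symmetric] by (rule restrict_ext) simp
    with subgroup.m_inv_closed[OF S y] have "(\<lambda>g\<in>carrier G. - y g) \<in> S"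
      by (simp only: a_inv_def)
    from nat[OF this, of "nat (- c)"]
    have "(\<lambda>g\<in>carrier G. of_int (- c) * - y g) \<in> S" using False by (simp only: of_nat_nat)
    then show ?thesis by (simp only: of_int_minus minus_mult_minus)
  qed
qed

text \<open>The y in \<open>J d\<close> whose class is generated form a subgroup, so spanning
  monomials suffice: those of degree exactly d give products of generators, those of higher degree
  have class zero.\<close>

lemma cls_in_generate:
  assumes "y \<in> J d"
  shows "cls d y \<in> generate_ring RG (gr_gen ` K)"
proof -
  let ?g = "generate_ring RG (gr_gen ` K)"
  define S where "S = {y \<in> J d. cls d y \<in> ?g}"
  have zero: "\<zero>\<^bsub>RG\<^esub> \<in> ?g" by (rule RG.zero_in_generate)
  have S: "subgroup S (add_monoid R)"
  proof (rule group.subgroupI[OF R.a_group])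
    show "S \<subseteq> carrier (add_monoid R)" using J_carrier by (auto simp: S_def)
    have "\<zero>\<^bsub>R\<^esub> \<in> S" by (simp add: S_def J_zero' cls_vanish[OF J_zero'] zero)
    then show "S \<noteq> {}" by blast
    fix x assume x: "x \<in> S"
    then have xJ: "x \<in> J d" by (simp add: S_def)
    have "cls d (\<ominus>\<^bsub>R\<^esub> x) \<oplus>\<^bsub>RG\<^esub> cls d x = \<zero>\<^bsub>RG\<^esub>"
      using cls_add[OF J_minus[OF xJ] xJ] cls_vanish[OF J_zero'] J_carrier[OF xJ] by (simp add: R.l_neg)
    then have "cls d (\<ominus>\<^bsub>R\<^esub> x) = \<ominus>\<^bsub>RG\<^esub> cls d x"
      by (intro RG.minus_equality[symmetric] cls_closed J_minus xJ)
    then have "\<ominus>\<^bsub>R\<^esub> x \<in> S"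
      using x J_minus[OF xJ] generate_ring.a_inv[of "cls d x" RG] by (simp add: S_def)
    then show "inv\<^bsub>add_monoid R\<^esub> x \<in> S" by (simp only: a_inv_def)
    fix z assume z: "z \<in> S"
    then show "x \<otimes>\<^bsub>add_monoid R\<^esub> z \<in> S"
      using x J_plus cls_add generate_ring.eng_add by (auto simp: S_def)
  qed
  have mon: "Jmon M \<in> S" if M: "set_mset M \<subseteq> K" "d \<le> size M" for M
  proof (cases "size M = d")
    case True
    have "cls (size M) (Jmon M) \<in> ?g"
      using M(1)
    proof (induction M)
      case empty
      have "Jmon {#} = \<one>\<^bsub>R\<^esub>" by (simp only: Jmon_def mon_empty R_sel)
      then show ?case by (simp add: cls_one generate_ring.one)
    next
      case (add k M)
      then have k: "k \<in> K" and M: "set_mset M \<subseteq> K" by simp_all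
      from cls_add_mset[OF k M]
      show ?case
        using generate_ring.eng_mult[OF generate_ring.incl[OF imageI[OF k]] add.IH[OF M]] by simp
    qed
    then show ?thesis using True Jmon_in_J[OF M] by (simp add: S_def)
  next
    case False
    then have "Jmon M \<in> J (Suc d)" using M by (intro Jmon_in_J) auto
    then show ?thesis using cls_vanish zero Jmon_in_J[OF M] by (simp add: S_def)
  qed
  from assms have "y \<in> S"
  proof (induction rule: J.induct)
    case J_zero
    show ?case using subgroup.one_closed[OF S] by (simp only: R_sel monoid.simps)
  next
    case (J_step x M c)
    have "(\<lambda>g\<in>carrier G. x g + of_int c * mon M g) =
        (\<lambda>g\<in>carrier G. x g) \<oplus>\<^bsub>R\<^esub> (\<lambda>g\<in>carrier G. of_int c * mon M g)"
      unfolding R_sel by (rule restrict_ext) simp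
    moreover have "(\<lambda>g\<in>carrier G. of_int c * mon M g) \<in> S"
      using mon[OF J_step.hyps(2,3)] unfolding Jmon_def by (rule int_multiple_in_subgroup[OF S])
    ultimately show ?case
      using subgroup.m_closed[OF S J_step.IH] by (simp only: monoid.simps)
  qed
  then show ?thesis by (simp add: S_def)
qed

lemma generate_ring_gr_gen: "generate_ring RG (gr_gen ` K) = carrier RG"
proof (intro equalityI)
  show "generate_ring RG (gr_gen ` K) \<subseteq> carrier RG"
    by (rule RG.generate_ring_incl) (use gr_gen_closed in auto)
  have step: "cosets u \<in> generate_ring RG (gr_gen ` K)" if "u \<in> rees" "\<forall>i\<ge>N. u i = \<zero>\<^bsub>R\<^esub>" for u N
    using that
  proof (induction N arbitrary: u)
    case 0
    then have "u = \<zero>\<^bsub>UP R\<^esub>" by (auto simp: UP_zero)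
    then show ?case by (simp only: cosets_zero RG.zero_in_generate)
  next
    case (Suc N)
    \<comment> \<open>The coefficient in degree \<open>N\<close> is split off: the rest has a
      smaller degree bound, and the removed part is a homogeneous class.\<close>
    define v where "v = u(N := \<zero>\<^bsub>R\<^esub>)"
    have vN: "\<forall>i\<ge>N. v i = \<zero>\<^bsub>R\<^esub>" using Suc.prems(2) by (auto simp: v_def)
    have "bound \<zero>\<^bsub>R\<^esub> N v" using vN by (auto simp: bound_def)
    moreover have vJ: "v n \<in> J n" for n
      using rees_J[OF Suc.prems(1), of n] J_zero' by (simp add: v_def)
    ultimately have v: "v \<in> rees"
      using J_carrier[OF vJ] by (auto simp: rees_def UP_def up_def)
    have uN: "u N \<in> J N" by (rule rees_J[OF Suc.prems(1)])
    have "u = v \<oplus>\<^bsub>UP R\<^esub> UnivPoly.monom (UP R) (u N) N"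
    proof
      fix i
      show "u i = (v \<oplus>\<^bsub>UP R\<^esub> UnivPoly.monom (UP R) (u N) N) i"
        unfolding UP_sel(1)[OF rees_UP[OF v] rees_UP[OF monom_rees[OF uN]]]
        unfolding monom_apply[OF J_carrier[OF uN]]
        using J_carrier[OF rees_J[OF Suc.prems(1), of i]] J_carrier[OF uN] by (simp add: v_def)
    qed
    then have "cosets u = cosets v \<oplus>\<^bsub>RG\<^esub> cls N (u N)"
      using ring_hom_add[OF cosets_hom, of v "UnivPoly.monom (UP R) (u N) N"] v monom_rees[OF uN]
      by (simp add: cls_def)
    then show ?case
      using generate_ring.eng_add[OF Suc.IH[OF v vN] cls_in_generate[OF uN]] by (simp only:)
  qed
  show "carrier RG \<subseteq> generate_ring RG (gr_gen ` K)"
  proof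
    fix w assume "w \<in> carrier RG"
    then obtain u where u: "u \<in> rees" "w = cosets u" unfolding cosets_surj[symmetric] by auto
    obtain N where "bound \<zero>\<^bsub>R\<^esub> N u" using rees_UP[OF u(1)] by (auto simp: UP_def up_def)
    then have "\<forall>i\<ge>Suc N. u i = \<zero>\<^bsub>R\<^esub>" by (simp add: bound_def Suc_le_eq)
    then show "w \<in> generate_ring RG (gr_gen ` K)" using step[OF u(1)] u(2) by simp
  qed
qed

end

section \<open>Products of cyclic groups of prime power order\<close>

context self_dual_group
begin

text \<open>Multiplication by \<chi>_e translates the coefficient function, so multiplication by
  \<chi>_e - 1 is a difference operator on coefficients.\<close>

lemma comb_shift:
  assumes e: "e \<in> carrier G"
  shows "(\<lambda>g\<in>carrier G. (\<chi> e g - 1) * comb c g) = comb (\<lambda>a. c (inv e \<otimes> a) - c a)"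
proof (rule comb_eqI)
  fix g assume g: "g \<in> carrier G"
  have "\<chi> e g * comb c g = (\<Sum>a\<in>carrier G. of_int (c (inv e \<otimes> (e \<otimes> a))) * \<chi> (e \<otimes> a) g)"
    unfolding comb_apply[OF g] sum_distrib_left
    by (rule sum.cong[OF refl]) (simp add: e g chi_mult m_assoc[symmetric])
  also have "\<dots> = (\<Sum>a\<in>carrier G. of_int (c (inv e \<otimes> a)) * \<chi> a g)"
    by (rule sum_translate[OF e])
  finally show "(\<lambda>g\<in>carrier G. (\<chi> e g - 1) * comb c g) g = comb (\<lambda>a. c (inv e \<otimes> a) - c a) g"
    using g by (simp add: comb_apply left_diff_distrib sum_subtractf)
qed simp

end

text \<open>In r binom(q, r) = q binom(q - 1, r - 1) with q = p^i, a binomial coefficient prime to p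
  would force q to divide r, against 0 < r < q.\<close>

lemma prime_dvd_choose_prime_power:
  fixes p :: nat
  assumes "normalization_semidom_class.prime p" "0 < r" "r < p ^ i"
  shows "p dvd (p ^ i choose r)"
proof (rule ccontr)
  assume "\<not> p dvd (p ^ i choose r)"
  then have "coprime (p ^ i) (p ^ i choose r)"
    using assms(1) by (simp add: prime_imp_coprime)
  moreover have "p ^ i dvd r * (p ^ i choose r)"
    using binomial_absorption[of "r - 1" "p ^ i"] assms(2) by simp
  ultimately have "p ^ i dvd r"
    by (simp add: coprime_dvd_mult_left_iff)
  then show False using assms by (auto dest: dvd_imp_le)
qed

text \<open>Pascal's rule with the upper entry taken cyclically modulo q = p^i. It survives the jump
  from q - 1 to 0 because p divides binom(q, r) for 0 < r < q.\<close>

lemma cong_choose_succ_mod_prime_power: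
  fixes p :: nat and a :: int
  assumes p: "normalization_semidom_class.prime p" and r: "r < p ^ i" and a: "0 \<le> a" "a < int (p ^ i)"
  shows "[int (nat ((1 + a) mod int (p ^ i)) choose r) - int (nat a choose r) =
    (if r = 0 then 0 else int (nat a choose (r - 1)))] (mod int p)"
proof (cases r)
  case 0
  then show ?thesis by simp
next
  case (Suc s)
  have nat_a: "nat (1 + a) = Suc (nat a)" using a by simp
  show ?thesis
  proof (cases "1 + a < int (p ^ i)")
    case True
    then have "(1 + a) mod int (p ^ i) = 1 + a" using a by simp
    then show ?thesis using Suc nat_a by simp
  next
    \<comment> \<open>Wrap-around: a = q - 1 and the new upper entry is 0, so the difference is
      minus binom(q - 1, r); Pascal's rule for binom(q, r) = 0 modulo p turns it into binom(q - 1, r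
      - 1).\<close>
    case False
    then have eq: "1 + a = int (p ^ i)" using a by linarith
    then have q: "Suc (nat a) = p ^ i" using nat_a by (metis nat_int)
    have "p dvd (p ^ i choose r)"
      by (rule prime_dvd_choose_prime_power[OF p _ r]) (simp add: Suc)
    then have "[int (p ^ i choose r) = 0] (mod int p)"
      by (simp add: cong_0_iff)
    then have "[int (nat a choose s) + int (nat a choose Suc s) = 0] (mod int p)"
      unfolding q[symmetric] Suc by simp
    then have "[0 - int (nat a choose Suc s) = int (nat a choose s)] (mod int p)"
      by (simp add: cong_iff_dvd_diff) (metis add.commute dvd_minus_iff minus_add_distrib uminus_add_conv_diff)
    then show ?thesis using Suc eq by simp
  qed
qed

section \<open>The concrete group and its self-pairing\<close>

locale prime_power_product =
  fixes p :: nat and K :: "'k set" and i :: "'k \<Rightarrow> nat"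
  assumes prime_p: "normalization_semidom_class.prime p" and finite_index: "finite K"
    and i_pos: "\<And>k. k \<in> K \<Longrightarrow> 1 \<le> i k"
begin

definition q :: "'k \<Rightarrow> nat" where
  "q k = p ^ i k"

definition A :: "('k \<Rightarrow> int) monoid" where
  "A = product_group K (\<lambda>k. integer_mod_group (q k))"

text \<open>The exponential of 2 pi i \<Sum> a_k g_k / q_k. Being symmetric in a and g, it realises
  the self-duality of the group.\<close>

definition pair :: "('k \<Rightarrow> int) \<Rightarrow> ('k \<Rightarrow> int) \<Rightarrow> complex" where
  "pair a g = (\<Prod>k\<in>K. cis (2 * pi * (of_int (a k * g k) / of_nat (q k))))"

definition unit :: "'k \<Rightarrow> 'k \<Rightarrow> int" where
  "unit k = (\<lambda>j\<in>K. if j = k then 1 else 0)"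

lemma q_gt_1: "k \<in> K \<Longrightarrow> 1 < q k"
  unfolding q_def using i_pos[of k] prime_gt_1_nat[OF prime_p] by (intro one_less_power) auto

lemma q_pos: "0 < q k"
  unfolding q_def using prime_gt_0_nat[OF prime_p] by simp

lemma int_q_gt_1:
  assumes "k \<in> K"
  shows "1 < int (q k)"
  unfolding of_nat_1[symmetric, where 'a = int] of_nat_less_iff by (rule q_gt_1[OF assms])

lemma A_sel:
  "carrier A = (\<Pi>\<^sub>E k\<in>K. {0..<int (q k)})"
  "x \<otimes>\<^bsub>A\<^esub> y = (\<lambda>k\<in>K. (x k + y k) mod int (q k))"
  "\<one>\<^bsub>A\<^esub> = (\<lambda>k\<in>K. 0)"
proof -
  show "carrier A = (\<Pi>\<^sub>E k\<in>K. {0..<int (q k)})"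
    using q_pos unfolding A_def carrier_product_group
    by (intro PiE_cong) (simp add: carrier_integer_mod_group)
qed (simp_all add: A_def)

text \<open>Changing an entry by a multiple of q_k changes the angle by a multiple of 2 pi; so the
  group law, which reduces modulo q_k, becomes multiplication of values.\<close>

lemma cis_mod:
  assumes "k \<in> K"
  shows "cis (2 * pi * (of_int (c mod int (q k) * g) / of_nat (q k))) = cis (2 * pi * (of_int (c * g) / of_nat (q k)))"
proof -
  let ?q = "int (q k)"
  have q0: "real (q k) \<noteq> 0" using q_pos[of k] by simp
  have "c * g = (c div ?q * ?q + c mod ?q) * g"
    by (simp only: div_mult_mod_eq)
  also have "\<dots> = (c div ?q * g) * ?q + c mod ?q * g"
    by (simp only: distrib_right mult.assoc mult.commute[of g])
  finally have "c * g = (c div ?q * g) * ?q + c mod ?q * g" .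
  from arg_cong[OF this, of real_of_int] have "(of_int (c * g) :: real) = of_int (c div ?q * g) * real (q k) + of_int (c mod ?q * g)"
    by (simp only: of_int_add of_int_mult of_int_of_nat_eq)
  then have "2 * pi * (of_int (c * g) / real (q k)) =
      2 * pi * of_int (c div ?q * g) + 2 * pi * (of_int (c mod ?q * g) / real (q k))"
    using q0 by (simp add: field_simps)
  then have "cis (2 * pi * (of_int (c * g) / real (q k))) =
      cis (2 * pi * of_int (c div ?q * g)) * cis (2 * pi * (of_int (c mod ?q * g) / real (q k)))"
    by (simp only: cis_mult)
  also have "cis (2 * pi * of_int (c div ?q * g)) = 1"
    by (rule cis_multiple_2pi) simp
  finally show ?thesis by simp
qed

text \<open>The assumption that the exponents are at least 1 enters here: the entry 1 is a reduced
  residue only if q_k > 1.\<close>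

lemma unit_closed: "unit k \<in> carrier A"
  unfolding A_sel unit_def restrict_PiE_iff
proof
  fix j assume "j \<in> K"
  from int_q_gt_1[OF this] show "(if j = k then 1 else 0) \<in> {0..<int (q j)}"
    by (cases "j = k") simp_all
qed

lemma pair_sym: "pair a g = pair g a"
  by (simp add: pair_def mult.commute)

lemma pair_unit:
  assumes "k \<in> K"
  shows "pair (unit k) g = cis (2 * pi * (of_int (g k) / of_nat (q k)))"
proof -
  have "pair (unit k) g = (\<Prod>j\<in>K. if j = k then cis (2 * pi * (of_int (g j) / of_nat (q j))) else 1)"
    unfolding pair_def by (rule prod.cong) (simp_all add: unit_def)
  then show ?thesis using assms finite_index by simp
qed

sublocale A: generated_self_dual_group A pair K unit
proof -
  interpret A: comm_group A
  proof (rule group.group_comm_groupI)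
    show "group A" by (simp add: A_def)
    show "x \<otimes>\<^bsub>A\<^esub> y = y \<otimes>\<^bsub>A\<^esub> x" for x y by (simp add: A_sel add.commute)
  qed
  show "generated_self_dual_group A pair K unit"
  proof unfold_locales
    show "finite (carrier A)" by (simp add: A_sel finite_PiE finite_index)
    fix a g
    show "pair a g = pair g a" by (rule pair_sym)
    show "pair a g \<noteq> 0" by (simp add: pair_def finite_index cis_neq_zero)
    fix b
    show "pair (a \<otimes>\<^bsub>A\<^esub> b) g = pair a g * pair b g"
    proof -
      have "cis (2 * pi * (of_int ((a \<otimes>\<^bsub>A\<^esub> b) k * g k) / of_nat (q k))) =
          cis (2 * pi * (of_int (a k * g k) / of_nat (q k))) * cis (2 * pi * (of_int (b k * g k) / of_nat (q k)))"
        if k: "k \<in> K" for k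
      proof -
        have "cis (2 * pi * (of_int ((a \<otimes>\<^bsub>A\<^esub> b) k * g k) / of_nat (q k))) =
            cis (2 * pi * (of_int ((a k + b k) * g k) / of_nat (q k)))"
          using k cis_mod[OF k, of "a k + b k" "g k"] by (simp only: A_sel restrict_apply')
        also have "2 * pi * (of_int ((a k + b k) * g k) / of_nat (q k)) =
            2 * pi * (of_int (a k * g k) / of_nat (q k)) + 2 * pi * (of_int (b k * g k) / of_nat (q k))"
          by (simp add: distrib_right distrib_left add_divide_distrib)
        finally show ?thesis by (simp only: cis_mult)
      qed
      then show ?thesis by (simp add: pair_def prod.distrib)
    qed
  next
    fix a assume a: "a \<in> carrier A" and triv: "\<And>g. g \<in> carrier A \<Longrightarrow> pair a g = 1"
    \<comment> \<open>Pairing with \<open>unit k\<close> gives the exponential of 2 pi i a_k / q_k;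
      if it is 1, then q_k divides a_k, and the representative is 0.\<close>
    have "a k = 0" if k: "k \<in> K" for k
    proof -
      have ak: "0 \<le> a k" "a k < int (q k)" using a k by (auto simp: A_sel PiE_iff)
      have "cis (2 * pi * (of_int (a k) / of_nat (q k))) = 1"
        using triv[OF unit_closed[of k]] pair_sym[of a "unit k"] pair_unit[OF k, of a] by simp
      then have "cos (2 * pi * (of_int (a k) / of_nat (q k))) = 1"
        by (metis cis.sel(1) one_complex.sel(1))
      from this[unfolded cos_one_2pi_int] obtain z :: int where
        "2 * pi * (of_int (a k) / of_nat (q k)) = of_int z * 2 * pi" ..
      then have "2 * pi * (of_int (a k) / of_nat (q k)) = 2 * pi * of_int z"
        by (simp only: mult_ac)
      then have "of_int (a k) / of_nat (q k) = (of_int z :: real)"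
        by (rule mult_left_cancel[THEN iffD1, rotated]) simp
      then have "real_of_int (a k) = of_int z * of_nat (q k)"
        using q_pos[of k] by (simp add: divide_eq_eq)
      then have "real_of_int (a k) = of_int (z * int (q k))" by simp
      then have "a k = z * int (q k)" by (simp only: of_int_eq_iff)
      then have "a k mod int (q k) = 0" by simp
      then show ?thesis using mod_pos_pos_trivial[OF ak] by simp
    qed
    then show "a = \<one>\<^bsub>A\<^esub>"
      using a unfolding A_sel by (intro extensionalityI[of _ K]) (auto simp: PiE_iff)
  next
    show "finite K" by (rule finite_index)
    show "unit k \<in> carrier A" for k by (rule unit_closed)
    fix a assume a: "a \<in> carrier A"
    have "pair a g = (\<Prod>k\<in>K. pair (unit k) g ^ nat (a k))" for g
      unfolding pair_def[of a]
    proof (rule prod.cong[OF refl])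
      fix k assume k: "k \<in> K"
      then have "0 \<le> a k" using a by (auto simp: A_sel PiE_iff)
      then have "real (nat (a k)) = of_int (a k)" by simp
      then show "cis (2 * pi * (of_int (a k * g k) / of_nat (q k))) = pair (unit k) g ^ nat (a k)"
        by (simp add: pair_unit[OF k] DeMoivre mult_ac)
    qed
    then show "\<exists>m :: 'k \<Rightarrow> nat. \<forall>g\<in>carrier A. pair a g = (\<Prod>k\<in>K. pair (unit k) g ^ m k)"
      by (intro exI[of _ "\<lambda>k. nat (a k)"]) simp
  qed
qed

section \<open>Coefficient functionals and their values on monomials modulo p\<close>

definition binom :: "'k multiset \<Rightarrow> ('k \<Rightarrow> int) \<Rightarrow> int" where
  "binom m a = (\<Prod>k\<in>K. int (nat (a k) choose count m k))"

text \<open>The coefficient of X^m after expanding each \<chi>^a with the reduced exponents of a.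
  The relation X_k^q_k = 0, which makes this compatible with multiplication, holds only modulo p,
  whence an integer studied up to congruence.\<close>

definition ell :: "'k multiset \<Rightarrow> (('k \<Rightarrow> int) \<Rightarrow> complex) \<Rightarrow> int" where
  "ell m x = (\<Sum>a\<in>carrier A. A.coef x a * binom m a)"

lemma ell_comb: "ell m (A.comb c) = (\<Sum>a\<in>carrier A. c a * binom m a)"
  unfolding ell_def by (rule sum.cong[OF refl]) (simp add: A.coef_comb)

lemma ell_add:
  assumes "x \<in> A.J d" "y \<in> A.J d'"
  shows "ell m (x \<oplus>\<^bsub>char_ring A\<^esub> y) = ell m x + ell m y"
proof -
  obtain c where c: "x = A.comb c" using assms(1) by (rule A.J_combE)
  obtain c' where c': "y = A.comb c'" using assms(2) by (rule A.J_combE)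
  show ?thesis
    unfolding c c' A.R_sel A.comb_add ell_comb by (simp add: distrib_right sum.distrib)
qed

text \<open>Only the k-th factor changes under translation by \<open>unit k\<close>, and there the
  cyclic Pascal rule applies; the bound on the exponents of \<open>m\<close> is what that rule
  requires. Differencing in direction k thus lowers m by one k.\<close>

lemma binom_translate:
  assumes m: "\<And>j. j \<in> K \<Longrightarrow> count m j < q j" and k: "k \<in> K" and a: "a \<in> carrier A"
  shows "[binom m (unit k \<otimes>\<^bsub>A\<^esub> a) - binom m a = (if k \<in># m then binom (m - {#k#}) a else 0)] (mod int p)"
proof -
  have ak: "0 \<le> a j" "a j < int (q j)" if "j \<in> K" for j
    using a that by (auto simp: A_sel PiE_iff)
  let ?P = "\<Prod>j\<in>K - {k}. int (nat (a j) choose count m j)"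
  have split: "binom m' b = int (nat (b k) choose count m' k) * (\<Prod>j\<in>K - {k}. int (nat (b j) choose count m' j))" for m' b
    unfolding binom_def by (rule prod.remove[OF finite_index k])
  have "(\<Prod>j\<in>K - {k}. int (nat ((unit k \<otimes>\<^bsub>A\<^esub> a) j) choose count m j)) = ?P"
    using ak by (intro prod.cong refl) (simp add: A_sel unit_def)
  moreover have "(unit k \<otimes>\<^bsub>A\<^esub> a) k = (1 + a k) mod int (q k)"
    using k by (simp add: A_sel unit_def)
  ultimately have "binom m (unit k \<otimes>\<^bsub>A\<^esub> a) - binom m a =
      (int (nat ((1 + a k) mod int (q k)) choose count m k) - int (nat (a k) choose count m k)) * ?P"
    unfolding split[of m] by (simp only: left_diff_distrib)
  moreover have "[(int (nat ((1 + a k) mod int (q k)) choose count m k) - int (nat (a k) choose count m k)) * ?P =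
      (if count m k = 0 then 0 else int (nat (a k) choose (count m k - 1))) * ?P] (mod int p)"
    unfolding q_def
    by (intro cong_mult cong_refl cong_choose_succ_mod_prime_power prime_p m[unfolded q_def] k ak[unfolded q_def])
  moreover have "(if count m k = 0 then 0 else int (nat (a k) choose (count m k - 1))) * ?P =
      (if k \<in># m then binom (m - {#k#}) a else 0)"
  proof -
    have P: "(\<Prod>j\<in>K - {k}. int (nat (a j) choose count (m - {#k#}) j)) = ?P"
      by (intro prod.cong refl) auto
    show ?thesis
    proof (cases "k \<in># m")
      case True
      then have "(count m k = 0) = False" using not_in_iff by metis
      moreover have "count (m - {#k#}) k = count m k - 1" by simp
      ultimately show ?thesis
        by (simp only: True split[of "m - {#k#}"] P if_True if_False)
    next
      case False
      then have "count m k = 0" by (simp only: not_in_iff)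
      with False show ?thesis by simp
    qed
  qed
  ultimately show ?thesis by (simp only:)
qed

text \<open>Summation by parts: multiplying by X_k differences the coefficients, and reindexing the
  sum moves the difference onto the binomial weights.\<close>

lemma ell_step:
  assumes m: "\<And>j. j \<in> K \<Longrightarrow> count m j < q j" and k: "k \<in> K"
  shows "[ell m (\<lambda>g\<in>carrier A. (pair (unit k) g - 1) * A.comb c g) =
    (if k \<in># m then ell (m - {#k#}) (A.comb c) else 0)] (mod int p)"
proof -
  have "ell m (\<lambda>g\<in>carrier A. (pair (unit k) g - 1) * A.comb c g) =
      (\<Sum>a\<in>carrier A. c (inv\<^bsub>A\<^esub> unit k \<otimes>\<^bsub>A\<^esub> a) * binom m a) - (\<Sum>a\<in>carrier A. c a * binom m a)"
    unfolding A.comb_shift[OF unit_closed] ell_comb by (simp add: left_diff_distrib sum_subtractf)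
  also have "(\<Sum>a\<in>carrier A. c (inv\<^bsub>A\<^esub> unit k \<otimes>\<^bsub>A\<^esub> a) * binom m a) =
      (\<Sum>a\<in>carrier A. c (inv\<^bsub>A\<^esub> unit k \<otimes>\<^bsub>A\<^esub> (unit k \<otimes>\<^bsub>A\<^esub> a)) * binom m (unit k \<otimes>\<^bsub>A\<^esub> a))"
    by (rule A.sum_translate[OF unit_closed, symmetric])
  also have "\<dots> = (\<Sum>a\<in>carrier A. c a * binom m (unit k \<otimes>\<^bsub>A\<^esub> a))"
    by (rule sum.cong[OF refl]) (simp add: unit_closed A.m_assoc[symmetric])
  also have "\<dots> - (\<Sum>a\<in>carrier A. c a * binom m a) =
      (\<Sum>a\<in>carrier A. c a * (binom m (unit k \<otimes>\<^bsub>A\<^esub> a) - binom m a))"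
    by (simp add: right_diff_distrib sum_subtractf)
  finally have "ell m (\<lambda>g\<in>carrier A. (pair (unit k) g - 1) * A.comb c g) =
      (\<Sum>a\<in>carrier A. c a * (binom m (unit k \<otimes>\<^bsub>A\<^esub> a) - binom m a))" .
  moreover have "[(\<Sum>a\<in>carrier A. c a * (binom m (unit k \<otimes>\<^bsub>A\<^esub> a) - binom m a)) =
      (\<Sum>a\<in>carrier A. c a * (if k \<in># m then binom (m - {#k#}) a else 0))] (mod int p)"
    by (intro cong_sum cong_mult cong_refl binom_translate m k)
  moreover have "(\<Sum>a\<in>carrier A. c a * (if k \<in># m then binom (m - {#k#}) a else 0)) =
      (if k \<in># m then ell (m - {#k#}) (A.comb c) else 0)"
    by (simp add: ell_comb)
  ultimately show ?thesis by (simp only:)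
qed

text \<open>Each factor X_k of the monomial is traded for one k in m, or yields 0 if m has none.
  What remains is the value at the constant 1, which is nonzero only if m has been used up exactly.
  As m shrinks along the way, it is generalised in the induction.\<close>

lemma ell_Jmon:
  assumes "set_mset M \<subseteq> K" "set_mset m \<subseteq> K" "\<And>j. j \<in> K \<Longrightarrow> count m j < q j"
  shows "[ell m (A.Jmon M) = (if M = m then 1 else 0)] (mod int p)"
  using assms
proof (induction M arbitrary: m)
  case empty
  have "A.Jmon {#} = A.comb (\<lambda>b. if b = \<one>\<^bsub>A\<^esub> then 1 else 0)"
    using A.comb_const[of 1] by (simp only: A.Jmon_def A.mon_empty of_int_1)
  then have "ell m (A.Jmon {#}) = (\<Sum>a\<in>carrier A. if a = \<one>\<^bsub>A\<^esub> then binom m a else 0)"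
    by (simp only: ell_comb) (rule sum.cong[OF refl], simp)
  also have "\<dots> = binom m \<one>\<^bsub>A\<^esub>"
    using A.finite_carrier A.one_closed by simp
  \<comment> \<open>At the identity all upper entries are 0, and 0 choose r vanishes unless r =
    0.\<close>
  also have "\<dots> = (\<Prod>k\<in>K. if k \<in># m then 0 else 1)"
    unfolding binom_def by (rule prod.cong[OF refl]) (auto simp: A_sel not_in_iff binomial_eq_0_iff)
  also have "\<dots> = (if {#} = m then 1 else 0)"
  proof (cases "m = {#}")
    case False
    then obtain k where "k \<in># m" by auto
    then show ?thesis
      using False empty.prems(2) finite_index by (auto intro!: prod_zero)
  qed simp
  finally show ?case by simp
next
  case (add k M)
  then have k: "k \<in> K" and M: "set_mset M \<subseteq> K" by simp_all
  obtain c where c: "A.Jmon M = A.comb c"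
    using A.Jmon_in_J[OF M order_refl] by (rule A.J_combE)
  have "A.Jmon (add_mset k M) = (\<lambda>g\<in>carrier A. (pair (unit k) g - 1) * A.comb c g)"
    unfolding c[symmetric] A.Jmon_def A.mon_add_mset by (rule restrict_ext) simp
  then have step: "[ell m (A.Jmon (add_mset k M)) = (if k \<in># m then ell (m - {#k#}) (A.Jmon M) else 0)] (mod int p)"
    using ell_step[OF add.prems(3) k, of c] unfolding c by (simp only:)
  show ?case
  proof (cases "k \<in># m")
    case True
    have "set_mset (m - {#k#}) \<subseteq> K" using add.prems(2) in_diffD by fastforce
    moreover have "count (m - {#k#}) j < q j" if "j \<in> K" for j
      by (rule le_less_trans[OF _ add.prems(3)[OF that]]) simp
    ultimately have "[ell (m - {#k#}) (A.Jmon M) = (if M = m - {#k#} then 1 else 0)] (mod int p)"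
      by (rule add.IH[OF M])
    moreover have "M = m - {#k#} \<longleftrightarrow> add_mset k M = m" using True by auto
    ultimately show ?thesis
      using step True by (simp only: if_True) (rule cong_trans)
  next
    case False
    then have "add_mset k M \<noteq> m" by auto
    then show ?thesis using step False by simp
  qed
qed

lemma ell_zero: "ell m \<zero>\<^bsub>char_ring A\<^esub> = 0"
  unfolding A.R_sel A.comb_zero ell_comb by simp

lemma ell_int_mult:
  assumes "set_mset M \<subseteq> K"
  shows "ell m (\<lambda>g\<in>carrier A. of_int z * A.mon M g) = z * ell m (A.Jmon M)"
proof -
  obtain c where c: "A.Jmon M = A.comb c"
    using A.Jmon_in_J[OF assms order_refl] by (rule A.J_combE)
  have "(\<lambda>g\<in>carrier A. of_int z * A.mon M g) = A.comb (\<lambda>a. z * c a)"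
  proof (rule A.comb_eqI)
    fix g assume g: "g \<in> carrier A"
    have "A.mon M g = A.comb c g"
      using fun_cong[OF c, of g] g by (simp only: A.Jmon_def restrict_apply')
    then show "(\<lambda>g\<in>carrier A. of_int z * A.mon M g) g = A.comb (\<lambda>a. z * c a) g"
      using g by (simp add: A.comb_apply sum_distrib_left mult.assoc)
  qed simp
  then show ?thesis
    unfolding c by (simp only: ell_comb sum_distrib_left mult.assoc)
qed

text \<open>\<open>J (Suc (size m))\<close> is spanned by monomials larger than m, hence different
  from m, and the functional for m is 0 modulo p on each of them.\<close>

lemma ell_J:
  assumes "y \<in> A.J (Suc (size m))" "set_mset m \<subseteq> K" "\<And>j. j \<in> K \<Longrightarrow> count m j < q j"
  shows "[ell m y = 0] (mod int p)"
  using assms(1)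
proof (induction rule: A.J.induct)
  case J_zero
  then show ?case using ell_zero[of m] by (simp only: A.R_sel) simp
next
  case (J_step x M c)
  have eq: "(\<lambda>g\<in>carrier A. x g + of_int c * A.mon M g) =
      (\<lambda>g\<in>carrier A. x g) \<oplus>\<^bsub>char_ring A\<^esub> (\<lambda>g\<in>carrier A. of_int c * A.mon M g)"
    unfolding A.R_sel by (rule restrict_ext) simp
  have "ell m (\<lambda>g\<in>carrier A. x g + of_int c * A.mon M g) =
      ell m (\<lambda>g\<in>carrier A. x g) + c * ell m (A.Jmon M)"
    unfolding eq ell_add[OF J_step.hyps(1) A.J_mon_mult[OF J_step.hyps(2,3)]] ell_int_mult[OF J_step.hyps(2)] ..
  moreover have "[ell m (\<lambda>g\<in>carrier A. x g) + c * ell m (A.Jmon M) = 0 + c * 0] (mod int p)"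
  proof (intro cong_add cong_mult cong_refl J_step.IH)
    have "M \<noteq> m" using J_step.hyps(3) by auto
    then show "[ell m (A.Jmon M) = 0] (mod int p)"
      using ell_Jmon[OF J_step.hyps(2) assms(2,3)] by simp
  qed
  ultimately show ?case by (simp only: mult_zero_right add_0_right)
qed

text \<open>\<open>ell\<close> evaluated on an arbitrary representative of the component in degree
  \<open>size m\<close>. The choice is harmless modulo p, since two representatives differ by an
  element of \<open>J (Suc (size m))\<close>, where \<open>ell\<close> vanishes modulo p.\<close>

definition functional :: "'k multiset \<Rightarrow> (nat \<Rightarrow> (('k \<Rightarrow> int) \<Rightarrow> complex) set) \<Rightarrow> int" where
  "functional m u = ell m (SOME y. y \<in> A.J (size m) \<and> u (size m) = A.J (Suc (size m)) +>\<^bsub>char_ring A\<^esub> y)"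

context
  fixes m :: "'k multiset"
  assumes m: "set_mset m \<subseteq> K" "\<And>j. j \<in> K \<Longrightarrow> count m j < q j"
begin

lemma functional_coset:
  assumes y: "y \<in> A.J (size m)" and u: "u (size m) = A.J (Suc (size m)) +>\<^bsub>char_ring A\<^esub> y"
  shows "[functional m u = ell m y] (mod int p)"
proof -
  define z where "z = (SOME y. y \<in> A.J (size m) \<and> u (size m) = A.J (Suc (size m)) +>\<^bsub>char_ring A\<^esub> y)"
  have z: "z \<in> A.J (size m) \<and> u (size m) = A.J (Suc (size m)) +>\<^bsub>char_ring A\<^esub> z"
  proof -
    have "\<exists>y. y \<in> A.J (size m) \<and> u (size m) = A.J (Suc (size m)) +>\<^bsub>char_ring A\<^esub> y"
      by (intro exI[of _ y] conjI y u)
    from someI_ex[OF this] show ?thesis unfolding z_def .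
  qed
  have "z \<in> A.J (Suc (size m)) +>\<^bsub>char_ring A\<^esub> z"
    using abelian_subgroup.a_rcos_self[OF A.J_abelian_subgroup] A.J_carrier z by blast
  then have "z \<in> A.J (Suc (size m)) +>\<^bsub>char_ring A\<^esub> y" using z u by simp
  then obtain h where h: "h \<in> A.J (Suc (size m))" "z = h \<oplus>\<^bsub>char_ring A\<^esub> y"
    unfolding a_r_coset_def' by blast
  have "[ell m h + ell m y = 0 + ell m y] (mod int p)"
    by (intro cong_add cong_refl ell_J[OF h(1) m])
  then show ?thesis
    unfolding functional_def z_def[symmetric] unfolding h(2) ell_add[OF h(1) y] by simp
qed

lemma carrier_coset:
  assumes "u \<in> carrier (graded_char_ring A)"
  obtains y where "y \<in> A.J d" "u d = A.J (Suc d) +>\<^bsub>char_ring A\<^esub> y"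
  using assms unfolding A.RG_sel A.graded_piece_sel by blast

lemma functional_add:
  assumes "u \<in> carrier (graded_char_ring A)" "v \<in> carrier (graded_char_ring A)"
  shows "[functional m (u \<oplus>\<^bsub>graded_char_ring A\<^esub> v) = functional m u + functional m v] (mod int p)"
proof -
  obtain y where y: "y \<in> A.J (size m)" "u (size m) = A.J (Suc (size m)) +>\<^bsub>char_ring A\<^esub> y"
    using assms(1) by (rule carrier_coset)
  obtain z where z: "z \<in> A.J (size m)" "v (size m) = A.J (Suc (size m)) +>\<^bsub>char_ring A\<^esub> z"
    using assms(2) by (rule carrier_coset)
  have "(u \<oplus>\<^bsub>graded_char_ring A\<^esub> v) (size m) = A.J (Suc (size m)) +>\<^bsub>char_ring A\<^esub> (y \<oplus>\<^bsub>char_ring A\<^esub> z)"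
    by (simp only: A.RG_sel y z A.coset_plus[OF A.J_carrier[OF y(1)] A.J_carrier[OF z(1)]])
  from functional_coset[where u = "u \<oplus>\<^bsub>graded_char_ring A\<^esub> v", OF A.J_plus[OF y(1) z(1)] this]
  have "[functional m (u \<oplus>\<^bsub>graded_char_ring A\<^esub> v) = ell m y + ell m z] (mod int p)"
    by (simp only: ell_add[OF y(1) z(1)])
  moreover have "[ell m y + ell m z = functional m u + functional m v] (mod int p)"
    by (rule cong_add[OF cong_sym[OF functional_coset[where u = u, OF y(1,2)]]
          cong_sym[OF functional_coset[where u = v, OF z(1,2)]]])
  ultimately show ?thesis by (rule cong_trans)
qed

text \<open>In equal degrees this is the value of \<open>ell\<close> on the monomial. In different
  degrees the component inspected is the zero coset, for which 0 is a representative.\<close>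

lemma functional_monomial:
  assumes M: "set_mset M \<subseteq> K"
  shows "[functional m (\<Otimes>\<^bsub>graded_char_ring A\<^esub>k\<in>set_mset M. A.gr_gen k [^]\<^bsub>graded_char_ring A\<^esub> count M k) =
    (if M = m then 1 else 0)] (mod int p)"
proof (cases "size M = size m")
  case True
  have J: "A.Jmon M \<in> A.J (size m)" using A.Jmon_in_J[OF M] True by simp
  have "A.cls (size M) (A.Jmon M) (size m) = A.J (Suc (size m)) +>\<^bsub>char_ring A\<^esub> A.Jmon M"
    using A.cls_apply[OF J] True by simp
  from cong_trans[OF functional_coset[where u = "A.cls (size M) (A.Jmon M)", OF J this] ell_Jmon[OF M m]] show ?thesis
    by (simp only: A.cls_Jmon[OF M])
next
  case False
  have "A.cls (size M) (A.Jmon M) (size m) = A.J (Suc (size m)) +>\<^bsub>char_ring A\<^esub> \<zero>\<^bsub>char_ring A\<^esub>"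
    using A.cls_apply[OF A.Jmon_in_J[OF M order_refl]] A.coset_zero[OF A.J_zero'] False by simp
  from functional_coset[where u = "A.cls (size M) (A.Jmon M)", OF A.J_zero' this]
  show ?thesis using False by (auto simp: A.cls_Jmon[OF M] ell_zero)
qed

end

text \<open>If no X_k^q_k divides m, the functional for m is available and picks out the coefficient
  of m from any relation.\<close>

lemma relation_monomial:
  defines "Fp \<equiv> residue_ring (int p)"
  assumes f: "f \<in> mpolys Fp K"
    and zero: "mpoly_eval Fp (tensor_ring (graded_char_ring A) Fp)
       (\<lambda>c. tensor (graded_char_ring A) Fp \<one>\<^bsub>graded_char_ring A\<^esub> c)
       (\<lambda>k. tensor (graded_char_ring A) Fp (A.gr_gen k) \<one>\<^bsub>Fp\<^esub>) f =
       \<zero>\<^bsub>tensor_ring (graded_char_ring A) Fp\<^esub>"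
    and m: "f m \<noteq> \<zero>\<^bsub>Fp\<^esub>"
  shows "\<exists>k\<in>K. replicate_mset (q k) k \<subseteq># m"
proof (rule ccontr)
  assume contra: "\<not> (\<exists>k\<in>K. replicate_mset (q k) k \<subseteq># m)"
  have p1: "1 < int p" using prime_gt_1_nat[OF prime_p] by simp
  interpret F: residues "int p" Fp by unfold_locales (use p1 Fp_def in simp_all)
  note supp = F.indexed_pset_support[OF f]
  have mK: "set_mset m \<subseteq> K" by (rule supp(3)[OF m])
  have count: "count m k < q k" if "k \<in> K" for k
    using contra that by (meson count_le_replicate_mset_subset_eq not_le)
  let ?P = "\<lambda>M. \<Otimes>\<^bsub>graded_char_ring A\<^esub>k\<in>set_mset M. A.gr_gen k [^]\<^bsub>graded_char_ring A\<^esub> count M k"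
  have 1: "[(\<Sum>M | f M \<noteq> \<zero>\<^bsub>Fp\<^esub>. functional m (?P M) * f M) = 0] (mod int p)"
    unfolding Fp_def
    by (rule mpoly_relation_imp_functional_zero[OF A.RG_cring p1 f[unfolded Fp_def] _ _ zero[unfolded Fp_def]])
      (use A.gr_gen_closed functional_add[OF mK count] in auto)
  have 2: "[(\<Sum>M | f M \<noteq> \<zero>\<^bsub>Fp\<^esub>. functional m (?P M) * f M) =
      (\<Sum>M | f M \<noteq> \<zero>\<^bsub>Fp\<^esub>. (if M = m then 1 else 0) * f M)] (mod int p)"
    by (intro cong_sum cong_mult cong_refl functional_monomial[OF mK count] supp(3)) auto
  have 3: "(\<Sum>M | f M \<noteq> \<zero>\<^bsub>Fp\<^esub>. (if M = m then 1 else 0) * f M) = f m"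
  proof -
    have "(\<Sum>M | f M \<noteq> \<zero>\<^bsub>Fp\<^esub>. (if M = m then 1 else 0) * f M) =
        (\<Sum>M | f M \<noteq> \<zero>\<^bsub>Fp\<^esub>. if M = m then f M else 0)"
      by (rule sum.cong) auto
    then show ?thesis using supp(1) m by simp
  qed
  have "[f m = 0] (mod int p)"
    using cong_trans[OF cong_sym[OF 2] 1] unfolding 3 .
  \<comment> \<open>Coefficients in \<open>Fp\<close> are reduced residues, so a coefficient
    congruent to 0 is 0.\<close>
  moreover have "0 \<le> f m" "f m < int p"
    using supp(2)[of m] by (simp_all add: F.res_carrier_eq)
  ultimately have "f m = 0" by (simp add: cong_def)
  then show False using m by (simp add: F.res_zero_eq)
qed

end

theorem theorem1p2:
  fixes p n :: nat and i :: "nat \<Rightarrow> nat" and G :: "(nat \<Rightarrow> int) monoid"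
    and RG :: "(nat \<Rightarrow> ((nat \<Rightarrow> int) \<Rightarrow> complex) set) ring" and Fp :: "int ring"
  assumes "normalization_semidom_class.prime p"
    and "\<forall>k\<in>{1..n}. i k \<ge> 1"
    and "G = product_group {1..n} (\<lambda>k. integer_mod_group (p ^ i k))"
    and "RG = graded_char_ring G"
    and "Fp = residue_ring (int p)"
  shows "\<exists>x. (\<forall>k\<in>{1..n}. x k \<in> homogeneous_elements G 1) \<and>
    generate_ring RG (x ` {1..n}) = carrier RG \<and>
    (\<forall>f\<in>mpolys Fp {1..n}.
       mpoly_eval Fp (tensor_ring RG Fp) (\<lambda>c. tensor RG Fp \<one>\<^bsub>RG\<^esub> c)
         (\<lambda>k. tensor RG Fp (x k) \<one>\<^bsub>Fp\<^esub>) f = \<zero>\<^bsub>tensor_ring RG Fp\<^esub> \<longrightarrow>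
       (\<forall>m. f m \<noteq> \<zero>\<^bsub>Fp\<^esub> \<longrightarrow> (\<exists>k\<in>{1..n}. replicate_mset (p ^ i k) k \<subseteq># m)))"
proof -
  interpret P: prime_power_product p "{1..n}" i
    by unfold_locales (use assms(1,2) in auto)
  have G: "G = P.A" by (simp only: assms(3) P.A_def P.q_def)
  show ?thesis
    unfolding assms(4,5) G
  proof (intro exI[of _ "P.A.gr_gen"] conjI ballI impI allI)
    show "P.A.gr_gen k \<in> homogeneous_elements P.A 1" if "k \<in> {1..n}" for k
      by (rule P.A.gr_gen_homogeneous[OF that])
    show "generate_ring (graded_char_ring P.A) (P.A.gr_gen ` {1..n}) = carrier (graded_char_ring P.A)"
      by (rule P.A.generate_ring_gr_gen)
  qed (rule P.relation_monomial[unfolded P.q_def])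
qed

end
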